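(* Let $(\mathcal V,\otimes,\mathbf 1)$ be a monoidal category with $\mathcal V$ cocomplete and $\otimes$ cocontinuous in each argument. Then the colimit functor $$\operatorname{colim}\colon\int[-,\mathcal V]\to\mathcal V,\qquad(\mathcal I,F)\mapsto\operatorname{colim}F$$ extends to a strong monoidal functor with a natural isomorphism $\mu_{F,G}\colon\operatorname{colim}F\otimes\operatorname{colim}G\cong\operatorname{colim}(F\boxtimes G)$ and an isomorphism $\eta\colon\mathbf 1\cong\operatorname{colim}( *\mapsto\mathbf 1)$.
   Context: $\int[-,\mathcal V]$ is the (contravariant) Grothendieck construction of $[-,\mathcal V]\colon\mathrm{Cat}^{\mathrm{op}}\to\mathrm{CAT}$: objects are pairs $(\mathcal I,F)$ of a small category $\mathcal I$ and a functor $F\colon\mathcal I\to\mathcal V$; a morphism $(\mathcal I,F)\to(\mathcal J,G)$ is a pair $(H,\eta)$ of a functor $H\colon\mathcal I\to\mathcal J$ and a natural transformation $\eta\colon F\Rightarrow G\circ H$; composition is $(H',\eta')\circ(H,\eta)=(H'H,\eta'H\circ\eta)$. The functor $\operatorname{colim}$ (after choosing a colimit for every small diagram) sends $(H,\eta)\colon(\mathcal I,F)\to(\mathcal J,G)$ to the unique map $\operatorname{colim}F\to\operatorname{colim}G$ whose precomposition with the colimiting cocone of $F$ at $i$ is $\eta_i$ followed by the colimiting cocone component of $G$ at $H(i)$. Monoidal structure on $\int[-,\mathcal V]$: $(\mathcal I,F)\boxtimes(\mathcal J,G)=(\mathcal I\times\mathcal J,F\boxtimes G)$ with $F\boxtimes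 G=\otimes\circ(F\times G)$, unit $( *,*\mapsto\mathbf 1)$ on the terminal category, and associator and unitors whose components are pairs consisting of those of the cartesian monoidal category $(\mathrm{Cat},\times,* )$ and the pointwise ones of $\mathcal V$. A functor is cocontinuous if it preserves small colimits. A strong monoidal functor is a lax monoidal functor (coherence maps $\mu,\eta$ satisfying associativity and left/right unitality) with $\mu$ and $\eta$ isomorphisms. *)

theory Defs
  imports "HOL-Library.FuncSet" "HOL-Library.Infinite_Typeclass"
begin

section \<open>Categories, functors, natural transformations\<close>

text \<open>
  All structure maps are extensional (equal to \<open>undefined\<close> off their domain), so that
  HOL equality of categories, functors and natural transformations is the mathematical one.
  \<open>g \<cdot>\<^bsub>C\<^esub> f\<close> is ``g after f''.
\<close>

record ('o, 'm) cat =
  Obj :: "'o set"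
  Arr :: "'m set"
  Dom :: "'m \<Rightarrow> 'o"
  Cod :: "'m \<Rightarrow> 'o"
  Ide :: "'o \<Rightarrow> 'm"
  Comp :: "'m \<Rightarrow> 'm \<Rightarrow> 'm" (infixr "\<cdot>\<index>" 75)

definition composable :: "('o, 'm, 'z) cat_scheme \<Rightarrow> 'm \<Rightarrow> 'm \<Rightarrow> bool" where
  "composable C g f \<longleftrightarrow> g \<in> Arr C \<and> f \<in> Arr C \<and> Dom C g = Cod C f"

definition hom :: "('o, 'm, 'z) cat_scheme \<Rightarrow> 'o \<Rightarrow> 'o \<Rightarrow> 'm set" where
  "hom C a b = {f \<in> Arr C. Dom C f = a \<and> Cod C f = b}"

definition category :: "('o, 'm, 'z) cat_scheme \<Rightarrow> bool" where
  "category C \<longleftrightarrow>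
     Dom C \<in> Arr C \<rightarrow>\<^sub>E Obj C \<and>
     Cod C \<in> Arr C \<rightarrow>\<^sub>E Obj C \<and>
     Ide C \<in> Obj C \<rightarrow>\<^sub>E Arr C \<and>
     (\<forall>a \<in> Obj C. Ide C a \<in> hom C a a) \<and>
     (\<forall>g f. composable C g f \<longrightarrow> g \<cdot>\<^bsub>C\<^esub> f \<in> hom C (Dom C f) (Cod C g)) \<and>
     (\<forall>g f. \<not> composable C g f \<longrightarrow> g \<cdot>\<^bsub>C\<^esub> f = undefined) \<and>
     (\<forall>f \<in> Arr C. f \<cdot>\<^bsub>C\<^esub> Ide C (Dom C f) = f \<and> Ide C (Cod C f) \<cdot>\<^bsub>C\<^esub> f = f) \<and>
     (\<forall>h g f. composable C h g \<and> composable C g f \<longrightarrow>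
        (h \<cdot>\<^bsub>C\<^esub> g) \<cdot>\<^bsub>C\<^esub> f = h \<cdot>\<^bsub>C\<^esub> (g \<cdot>\<^bsub>C\<^esub> f))"

definition is_iso :: "('o, 'm, 'z) cat_scheme \<Rightarrow> 'm \<Rightarrow> bool" where
  "is_iso C f \<longleftrightarrow> f \<in> Arr C \<and>
     (\<exists>g \<in> hom C (Cod C f) (Dom C f).
        g \<cdot>\<^bsub>C\<^esub> f = Ide C (Dom C f) \<and> f \<cdot>\<^bsub>C\<^esub> g = Ide C (Cod C f))"

record ('o1, 'm1, 'o2, 'm2) func =
  fobj :: "'o1 \<Rightarrow> 'o2"
  farr :: "'m1 \<Rightarrow> 'm2"

definition is_functor ::
  "('o1, 'm1, 'y) cat_scheme \<Rightarrow> ('o2, 'm2, 'z) cat_scheme \<Rightarrow> ('o1, 'm1, 'o2, 'm2) func \<Rightarrow> bool" where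
  "is_functor C D F \<longleftrightarrow>
     fobj F \<in> Obj C \<rightarrow>\<^sub>E Obj D \<and>
     farr F \<in> Arr C \<rightarrow>\<^sub>E Arr D \<and>
     (\<forall>f \<in> Arr C. farr F f \<in> hom D (fobj F (Dom C f)) (fobj F (Cod C f))) \<and>
     (\<forall>a \<in> Obj C. farr F (Ide C a) = Ide D (fobj F a)) \<and>
     (\<forall>g f. composable C g f \<longrightarrow> farr F (g \<cdot>\<^bsub>C\<^esub> f) = farr F g \<cdot>\<^bsub>D\<^esub> farr F f)"

definition id_functor :: "('o, 'm, 'z) cat_scheme \<Rightarrow> ('o, 'm, 'o, 'm) func" where
  "id_functor C = \<lparr>fobj = (\<lambda>a \<in> Obj C. a), farr = (\<lambda>f \<in> Arr C. f)\<rparr>"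

text \<open>The composite \<open>G \<circ> F\<close>; the first argument is the domain category of \<open>F\<close>.\<close>
definition comp_functor ::
  "('o1, 'm1, 'z) cat_scheme \<Rightarrow> ('o2, 'm2, 'o3, 'm3) func \<Rightarrow> ('o1, 'm1, 'o2, 'm2) func
    \<Rightarrow> ('o1, 'm1, 'o3, 'm3) func" where
  "comp_functor C G F =
     \<lparr>fobj = (\<lambda>a \<in> Obj C. fobj G (fobj F a)), farr = (\<lambda>f \<in> Arr C. farr G (farr F f))\<rparr>"

definition is_nat_trans ::
  "('o1, 'm1, 'y) cat_scheme \<Rightarrow> ('o2, 'm2, 'z) cat_scheme \<Rightarrow>
   ('o1, 'm1, 'o2, 'm2) func \<Rightarrow> ('o1, 'm1, 'o2, 'm2) func \<Rightarrow> ('o1 \<Rightarrow> 'm2) \<Rightarrow> bool" where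
  "is_nat_trans C D F G \<tau> \<longleftrightarrow>
     \<tau> \<in> extensional (Obj C) \<and>
     (\<forall>a \<in> Obj C. \<tau> a \<in> hom D (fobj F a) (fobj G a)) \<and>
     (\<forall>f \<in> Arr C. \<tau> (Cod C f) \<cdot>\<^bsub>D\<^esub> farr F f = farr G f \<cdot>\<^bsub>D\<^esub> \<tau> (Dom C f))"

definition prod_cat ::
  "('o1, 'm1, 'y) cat_scheme \<Rightarrow> ('o2, 'm2, 'z) cat_scheme \<Rightarrow> ('o1 \<times> 'o2, 'm1 \<times> 'm2) cat" where
  "prod_cat C D =
     \<lparr>Obj = Obj C \<times> Obj D,
      Arr = Arr C \<times> Arr D,
      Dom = (\<lambda>(f, g) \<in> Arr C \<times> Arr D. (Dom C f, Dom D g)),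
      Cod = (\<lambda>(f, g) \<in> Arr C \<times> Arr D. (Cod C f, Cod D g)),
      Ide = (\<lambda>(a, b) \<in> Obj C \<times> Obj D. (Ide C a, Ide D b)),
      Comp = (\<lambda>(f', g') (f, g). if composable C f' f \<and> composable D g' g
                then (f' \<cdot>\<^bsub>C\<^esub> f, g' \<cdot>\<^bsub>D\<^esub> g) else undefined)\<rparr>"


section \<open>Small categories\<close>

text \<open>
  An infinite type \<open>'u\<close> plays the role of the universe: a set of elements of \<open>'u\<close> is small if
  its cardinality is strictly below that of \<open>'u\<close>. For a Grothendieck universe \<open>U\<close>
  and \<open>A \<subseteq> U\<close> this says exactly \<open>A \<in> U\<close>; in general, ``small'' means
  ``\<open>\<kappa>\<close>-small'' for the infinite cardinal \<open>\<kappa> = |'u|\<close>.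
\<close>

definition small :: "'u::infinite set \<Rightarrow> bool" where
  "small A \<longleftrightarrow> (card_of A, card_of (UNIV :: 'u set)) \<in> ordLess"

definition small_category :: "('u::infinite, 'u) cat \<Rightarrow> bool" where
  "small_category I \<longleftrightarrow> category I \<and> small (Obj I) \<and> small (Arr I)"

text \<open>A pairing on \<open>'u\<close>, so that products of small categories again live on \<open>'u\<close>.\<close>

definition upair :: "'u::infinite \<times> 'u \<Rightarrow> 'u" where
  "upair = (SOME p. bij p)"

lemma bij_upair: "bij (upair :: 'u::infinite \<times> 'u \<Rightarrow> 'u)"
proof -
  have "(card_of ((UNIV::'u set) \<times> (UNIV::'u set)), card_of (UNIV::'u set)) \<in> ordIso"
    by (rule card_of_Times_same_infinite) (rule infinite_UNIV)
  then obtain p :: "'u \<times> 'u \<Rightarrow> 'u" where "bij_betw p (UNIV \<times> UNIV) UNIV"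
    using card_of_ordIso by blast
  then have "bij p"
    by simp
  then show ?thesis
    unfolding upair_def by (rule someI[of bij])
qed

definition ufst :: "'u::infinite \<Rightarrow> 'u" where
  "ufst x = fst (inv upair x)"

definition usnd :: "'u::infinite \<Rightarrow> 'u" where
  "usnd x = snd (inv upair x)"

lemma ufst_upair [simp]: "ufst (upair (a, b)) = a"
  and usnd_upair [simp]: "usnd (upair (a, b)) = b"
  by (simp_all add: ufst_def usnd_def bij_is_inj[OF bij_upair])

lemma upair_ufst_usnd [simp]: "upair (ufst x, usnd x) = x"
  by (simp add: ufst_def usnd_def surj_f_inv_f[OF bij_is_surj[OF bij_upair]])

text \<open>The product of small categories: the product category transported along \<open>upair\<close>.\<close>

definition uprod :: "('u::infinite, 'u) cat \<Rightarrow> ('u, 'u) cat \<Rightarrow> ('u, 'u) cat" where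
  "uprod I J =
     \<lparr>Obj = upair ` (Obj I \<times> Obj J),
      Arr = upair ` (Arr I \<times> Arr J),
      Dom = (\<lambda>f \<in> upair ` (Arr I \<times> Arr J). upair (Dom I (ufst f), Dom J (usnd f))),
      Cod = (\<lambda>f \<in> upair ` (Arr I \<times> Arr J). upair (Cod I (ufst f), Cod J (usnd f))),
      Ide = (\<lambda>a \<in> upair ` (Obj I \<times> Obj J). upair (Ide I (ufst a), Ide J (usnd a))),
      Comp = (\<lambda>g f. if composable I (ufst g) (ufst f) \<and> composable J (usnd g) (usnd f)
                then upair (ufst g \<cdot>\<^bsub>I\<^esub> ufst f, usnd g \<cdot>\<^bsub>J\<^esub> usnd f) else undefined)\<rparr>"

text \<open>The terminal category; the element of \<open>'u\<close> used as its only object and arrow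
  is immaterial.\<close>

definition ustar :: "'u" where
  "ustar = undefined"

definition uterm :: "('u, 'u) cat" where
  "uterm =
     \<lparr>Obj = {ustar}, Arr = {ustar},
      Dom = (\<lambda>f \<in> {ustar}. ustar), Cod = (\<lambda>f \<in> {ustar}. ustar), Ide = (\<lambda>a \<in> {ustar}. ustar),
      Comp = (\<lambda>g f. if g = ustar \<and> f = ustar then ustar else undefined)\<rparr>"

definition uprod_functor ::
  "('u::infinite, 'u) cat \<Rightarrow> ('u, 'u) cat \<Rightarrow> ('u, 'u, 'u, 'u) func \<Rightarrow> ('u, 'u, 'u, 'u) func
    \<Rightarrow> ('u, 'u, 'u, 'u) func" where
  "uprod_functor I J H K =
     \<lparr>fobj = (\<lambda>a \<in> Obj (uprod I J). upair (fobj H (ufst a), fobj K (usnd a))),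
      farr = (\<lambda>f \<in> Arr (uprod I J). upair (farr H (ufst f), farr K (usnd f)))\<rparr>"

text \<open>Associator \<open>(I \<times> J) \<times> K \<rightarrow> I \<times> (J \<times> K)\<close> and unitors of the cartesian monoidal
  category of small categories.\<close>

definition uassoc ::
  "('u::infinite, 'u) cat \<Rightarrow> ('u, 'u) cat \<Rightarrow> ('u, 'u) cat \<Rightarrow> ('u, 'u, 'u, 'u) func" where
  "uassoc I J K =
     \<lparr>fobj = (\<lambda>a \<in> Obj (uprod (uprod I J) K).
                upair (ufst (ufst a), upair (usnd (ufst a), usnd a))),
      farr = (\<lambda>f \<in> Arr (uprod (uprod I J) K).
                upair (ufst (ufst f), upair (usnd (ufst f), usnd f)))\<rparr>"

definition ulunit :: "('u::infinite, 'u) cat \<Rightarrow> ('u, 'u, 'u, 'u) func" where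
  "ulunit I = \<lparr>fobj = restrict usnd (Obj (uprod uterm I)), farr = restrict usnd (Arr (uprod uterm I))\<rparr>"

definition urunit :: "('u::infinite, 'u) cat \<Rightarrow> ('u, 'u, 'u, 'u) func" where
  "urunit I = \<lparr>fobj = restrict ufst (Obj (uprod I uterm)), farr = restrict ufst (Arr (uprod I uterm))\<rparr>"


section \<open>Colimits\<close>

definition is_cocone ::
  "('i, 'j, 'y) cat_scheme \<Rightarrow> ('o, 'm, 'z) cat_scheme \<Rightarrow> ('i, 'j, 'o, 'm) func
    \<Rightarrow> 'o \<Rightarrow> ('i \<Rightarrow> 'm) \<Rightarrow> bool" where
  "is_cocone I V F c \<iota> \<longleftrightarrow>
     c \<in> Obj V \<and>
     (\<forall>i \<in> Obj I. \<iota> i \<in> hom V (fobj F i) c) \<and>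
     (\<forall>f \<in> Arr I. \<iota> (Cod I f) \<cdot>\<^bsub>V\<^esub> farr F f = \<iota> (Dom I f))"

definition is_colimit ::
  "('i, 'j, 'y) cat_scheme \<Rightarrow> ('o, 'm, 'z) cat_scheme \<Rightarrow> ('i, 'j, 'o, 'm) func
    \<Rightarrow> 'o \<Rightarrow> ('i \<Rightarrow> 'm) \<Rightarrow> bool" where
  "is_colimit I V F c \<iota> \<longleftrightarrow>
     is_cocone I V F c \<iota> \<and>
     (\<forall>d \<kappa>. is_cocone I V F d \<kappa> \<longrightarrow>
        (\<exists>!m. m \<in> hom V c d \<and> (\<forall>i \<in> Obj I. m \<cdot>\<^bsub>V\<^esub> \<iota> i = \<kappa> i)))"

text \<open>The argument \<open>TYPE('u)\<close> names the universe with respect to which diagrams are small.\<close>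

definition cocomplete :: "'u::infinite itself \<Rightarrow> ('o, 'm, 'z) cat_scheme \<Rightarrow> bool" where
  "cocomplete _ V \<longleftrightarrow>
     (\<forall>(I :: ('u, 'u) cat) F. small_category I \<and> is_functor I V F \<longrightarrow>
        (\<exists>c \<iota>. is_colimit I V F c \<iota>))"

definition cocontinuous ::
  "'u::infinite itself \<Rightarrow> ('o1, 'm1, 'y) cat_scheme \<Rightarrow> ('o2, 'm2, 'z) cat_scheme
    \<Rightarrow> ('o1, 'm1, 'o2, 'm2) func \<Rightarrow> bool" where
  "cocontinuous _ V W T \<longleftrightarrow>
     (\<forall>(I :: ('u, 'u) cat) F c \<iota>.
        small_category I \<and> is_functor I V F \<and> is_colimit I V F c \<iota> \<longrightarrow>
        is_colimit I W (comp_functor I T F) (fobj T c) (\<lambda>i. farr T (\<iota> i)))"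


section \<open>Monoidal categories and strong monoidal functors\<close>

record ('o, 'm) moncat = "('o, 'm) cat" +
  Tensor :: "('o \<times> 'o, 'm \<times> 'm, 'o, 'm) func"
  Unit :: "'o" ("\<one>\<index>")
  Assoc :: "'o \<Rightarrow> 'o \<Rightarrow> 'o \<Rightarrow> 'm"
  LUnit :: "'o \<Rightarrow> 'm"
  RUnit :: "'o \<Rightarrow> 'm"

text \<open>\<open>\<otimes>\<close> is the tensor product of objects, \<open>\<odot>\<close> that of arrows.\<close>

abbreviation tensor_obj :: "('o, 'm, 'z) moncat_scheme \<Rightarrow> 'o \<Rightarrow> 'o \<Rightarrow> 'o" (infixr "\<otimes>\<index>" 80) where
  "a \<otimes>\<^bsub>M\<^esub> b \<equiv> fobj (Tensor M) (a, b)"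

abbreviation tensor_arr :: "('o, 'm, 'z) moncat_scheme \<Rightarrow> 'm \<Rightarrow> 'm \<Rightarrow> 'm" (infixr "\<odot>\<index>" 80) where
  "f \<odot>\<^bsub>M\<^esub> g \<equiv> farr (Tensor M) (f, g)"

definition monoidal_category :: "('o, 'm, 'z) moncat_scheme \<Rightarrow> bool" where
  "monoidal_category M \<longleftrightarrow>
     category M \<and>
     is_functor (prod_cat M M) M (Tensor M) \<and>
     \<one>\<^bsub>M\<^esub> \<in> Obj M \<and>
     \<comment> \<open>associator\<close>
     (\<forall>a \<in> Obj M. \<forall>b \<in> Obj M. \<forall>c \<in> Obj M.
        Assoc M a b c \<in> hom M ((a \<otimes>\<^bsub>M\<^esub> b) \<otimes>\<^bsub>M\<^esub> c) (a \<otimes>\<^bsub>M\<^esub> (b \<otimes>\<^bsub>M\<^esub> c)) \<and> is_iso M (Assoc M a b c)) \<and>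
     (\<forall>f \<in> Arr M. \<forall>g \<in> Arr M. \<forall>h \<in> Arr M.
        Assoc M (Cod M f) (Cod M g) (Cod M h) \<cdot>\<^bsub>M\<^esub> ((f \<odot>\<^bsub>M\<^esub> g) \<odot>\<^bsub>M\<^esub> h)
          = (f \<odot>\<^bsub>M\<^esub> (g \<odot>\<^bsub>M\<^esub> h)) \<cdot>\<^bsub>M\<^esub> Assoc M (Dom M f) (Dom M g) (Dom M h)) \<and>
     \<comment> \<open>unitors\<close>
     (\<forall>a \<in> Obj M. LUnit M a \<in> hom M (\<one>\<^bsub>M\<^esub> \<otimes>\<^bsub>M\<^esub> a) a \<and> is_iso M (LUnit M a)) \<and>
     (\<forall>f \<in> Arr M. LUnit M (Cod M f) \<cdot>\<^bsub>M\<^esub> (Ide M \<one>\<^bsub>M\<^esub> \<odot>\<^bsub>M\<^esub> f) = f \<cdot>\<^bsub>M\<^esub> LUnit M (Dom M f)) \<and>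
     (\<forall>a \<in> Obj M. RUnit M a \<in> hom M (a \<otimes>\<^bsub>M\<^esub> \<one>\<^bsub>M\<^esub>) a \<and> is_iso M (RUnit M a)) \<and>
     (\<forall>f \<in> Arr M. RUnit M (Cod M f) \<cdot>\<^bsub>M\<^esub> (f \<odot>\<^bsub>M\<^esub> Ide M \<one>\<^bsub>M\<^esub>) = f \<cdot>\<^bsub>M\<^esub> RUnit M (Dom M f)) \<and>
     \<comment> \<open>pentagon and triangle\<close>
     (\<forall>a \<in> Obj M. \<forall>b \<in> Obj M. \<forall>c \<in> Obj M. \<forall>d \<in> Obj M.
        Assoc M a b (c \<otimes>\<^bsub>M\<^esub> d) \<cdot>\<^bsub>M\<^esub> Assoc M (a \<otimes>\<^bsub>M\<^esub> b) c d
          = (Ide M a \<odot>\<^bsub>M\<^esub> Assoc M b c d) \<cdot>\<^bsub>M\<^esub> Assoc M a (b \<otimes>\<^bsub>M\<^esub> c) d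
              \<cdot>\<^bsub>M\<^esub> (Assoc M a b c \<odot>\<^bsub>M\<^esub> Ide M d)) \<and>
     (\<forall>a \<in> Obj M. \<forall>b \<in> Obj M.
        (Ide M a \<odot>\<^bsub>M\<^esub> LUnit M b) \<cdot>\<^bsub>M\<^esub> Assoc M a \<one>\<^bsub>M\<^esub> b = RUnit M a \<odot>\<^bsub>M\<^esub> Ide M b)"

text \<open>The functors \<open>A \<otimes> -\<close> and \<open>- \<otimes> A\<close>.\<close>

definition tensor_left :: "('o, 'm, 'z) moncat_scheme \<Rightarrow> 'o \<Rightarrow> ('o, 'm, 'o, 'm) func" where
  "tensor_left M a =
     \<lparr>fobj = (\<lambda>x \<in> Obj M. a \<otimes>\<^bsub>M\<^esub> x), farr = (\<lambda>f \<in> Arr M. Ide M a \<odot>\<^bsub>M\<^esub> f)\<rparr>"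

definition tensor_right :: "('o, 'm, 'z) moncat_scheme \<Rightarrow> 'o \<Rightarrow> ('o, 'm, 'o, 'm) func" where
  "tensor_right M a =
     \<lparr>fobj = (\<lambda>x \<in> Obj M. x \<otimes>\<^bsub>M\<^esub> a), farr = (\<lambda>f \<in> Arr M. f \<odot>\<^bsub>M\<^esub> Ide M a)\<rparr>"

definition lax_monoidal_functor ::
  "('o1, 'm1, 'y) moncat_scheme \<Rightarrow> ('o2, 'm2, 'z) moncat_scheme \<Rightarrow> ('o1, 'm1, 'o2, 'm2) func
    \<Rightarrow> ('o1 \<Rightarrow> 'o1 \<Rightarrow> 'm2) \<Rightarrow> 'm2 \<Rightarrow> bool" where
  "lax_monoidal_functor M N F \<mu> \<eta> \<longleftrightarrow>
     monoidal_category M \<and> monoidal_category N \<and> is_functor M N F \<and>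
     (\<forall>a \<in> Obj M. \<forall>b \<in> Obj M.
        \<mu> a b \<in> hom N (fobj F a \<otimes>\<^bsub>N\<^esub> fobj F b) (fobj F (a \<otimes>\<^bsub>M\<^esub> b))) \<and>
     \<comment> \<open>naturality of \<open>\<mu>\<close>\<close>
     (\<forall>f \<in> Arr M. \<forall>g \<in> Arr M.
        \<mu> (Cod M f) (Cod M g) \<cdot>\<^bsub>N\<^esub> (farr F f \<odot>\<^bsub>N\<^esub> farr F g)
          = farr F (f \<odot>\<^bsub>M\<^esub> g) \<cdot>\<^bsub>N\<^esub> \<mu> (Dom M f) (Dom M g)) \<and>
     \<eta> \<in> hom N \<one>\<^bsub>N\<^esub> (fobj F \<one>\<^bsub>M\<^esub>) \<and>
     \<comment> \<open>associativity\<close>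
     (\<forall>a \<in> Obj M. \<forall>b \<in> Obj M. \<forall>c \<in> Obj M.
        farr F (Assoc M a b c) \<cdot>\<^bsub>N\<^esub> \<mu> (a \<otimes>\<^bsub>M\<^esub> b) c \<cdot>\<^bsub>N\<^esub> (\<mu> a b \<odot>\<^bsub>N\<^esub> Ide N (fobj F c))
          = \<mu> a (b \<otimes>\<^bsub>M\<^esub> c) \<cdot>\<^bsub>N\<^esub> (Ide N (fobj F a) \<odot>\<^bsub>N\<^esub> \<mu> b c)
              \<cdot>\<^bsub>N\<^esub> Assoc N (fobj F a) (fobj F b) (fobj F c)) \<and>
     \<comment> \<open>left and right unitality\<close>
     (\<forall>a \<in> Obj M.
        farr F (LUnit M a) \<cdot>\<^bsub>N\<^esub> \<mu> \<one>\<^bsub>M\<^esub> a \<cdot>\<^bsub>N\<^esub> (\<eta> \<odot>\<^bsub>N\<^esub> Ide N (fobj F a)) = LUnit N (fobj F a)) \<and>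
     (\<forall>a \<in> Obj M.
        farr F (RUnit M a) \<cdot>\<^bsub>N\<^esub> \<mu> a \<one>\<^bsub>M\<^esub> \<cdot>\<^bsub>N\<^esub> (Ide N (fobj F a) \<odot>\<^bsub>N\<^esub> \<eta>) = RUnit N (fobj F a))"

definition strong_monoidal_functor ::
  "('o1, 'm1, 'y) moncat_scheme \<Rightarrow> ('o2, 'm2, 'z) moncat_scheme \<Rightarrow> ('o1, 'm1, 'o2, 'm2) func
    \<Rightarrow> ('o1 \<Rightarrow> 'o1 \<Rightarrow> 'm2) \<Rightarrow> 'm2 \<Rightarrow> bool" where
  "strong_monoidal_functor M N F \<mu> \<eta> \<longleftrightarrow>
     lax_monoidal_functor M N F \<mu> \<eta> \<and>
     (\<forall>a \<in> Obj M. \<forall>b \<in> Obj M. is_iso N (\<mu> a b)) \<and> is_iso N \<eta>"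


section \<open>The Grothendieck construction of \<open>[-, V]\<close>\<close>

type_synonym ('u, 'o, 'm) diagram = "('u, 'u) cat \<times> ('u, 'u, 'o, 'm) func"

text \<open>A morphism \<open>(H, \<eta>)\<close>, together with its domain and codomain.\<close>

record ('u, 'o, 'm) garr =
  gdom :: "('u, 'o, 'm) diagram"
  gcod :: "('u, 'o, 'm) diagram"
  gfun :: "('u, 'u, 'u, 'u) func"
  gtrans :: "'u \<Rightarrow> 'm"

definition groth_obj :: "('o, 'm, 'z) cat_scheme \<Rightarrow> ('u::infinite, 'o, 'm) diagram set" where
  "groth_obj V = {(I, F). small_category I \<and> is_functor I V F}"

definition groth_arr :: "('o, 'm, 'z) cat_scheme \<Rightarrow> ('u::infinite, 'o, 'm) garr set" where
  "groth_arr V = {t. gdom t \<in> groth_obj V \<and> gcod t \<in> groth_obj V \<and>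
     (case (gdom t, gcod t) of ((I, F), (J, G)) \<Rightarrow>
        is_functor I J (gfun t) \<and> is_nat_trans I V F (comp_functor I G (gfun t)) (gtrans t))}"

definition groth_id :: "('o, 'm, 'z) cat_scheme \<Rightarrow> ('u, 'o, 'm) diagram \<Rightarrow> ('u, 'o, 'm) garr" where
  "groth_id V X = (case X of (I, F) \<Rightarrow>
     \<lparr>gdom = X, gcod = X, gfun = id_functor I, gtrans = (\<lambda>i \<in> Obj I. Ide V (fobj F i))\<rparr>)"

definition groth_comp ::
  "('o, 'm, 'z) cat_scheme \<Rightarrow> ('u, 'o, 'm) garr \<Rightarrow> ('u, 'o, 'm) garr \<Rightarrow> ('u, 'o, 'm) garr" where
  "groth_comp V t s = (case gdom s of (I, F) \<Rightarrow>
     \<lparr>gdom = gdom s, gcod = gcod t,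
      gfun = comp_functor I (gfun t) (gfun s),
      gtrans = (\<lambda>i \<in> Obj I. gtrans t (fobj (gfun s) i) \<cdot>\<^bsub>V\<^esub> gtrans s i)\<rparr>)"

definition diag_tensor ::
  "('o, 'm, 'z) moncat_scheme \<Rightarrow> ('u::infinite, 'o, 'm) diagram \<Rightarrow> ('u, 'o, 'm) diagram
    \<Rightarrow> ('u, 'o, 'm) diagram" where
  "diag_tensor V X Y = (case (X, Y) of ((I, F), (J, G)) \<Rightarrow>
     (uprod I J,
      comp_functor (uprod I J) (Tensor V)
        \<lparr>fobj = (\<lambda>a. (fobj F (ufst a), fobj G (usnd a))),
         farr = (\<lambda>f. (farr F (ufst f), farr G (usnd f)))\<rparr>))"

definition diag_unit :: "('o, 'm, 'z) moncat_scheme \<Rightarrow> ('u, 'o, 'm) diagram" where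
  "diag_unit V =
     (uterm, \<lparr>fobj = (\<lambda>a \<in> {ustar}. \<one>\<^bsub>V\<^esub>), farr = (\<lambda>f \<in> {ustar}. Ide V \<one>\<^bsub>V\<^esub>)\<rparr>)"

definition garr_tensor ::
  "('o, 'm, 'z) moncat_scheme \<Rightarrow> ('u::infinite, 'o, 'm) garr \<Rightarrow> ('u, 'o, 'm) garr
    \<Rightarrow> ('u, 'o, 'm) garr" where
  "garr_tensor V s t = (let I = fst (gdom s); J = fst (gdom t) in
     \<lparr>gdom = diag_tensor V (gdom s) (gdom t),
      gcod = diag_tensor V (gcod s) (gcod t),
      gfun = uprod_functor I J (gfun s) (gfun t),
      gtrans = (\<lambda>a \<in> Obj (uprod I J). gtrans s (ufst a) \<odot>\<^bsub>V\<^esub> gtrans t (usnd a))\<rparr>)"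

definition groth_assoc ::
  "('o, 'm, 'z) moncat_scheme \<Rightarrow> ('u::infinite, 'o, 'm) diagram \<Rightarrow> ('u, 'o, 'm) diagram
    \<Rightarrow> ('u, 'o, 'm) diagram \<Rightarrow> ('u, 'o, 'm) garr" where
  "groth_assoc V X Y Z = (case (X, Y, Z) of ((I, F), (J, G), (K, H)) \<Rightarrow>
     \<lparr>gdom = diag_tensor V (diag_tensor V X Y) Z,
      gcod = diag_tensor V X (diag_tensor V Y Z),
      gfun = uassoc I J K,
      gtrans = (\<lambda>a \<in> Obj (uprod (uprod I J) K).
         Assoc V (fobj F (ufst (ufst a))) (fobj G (usnd (ufst a))) (fobj H (usnd a)))\<rparr>)"

definition groth_lunit ::
  "('o, 'm, 'z) moncat_scheme \<Rightarrow> ('u::infinite, 'o, 'm) diagram \<Rightarrow> ('u, 'o, 'm) garr" where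
  "groth_lunit V X = (case X of (I, F) \<Rightarrow>
     \<lparr>gdom = diag_tensor V (diag_unit V) X, gcod = X, gfun = ulunit I,
      gtrans = (\<lambda>a \<in> Obj (uprod uterm I). LUnit V (fobj F (usnd a)))\<rparr>)"

definition groth_runit ::
  "('o, 'm, 'z) moncat_scheme \<Rightarrow> ('u::infinite, 'o, 'm) diagram \<Rightarrow> ('u, 'o, 'm) garr" where
  "groth_runit V X = (case X of (I, F) \<Rightarrow>
     \<lparr>gdom = diag_tensor V X (diag_unit V), gcod = X, gfun = urunit I,
      gtrans = (\<lambda>a \<in> Obj (uprod I uterm). RUnit V (fobj F (ufst a)))\<rparr>)"

definition groth ::
  "('o, 'm, 'z) moncat_scheme \<Rightarrow> (('u::infinite, 'o, 'm) diagram, ('u, 'o, 'm) garr) moncat" where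
  "groth V =
     \<lparr>Obj = groth_obj V,
      Arr = groth_arr V,
      Dom = restrict gdom (groth_arr V),
      Cod = restrict gcod (groth_arr V),
      Ide = restrict (groth_id V) (groth_obj V),
      Comp = (\<lambda>t s. if t \<in> groth_arr V \<and> s \<in> groth_arr V \<and> gdom t = gcod s
                then groth_comp V t s else undefined),
      Tensor =
        \<lparr>fobj = (\<lambda>(X, Y) \<in> groth_obj V \<times> groth_obj V. diag_tensor V X Y),
         farr = (\<lambda>(s, t) \<in> groth_arr V \<times> groth_arr V. garr_tensor V s t)\<rparr>,
      Unit = diag_unit V,
      Assoc = groth_assoc V,
      LUnit = groth_lunit V,
      RUnit = groth_runit V\<rparr>"


section \<open>The colimit functor\<close>

text \<open>A choice of a colimit \<open>K X\<close> with colimiting cocone \<open>\<iota> X\<close> for every small diagram \<open>X\<close>.\<close>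

definition colimit_choice ::
  "('o, 'm, 'z) cat_scheme \<Rightarrow> (('u::infinite, 'o, 'm) diagram \<Rightarrow> 'o)
    \<Rightarrow> (('u, 'o, 'm) diagram \<Rightarrow> 'u \<Rightarrow> 'm) \<Rightarrow> bool" where
  "colimit_choice V K \<iota> \<longleftrightarrow>
     (\<forall>(I, F) \<in> groth_obj V. is_colimit I V F (K (I, F)) (\<iota> (I, F)))"

definition colim_functor ::
  "('o, 'm, 'z) cat_scheme \<Rightarrow> (('u::infinite, 'o, 'm) diagram \<Rightarrow> 'o)
    \<Rightarrow> (('u, 'o, 'm) diagram \<Rightarrow> 'u \<Rightarrow> 'm)
    \<Rightarrow> (('u, 'o, 'm) diagram, ('u, 'o, 'm) garr, 'o, 'm) func" where
  "colim_functor V K \<iota> =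
     \<lparr>fobj = restrict K (groth_obj V),
      farr = (\<lambda>t \<in> groth_arr V.
        THE m. m \<in> hom V (K (gdom t)) (K (gcod t)) \<and>
          (\<forall>i \<in> Obj (fst (gdom t)).
             m \<cdot>\<^bsub>V\<^esub> \<iota> (gdom t) i = \<iota> (gcod t) (fobj (gfun t) i) \<cdot>\<^bsub>V\<^esub> gtrans t i))\<rparr>"

end

theory Submission
  imports Defs
begin

text \<open>
  Since \<open>\<otimes>\<close> preserves colimits in each variable, a Fubini argument shows that
  \<open>colim F \<otimes> colim G\<close>, with the legs \<open>\<iota>\<^sub>i \<otimes> \<iota>\<^sub>j\<close>, is itself a colimit of \<open>F \<boxtimes> G\<close>: factor a cocone first
  through \<open>F i \<otimes> colim G\<close> for each \<open>i\<close>, then through \<open>colim F \<otimes> colim G\<close>. The coherence map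
  \<open>\<mu>\<close> is the comparison of two colimits of the same diagram, and \<open>\<eta>\<close> is the leg of the chosen
  colimit of the unit diagram; both are isomorphisms. Naturality, associativity and unitality
  are equalities of maps out of such a tensor of colimits, so they may be checked on the legs, where they
  reduce to naturality of the constraints of \<open>V\<close>.
\<close>

section \<open>Categories and functors in terms of hom-sets\<close>

text \<open>The claim includes that the source is itself a monoidal category, and this takes up the
  larger half of the argument. All index categories live on one type \<open>'u\<close>, so a product
  is transported along the bijection \<open>upair\<close>, its coordinates are read through
  \<open>ufst\<close> and \<open>usnd\<close>, and rebracketing and unit laws become explicit
  functors. Since all structure maps are extensional, an equation between morphisms of diagrams can
  be tested point by point: functor parts agree by computing with projections, transformation parts
  are instances of the corresponding law of \<open>V\<close>. The chosen colimits enter only through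
  their universal property. In the Fubini argument the delicate point is that the factorizations
  through \<open>F i \<otimes> colim G\<close> are compatible in \<open>i\<close>; their uniqueness
  supplies this. The principle of checking on legs is stated for arbitrary colimits of the two
  factors, not only for the chosen ones. Hence a triple tensor needs no Fubini argument of its own,
  and in the unit laws the unit object itself can take part as the colimit of its constant
  diagram.\<close>

lemma hom_Arr: "f \<in> hom C a b \<Longrightarrow> f \<in> Arr C"
  and hom_Dom: "f \<in> hom C a b \<Longrightarrow> Dom C f = a"
  and hom_Cod: "f \<in> hom C a b \<Longrightarrow> Cod C f = b"
  by (simp_all add: hom_def)

lemma Arr_hom: "f \<in> Arr C \<Longrightarrow> f \<in> hom C (Dom C f) (Cod C f)"
  by (simp add: hom_def)

lemma composable_hom: "f \<in> hom C a b \<Longrightarrow> g \<in> hom C b c \<Longrightarrow> composable C g f"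
  by (simp add: hom_def composable_def)

lemma composable_iff_hom:
  "composable C g f \<longleftrightarrow> (\<exists>a b c. f \<in> hom C a b \<and> g \<in> hom C b c)"
  by (auto simp: hom_def composable_def)

text \<open>The definition quantifies over arrows and reads off \<open>Dom\<close> and
  \<open>Cod\<close>. With the end objects named instead, each verification starts from typed arrows
  and can use typed rewrite rules.\<close>

lemma categoryI:
  assumes "Dom C \<in> extensional (Arr C)" "Cod C \<in> extensional (Arr C)" "Ide C \<in> extensional (Obj C)"
    and "\<And>f. f \<in> Arr C \<Longrightarrow> Dom C f \<in> Obj C \<and> Cod C f \<in> Obj C"
    and "\<And>a. a \<in> Obj C \<Longrightarrow> Ide C a \<in> hom C a a"
    and "\<And>f g a b c. f \<in> hom C a b \<Longrightarrow> g \<in> hom C b c \<Longrightarrow> g \<cdot>\<^bsub>C\<^esub> f \<in> hom C a c"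
    and "\<And>f g. \<not> composable C g f \<Longrightarrow> g \<cdot>\<^bsub>C\<^esub> f = undefined"
    and "\<And>f a b. f \<in> hom C a b \<Longrightarrow> f \<cdot>\<^bsub>C\<^esub> Ide C a = f \<and> Ide C b \<cdot>\<^bsub>C\<^esub> f = f"
    and "\<And>f g h a b c d. f \<in> hom C a b \<Longrightarrow> g \<in> hom C b c \<Longrightarrow> h \<in> hom C c d \<Longrightarrow>
           (h \<cdot>\<^bsub>C\<^esub> g) \<cdot>\<^bsub>C\<^esub> f = h \<cdot>\<^bsub>C\<^esub> (g \<cdot>\<^bsub>C\<^esub> f)"
  shows "category C"
  unfolding category_def
proof (intro conjI ballI allI impI)
  show "Dom C \<in> Arr C \<rightarrow>\<^sub>E Obj C" "Cod C \<in> Arr C \<rightarrow>\<^sub>E Obj C"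
    using assms(1,2,4) by (auto simp: PiE_def)
  show "Ide C \<in> Obj C \<rightarrow>\<^sub>E Arr C"
    using assms(3,5) by (auto simp: PiE_def dest: hom_Arr)
  show "(h \<cdot>\<^bsub>C\<^esub> g) \<cdot>\<^bsub>C\<^esub> f = h \<cdot>\<^bsub>C\<^esub> (g \<cdot>\<^bsub>C\<^esub> f)" if "composable C h g \<and> composable C g f" for h g f
    using that by (intro assms(9)) (auto simp: composable_def hom_def)
  show "g \<cdot>\<^bsub>C\<^esub> f \<in> hom C (Dom C f) (Cod C g)" if "composable C g f" for g f
    using that by (intro assms(6)) (auto simp: composable_def hom_def)
  show "f \<cdot>\<^bsub>C\<^esub> Ide C (Dom C f) = f" "Ide C (Cod C f) \<cdot>\<^bsub>C\<^esub> f = f" if "f \<in> Arr C" for f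
    using assms(8)[OF Arr_hom[OF that]] by simp_all
qed (use assms(5,7) in simp_all)

text \<open>Both components are extensional on \<open>C\<close>, so their values there determine the
  record. The target categories may differ, since equality of records does not see them.\<close>

lemma func_eqI:
  fixes F G :: "('o1, 'm1, 'o2, 'm2) func"
  assumes "is_functor C D F" "is_functor C D' G"
    and "\<And>a. a \<in> Obj C \<Longrightarrow> fobj F a = fobj G a" "\<And>f. f \<in> Arr C \<Longrightarrow> farr F f = farr G f"
  shows "F = G"
proof (rule func.equality)
  show "fobj F = fobj G" "farr F = farr G"
    using assms by (auto simp: is_functor_def PiE_def intro: extensionalityI)
qed simp

lemma is_functorI:
  assumes "fobj F \<in> extensional (Obj C)" "farr F \<in> extensional (Arr C)"
    and "\<And>a. a \<in> Obj C \<Longrightarrow> fobj F a \<in> Obj D"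
    and "\<And>f a b. f \<in> hom C a b \<Longrightarrow> farr F f \<in> hom D (fobj F a) (fobj F b)"
    and "\<And>a. a \<in> Obj C \<Longrightarrow> farr F (Ide C a) = Ide D (fobj F a)"
    and "\<And>f g a b c. f \<in> hom C a b \<Longrightarrow> g \<in> hom C b c \<Longrightarrow>
           farr F (g \<cdot>\<^bsub>C\<^esub> f) = farr F g \<cdot>\<^bsub>D\<^esub> farr F f"
  shows "is_functor C D F"
  unfolding is_functor_def
proof (intro conjI ballI allI impI)
  show "fobj F \<in> Obj C \<rightarrow>\<^sub>E Obj D" "farr F \<in> Arr C \<rightarrow>\<^sub>E Arr D"
    using assms(1-3) hom_Arr[OF assms(4)[OF Arr_hom]] by (auto simp: PiE_def)
  show "farr F f \<in> hom D (fobj F (Dom C f)) (fobj F (Cod C f))" if "f \<in> Arr C" for f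
    using assms(4) Arr_hom[OF that] .
qed (use assms(5,6) in \<open>auto simp: composable_iff_hom\<close>)

lemma functor_obj: "is_functor C D F \<Longrightarrow> a \<in> Obj C \<Longrightarrow> fobj F a \<in> Obj D"
  and functor_Arr: "is_functor C D F \<Longrightarrow> f \<in> Arr C \<Longrightarrow> farr F f \<in> Arr D"
  and functor_hom: "is_functor C D F \<Longrightarrow> f \<in> hom C a b \<Longrightarrow> farr F f \<in> hom D (fobj F a) (fobj F b)"
  and functor_ide: "is_functor C D F \<Longrightarrow> a \<in> Obj C \<Longrightarrow> farr F (Ide C a) = Ide D (fobj F a)"
  and functor_comp: "is_functor C D F \<Longrightarrow> f \<in> hom C a b \<Longrightarrow> g \<in> hom C b c \<Longrightarrow>
    farr F (g \<cdot>\<^bsub>C\<^esub> f) = farr F g \<cdot>\<^bsub>D\<^esub> farr F f"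
  unfolding is_functor_def
  by blast (use hom_Arr hom_Dom hom_Cod composable_hom in \<open>fastforce+\<close>)

lemma category_ide: "category C \<Longrightarrow> a \<in> Obj C \<Longrightarrow> Ide C a \<in> hom C a a"
  and category_comp: "category C \<Longrightarrow> f \<in> hom C a b \<Longrightarrow> g \<in> hom C b c \<Longrightarrow> g \<cdot>\<^bsub>C\<^esub> f \<in> hom C a c"
  and category_id_right: "category C \<Longrightarrow> f \<in> hom C a b \<Longrightarrow> f \<cdot>\<^bsub>C\<^esub> Ide C a = f"
  and category_id_left: "category C \<Longrightarrow> f \<in> hom C a b \<Longrightarrow> Ide C b \<cdot>\<^bsub>C\<^esub> f = f"
  and category_assoc: "category C \<Longrightarrow> f \<in> hom C a b \<Longrightarrow> g \<in> hom C b c \<Longrightarrow> h \<in> hom C c d \<Longrightarrow>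
    (h \<cdot>\<^bsub>C\<^esub> g) \<cdot>\<^bsub>C\<^esub> f = h \<cdot>\<^bsub>C\<^esub> (g \<cdot>\<^bsub>C\<^esub> f)"
  unfolding category_def
  by (simp, metis hom_Dom hom_Cod composable_hom, metis hom_Arr hom_Dom, metis hom_Arr hom_Cod,
      metis composable_hom)

lemma category_hom_obj:
  assumes "category C" "f \<in> hom C a b"
  shows "a \<in> Obj C" "b \<in> Obj C"
  using assms by (auto simp: category_def hom_def PiE_def)

lemma is_isoI:
  assumes "f \<in> hom C a b" "g \<in> hom C b a" "g \<cdot>\<^bsub>C\<^esub> f = Ide C a" "f \<cdot>\<^bsub>C\<^esub> g = Ide C b"
  shows "is_iso C f"
  using assms by (auto simp: is_iso_def hom_def)

lemma is_isoE:
  assumes "is_iso C f" "f \<in> hom C a b"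
  obtains g where "g \<in> hom C b a" "g \<cdot>\<^bsub>C\<^esub> f = Ide C a" "f \<cdot>\<^bsub>C\<^esub> g = Ide C b"
  using assms by (auto simp: is_iso_def hom_def)

text \<open>The set-theoretic inverses respect the structure because \<open>F\<close> is injective:
  identities and composites are compared after applying \<open>F\<close>. This supplies the functor
  part of inverses in \<open>groth V\<close>.\<close>

lemma functor_inverse:
  assumes C: "category C" and F: "is_functor C D F"
    and obj: "bij_betw (fobj F) (Obj C) (Obj D)" and arr: "bij_betw (farr F) (Arr C) (Arr D)"
  obtains F' where "is_functor D C F'"
    and "\<And>a. a \<in> Obj C \<Longrightarrow> fobj F' (fobj F a) = a" "\<And>b. b \<in> Obj D \<Longrightarrow> fobj F (fobj F' b) = b"
    and "\<And>f. f \<in> Arr C \<Longrightarrow> farr F' (farr F f) = f" "\<And>g. g \<in> Arr D \<Longrightarrow> farr F (farr F' g) = g"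
proof -
  define F' where "F' = \<lparr>fobj = restrict (inv_into (Obj C) (fobj F)) (Obj D),
    farr = restrict (inv_into (Arr C) (farr F)) (Arr D)\<rparr>"
  have o1: "fobj F' (fobj F a) = a" if "a \<in> Obj C" for a
    using that bij_betw_inv_into_left[OF obj that] by (simp add: F'_def functor_obj[OF F])
  have o2: "fobj F (fobj F' b) = b" "fobj F' b \<in> Obj C" if "b \<in> Obj D" for b
    using that bij_betw_inv_into_right[OF obj that] bij_betw_apply[OF bij_betw_inv_into[OF obj] that]
    by (simp_all add: F'_def)
  have a1: "farr F' (farr F f) = f" if "f \<in> Arr C" for f
    using that bij_betw_inv_into_left[OF arr that] by (simp add: F'_def functor_Arr[OF F])
  have a2: "farr F (farr F' g) = g" "farr F' g \<in> Arr C" if "g \<in> Arr D" for g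
    using that bij_betw_inv_into_right[OF arr that] bij_betw_apply[OF bij_betw_inv_into[OF arr] that]
    by (simp_all add: F'_def)
  have h: "farr F' g \<in> hom C (fobj F' a) (fobj F' b)" if g: "g \<in> hom D a b" for g a b
  proof -
    have f: "farr F' g \<in> hom C (Dom C (farr F' g)) (Cod C (farr F' g))"
      using a2(2)[OF hom_Arr[OF g]] by (rule Arr_hom)
    \<comment> \<open>\<open>F\<close> sends the preimage arrow back to \<open>g\<close>, so its end
      objects lie over \<open>a\<close> and \<open>b\<close>; the left inverse on objects then
      identifies them.\<close>
    then have "g \<in> hom D (fobj F (Dom C (farr F' g))) (fobj F (Cod C (farr F' g)))"
      using functor_hom[OF F f] a2(1)[OF hom_Arr[OF g]] by simp
    then have "a = fobj F (Dom C (farr F' g))" "b = fobj F (Cod C (farr F' g))"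
      using g by (auto simp: hom_def)
    then show ?thesis
      using f o1 category_hom_obj[OF C f] by simp
  qed
  have "is_functor D C F'"
  proof (rule is_functorI)
    fix f g a b c assume f: "f \<in> hom D a b" and g: "g \<in> hom D b c"
    have "farr F (farr F' g \<cdot>\<^bsub>C\<^esub> farr F' f) = g \<cdot>\<^bsub>D\<^esub> f"
      using functor_comp[OF F h[OF f] h[OF g]] by (simp add: a2 hom_Arr[OF f] hom_Arr[OF g])
    then show "farr F' (g \<cdot>\<^bsub>D\<^esub> f) = farr F' g \<cdot>\<^bsub>C\<^esub> farr F' f"
      using a1[OF hom_Arr[OF category_comp[OF C h[OF f] h[OF g]]]] by simp
  next
    fix b assume b: "b \<in> Obj D"
    have "farr F (Ide C (fobj F' b)) = Ide D b"
      using functor_ide[OF F o2(2)[OF b]] o2(1)[OF b] by simp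
    then show "farr F' (Ide D b) = Ide C (fobj F' b)"
      using a1[OF hom_Arr[OF category_ide[OF C o2(2)[OF b]]]] by simp
  qed (use h o2(2) in \<open>simp_all add: F'_def\<close>)
  with o1 o2(1) a1 a2(1) show thesis
    by (rule that[rotated])
qed

section \<open>Identity functors and composites\<close>

lemma fobj_comp_functor [simp]: "a \<in> Obj C \<Longrightarrow> fobj (comp_functor C G F) a = fobj G (fobj F a)"
  and farr_comp_functor [simp]: "f \<in> Arr C \<Longrightarrow> farr (comp_functor C G F) f = farr G (farr F f)"
  and fobj_id_functor [simp]: "a \<in> Obj C \<Longrightarrow> fobj (id_functor C) a = a"
  and farr_id_functor [simp]: "f \<in> Arr C \<Longrightarrow> farr (id_functor C) f = f"
  by (simp_all add: comp_functor_def id_functor_def)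

lemma is_functor_id:
  assumes "category C"
  shows "is_functor C C (id_functor C)"
proof (rule is_functorI)
  fix f g a b c
  assume f: "f \<in> hom C a b" and g: "g \<in> hom C b c"
  show "farr (id_functor C) (g \<cdot>\<^bsub>C\<^esub> f) = farr (id_functor C) g \<cdot>\<^bsub>C\<^esub> farr (id_functor C) f"
    using f g category_comp[OF assms f g] by (auto simp: hom_def)
qed (use category_hom_obj[OF assms] in
      \<open>auto simp: id_functor_def hom_Arr category_ide[OF assms] hom_Arr[OF category_ide[OF assms]]\<close>)

lemma is_functor_comp:
  assumes C: "category C" and F: "is_functor C D F" and G: "is_functor D E G"
  shows "is_functor C E (comp_functor C G F)"
proof (rule is_functorI)
  show "fobj (comp_functor C G F) \<in> extensional (Obj C)"
    "farr (comp_functor C G F) \<in> extensional (Arr C)"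
    by (simp_all add: comp_functor_def)
next
  fix a assume a: "a \<in> Obj C"
  show "fobj (comp_functor C G F) a \<in> Obj E"
    using a by (simp add: functor_obj[OF G] functor_obj[OF F])
  show "farr (comp_functor C G F) (Ide C a) = Ide E (fobj (comp_functor C G F) a)"
    using a hom_Arr[OF category_ide[OF C a]]
    by (simp add: functor_obj[OF F] functor_ide[OF G] functor_ide[OF F])
next
  fix f a b assume f: "f \<in> hom C a b"
  show "farr (comp_functor C G F) f \<in> hom E (fobj (comp_functor C G F) a) (fobj (comp_functor C G F) b)"
    using functor_hom[OF G functor_hom[OF F f]] category_hom_obj[OF C f] hom_Arr[OF f] by simp
  fix g c assume g: "g \<in> hom C b c"
  show "farr (comp_functor C G F) (g \<cdot>\<^bsub>C\<^esub> f)
      = farr (comp_functor C G F) g \<cdot>\<^bsub>E\<^esub> farr (comp_functor C G F) f"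
    using functor_comp[OF G functor_hom[OF F f] functor_hom[OF F g]] functor_comp[OF F f g]
      hom_Arr[OF f] hom_Arr[OF g] hom_Arr[OF category_comp[OF C f g]] by simp
qed


section \<open>Products of small categories\<close>

lemma small_category_category: "small_category I \<Longrightarrow> category I"
  by (simp add: small_category_def)

text \<open>Every element of \<open>'u\<close> is a pair, so the projections are jointly injective
  on the whole type; equations in a product split into coordinates without first exhibiting a
  pair.\<close>

lemma upair_eq_iff: "x = y \<longleftrightarrow> ufst x = ufst y \<and> usnd x = usnd y"
  by (metis upair_ufst_usnd)

lemma upair_collapse: "ufst x = a \<Longrightarrow> upair (a, usnd x) = x" "usnd x = b \<Longrightarrow> upair (ufst x, b) = x"
  by auto

lemma upair_inject [simp]: "upair p = upair q \<longleftrightarrow> p = q"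
  by (rule inj_eq[OF bij_is_inj[OF bij_upair]])

lemma mem_upair_image: "x \<in> upair ` (A \<times> B) \<longleftrightarrow> ufst x \<in> A \<and> usnd x \<in> B"
proof
  assume "ufst x \<in> A \<and> usnd x \<in> B"
  then have "upair (ufst x, usnd x) \<in> upair ` (A \<times> B)"
    by blast
  then show "x \<in> upair ` (A \<times> B)"
    by simp
qed auto

lemma Obj_uprod [simp]: "a \<in> Obj (uprod I J) \<longleftrightarrow> ufst a \<in> Obj I \<and> usnd a \<in> Obj J"
  and Arr_uprod [simp]: "f \<in> Arr (uprod I J) \<longleftrightarrow> ufst f \<in> Arr I \<and> usnd f \<in> Arr J"
  by (simp_all add: uprod_def mem_upair_image)

lemma Dom_uprod [simp]: "ufst f \<in> Arr I \<Longrightarrow> usnd f \<in> Arr J \<Longrightarrow>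
    Dom (uprod I J) f = upair (Dom I (ufst f), Dom J (usnd f))"
  and Cod_uprod [simp]: "ufst f \<in> Arr I \<Longrightarrow> usnd f \<in> Arr J \<Longrightarrow>
    Cod (uprod I J) f = upair (Cod I (ufst f), Cod J (usnd f))"
  and Ide_uprod [simp]: "ufst a \<in> Obj I \<Longrightarrow> usnd a \<in> Obj J \<Longrightarrow>
    Ide (uprod I J) a = upair (Ide I (ufst a), Ide J (usnd a))"
  by (simp_all add: uprod_def mem_upair_image)

lemma hom_uprod [simp]:
  "f \<in> hom (uprod I J) a b \<longleftrightarrow>
     ufst f \<in> hom I (ufst a) (ufst b) \<and> usnd f \<in> hom J (usnd a) (usnd b)"
  by (auto simp: hom_def upair_eq_iff[of _ a] upair_eq_iff[of _ b])

text \<open>Injectivity of \<open>upair\<close> separates the equation between source and target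
  into its two coordinates.\<close>

lemma composable_uprod:
  "composable (uprod I J) g f \<longleftrightarrow>
     composable I (ufst g) (ufst f) \<and> composable J (usnd g) (usnd f)"
  by (auto simp: composable_def)

lemma Comp_uprod:
  assumes "ufst f \<in> hom I a b" "ufst g \<in> hom I b c" "usnd f \<in> hom J a' b'" "usnd g \<in> hom J b' c'"
  shows "g \<cdot>\<^bsub>uprod I J\<^esub> f = upair (ufst g \<cdot>\<^bsub>I\<^esub> ufst f, usnd g \<cdot>\<^bsub>J\<^esub> usnd f)"
  using composable_hom[OF assms(1,2)] composable_hom[OF assms(3,4)] by (simp add: uprod_def)

lemma category_uprod:
  assumes I: "category I" and J: "category J"
  shows "category (uprod I J)"
proof (rule categoryI)
  show "Dom (uprod I J) \<in> extensional (Arr (uprod I J))"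
    "Cod (uprod I J) \<in> extensional (Arr (uprod I J))"
    "Ide (uprod I J) \<in> extensional (Obj (uprod I J))"
    by (simp_all add: uprod_def)
  show "Dom (uprod I J) f \<in> Obj (uprod I J) \<and> Cod (uprod I J) f \<in> Obj (uprod I J)"
    if "f \<in> Arr (uprod I J)" for f
    using that by (simp add: category_hom_obj[OF I Arr_hom] category_hom_obj[OF J Arr_hom])
next
  fix f g h a b c d
  assume "f \<in> hom (uprod I J) a b"
  then have f: "ufst f \<in> hom I (ufst a) (ufst b)" "usnd f \<in> hom J (usnd a) (usnd b)"
    by simp_all
  show "f \<cdot>\<^bsub>uprod I J\<^esub> Ide (uprod I J) a = f \<and> Ide (uprod I J) b \<cdot>\<^bsub>uprod I J\<^esub> f = f"
    using f category_hom_obj[OF I, of "ufst f" "ufst a" "ufst b"]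
      category_hom_obj[OF J, of "usnd f" "usnd a" "usnd b"]
      category_ide[OF I, of "ufst a"] category_ide[OF I, of "ufst b"]
      category_ide[OF J, of "usnd a"] category_ide[OF J, of "usnd b"]
    by (auto simp: Comp_uprod[of _ I _ _ _ _ J]
        category_id_left[OF I] category_id_left[OF J] category_id_right[OF I] category_id_right[OF J])
  assume "g \<in> hom (uprod I J) b c"
  then have g: "ufst g \<in> hom I (ufst b) (ufst c)" "usnd g \<in> hom J (usnd b) (usnd c)"
    by simp_all
  show "g \<cdot>\<^bsub>uprod I J\<^esub> f \<in> hom (uprod I J) a c"
    using f g by (simp add: Comp_uprod[of _ I _ _ _ _ J] category_comp[OF I] category_comp[OF J])
  assume "h \<in> hom (uprod I J) c d"
  then have h: "ufst h \<in> hom I (ufst c) (ufst d)" "usnd h \<in> hom J (usnd c) (usnd d)"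
    by simp_all
  show "(h \<cdot>\<^bsub>uprod I J\<^esub> g) \<cdot>\<^bsub>uprod I J\<^esub> f = h \<cdot>\<^bsub>uprod I J\<^esub> (g \<cdot>\<^bsub>uprod I J\<^esub> f)"
    using f g h category_comp[OF I f(1) g(1)] category_comp[OF I g(1) h(1)]
      category_comp[OF J f(2) g(2)] category_comp[OF J g(2) h(2)]
    by (simp add: Comp_uprod[of _ I _ _ _ _ J] category_assoc[OF I] category_assoc[OF J])
next
  fix f g assume "\<not> composable (uprod I J) g f"
  then show "g \<cdot>\<^bsub>uprod I J\<^esub> f = undefined"
    by (simp add: composable_uprod) (auto simp: uprod_def)
qed (auto simp: category_ide[OF I] category_ide[OF J])

section \<open>Smallness of products\<close>

lemma small_finite: "finite (A :: 'u::infinite set) \<Longrightarrow> small A"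
  unfolding small_def
  by (metis card_of_ordLeq_finite infinite_UNIV card_of_Well_order not_ordLeq_iff_ordLess)

text \<open>Only the arithmetic of a product of two sets enters: it is finite, or else it has the
  cardinality of the larger factor. Either way it stays strictly below that of
  \<open>'u\<close>.\<close>

lemma small_upair_image:
  fixes A B :: "'u::infinite set"
  assumes A: "small A" and B: "small B"
  shows "small (upair ` (A \<times> B))"
proof -
  let ?U = "card_of (UNIV :: 'u set)"
  have "(card_of (A \<times> B), ?U) \<in> ordLess" if "infinite A \<or> infinite B" "A \<noteq> {}" "B \<noteq> {}"
  \<comment> \<open>The larger factor is infinite because one of the two is, and it absorbs the
    other, which is nonempty.\<close>
  proof (cases "(card_of B, card_of A) \<in> ordLeq")
    case True
    then have "(card_of (A \<times> B), card_of A) \<in> ordIso"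
      using that card_of_ordLeq_finite card_of_Times_infinite_simps(1) by metis
    then show ?thesis
      using A unfolding small_def by (rule ordIso_ordLess_trans)
  next
    case False
    then have AB: "(card_of A, card_of B) \<in> ordLeq"
      using ordLeq_total card_of_Well_order by metis
    then have "(card_of (A \<times> B), card_of B) \<in> ordIso"
      using that card_of_ordLeq_finite card_of_Times_infinite_simps(3) by metis
    then show ?thesis
      using B unfolding small_def by (rule ordIso_ordLess_trans)
  qed
  \<comment> \<open>This also settles the case of an empty factor, where the product is
    empty.\<close>
  moreover have "small (upair ` (A \<times> B))" if "finite (A \<times> B)"
    using that by (simp add: small_finite)
  ultimately show ?thesis
    unfolding small_def
    by (metis card_of_image finite_SigmaI finite.emptyI Sigma_empty1 Sigma_empty2
        ordLeq_ordLess_trans)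
qed

lemma small_category_uprod:
  assumes "small_category I" "small_category J"
  shows "small_category (uprod I J)"
proof -
  have "Obj (uprod I J) = upair ` (Obj I \<times> Obj J)" "Arr (uprod I J) = upair ` (Arr I \<times> Arr J)"
    by (simp_all add: uprod_def)
  with assms show ?thesis
    by (simp add: small_category_def category_uprod small_upair_image)
qed

section \<open>The terminal category and functors on products\<close>

lemma uterm_simps [simp]:
  "Obj uterm = {ustar}" "Arr uterm = {ustar}" "Dom uterm ustar = ustar" "Cod uterm ustar = ustar"
  "Ide uterm ustar = ustar" "ustar \<cdot>\<^bsub>uterm\<^esub> ustar = ustar"
  by (simp_all add: uterm_def)

lemma hom_uterm [simp]: "f \<in> hom uterm a b \<longleftrightarrow> f = ustar \<and> a = ustar \<and> b = ustar"
  by (auto simp: hom_def)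

lemma small_category_uterm: "small_category (uterm :: ('u::infinite, 'u) cat)"
  unfolding small_category_def
proof (intro conjI categoryI)
  show "g \<cdot>\<^bsub>uterm\<^esub> f = undefined" if "\<not> composable uterm g f" for f g :: 'u
    using that by (auto simp: composable_def) (auto simp: uterm_def)
qed (auto simp: small_finite, auto simp: uterm_def)

lemma uprod_functor_simps [simp]:
  "ufst a \<in> Obj I \<Longrightarrow> usnd a \<in> Obj J \<Longrightarrow>
     fobj (uprod_functor I J H K) a = upair (fobj H (ufst a), fobj K (usnd a))"
  "ufst f \<in> Arr I \<Longrightarrow> usnd f \<in> Arr J \<Longrightarrow>
     farr (uprod_functor I J H K) f = upair (farr H (ufst f), farr K (usnd f))"
  by (simp_all add: uprod_functor_def)

lemma uassoc_simps [simp]: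
  "a \<in> Obj (uprod (uprod I J) K) \<Longrightarrow>
     fobj (uassoc I J K) a = upair (ufst (ufst a), upair (usnd (ufst a), usnd a))"
  "f \<in> Arr (uprod (uprod I J) K) \<Longrightarrow>
     farr (uassoc I J K) f = upair (ufst (ufst f), upair (usnd (ufst f), usnd f))"
  by (simp_all add: uassoc_def)

lemma unitor_functor_simps [simp]:
  "ufst a = ustar \<Longrightarrow> usnd a \<in> Obj I \<Longrightarrow> fobj (ulunit I) a = usnd a"
  "ufst f = ustar \<Longrightarrow> usnd f \<in> Arr I \<Longrightarrow> farr (ulunit I) f = usnd f"
  "ufst a \<in> Obj I \<Longrightarrow> usnd a = ustar \<Longrightarrow> fobj (urunit I) a = ufst a"
  "ufst f \<in> Arr I \<Longrightarrow> usnd f = ustar \<Longrightarrow> farr (urunit I) f = ufst f"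
  by (simp_all add: ulunit_def urunit_def)

lemma is_functor_uprod_functor:
  assumes I: "category I" and J: "category J"
    and H: "is_functor I I' H" and K: "is_functor J J' K"
  shows "is_functor (uprod I J) (uprod I' J') (uprod_functor I J H K)"
proof (rule is_functorI)
  fix f g a b c
  assume "f \<in> hom (uprod I J) a b"
  then have f: "ufst f \<in> hom I (ufst a) (ufst b)" "usnd f \<in> hom J (usnd a) (usnd b)"
    by simp_all
  show "farr (uprod_functor I J H K) f
      \<in> hom (uprod I' J') (fobj (uprod_functor I J H K) a) (fobj (uprod_functor I J H K) b)"
    using f category_hom_obj[OF I, of "ufst f" "ufst a" "ufst b"]
      category_hom_obj[OF J, of "usnd f" "usnd a" "usnd b"]
    by (auto simp: hom_Arr functor_hom[OF H] functor_hom[OF K])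
  assume "g \<in> hom (uprod I J) b c"
  then have g: "ufst g \<in> hom I (ufst b) (ufst c)" "usnd g \<in> hom J (usnd b) (usnd c)"
    by simp_all
  show "farr (uprod_functor I J H K) (g \<cdot>\<^bsub>uprod I J\<^esub> f)
      = farr (uprod_functor I J H K) g \<cdot>\<^bsub>uprod I' J'\<^esub> farr (uprod_functor I J H K) f"
    using f g hom_Arr[OF category_comp[OF I f(1) g(1)]] hom_Arr[OF category_comp[OF J f(2) g(2)]]
      functor_hom[OF H f(1)] functor_hom[OF H g(1)] functor_hom[OF K f(2)] functor_hom[OF K g(2)]
      functor_comp[OF H f(1) g(1)] functor_comp[OF K f(2) g(2)]
    by (simp add: Comp_uprod[of _ I _ _ _ _ J] Comp_uprod[of _ I' _ _ _ _ J'] hom_Arr)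
qed (auto simp: uprod_functor_def functor_obj[OF H] functor_obj[OF K] functor_ide[OF H]
      functor_ide[OF K] hom_Arr[OF category_ide[OF I]] hom_Arr[OF category_ide[OF J]])

section \<open>Monoidal categories\<close>

lemma prod_cat_simps [simp]:
  "p \<in> Obj (prod_cat C D) \<longleftrightarrow> fst p \<in> Obj C \<and> snd p \<in> Obj D"
  "q \<in> Arr (prod_cat C D) \<longleftrightarrow> fst q \<in> Arr C \<and> snd q \<in> Arr D"
  "a \<in> Obj C \<Longrightarrow> b \<in> Obj D \<Longrightarrow> Ide (prod_cat C D) (a, b) = (Ide C a, Ide D b)"
  "r \<in> hom (prod_cat C D) x y \<longleftrightarrow>
     fst r \<in> hom C (fst x) (fst y) \<and> snd r \<in> hom D (snd x) (snd y)"
  by (cases p; cases q; cases r; cases x; cases y; force simp: prod_cat_def hom_def)+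

lemma Comp_prod_cat:
  assumes "f \<in> hom C a b" "f' \<in> hom C b c" "g \<in> hom D a' b'" "g' \<in> hom D b' c'"
  shows "(f', g') \<cdot>\<^bsub>prod_cat C D\<^esub> (f, g) = (f' \<cdot>\<^bsub>C\<^esub> f, g' \<cdot>\<^bsub>D\<^esub> g)"
  using composable_hom[OF assms(1,2)] composable_hom[OF assms(3,4)] by (simp add: prod_cat_def)

locale monoidal_cat =
  fixes V :: "('o, 'm, 'z) moncat_scheme" (structure)
  assumes monoidal: "monoidal_category V"
begin

lemma category_V: "category V"
  and functor_tensor: "is_functor (prod_cat V V) V (Tensor V)"
  and unit_obj: "\<one> \<in> Obj V"
  using monoidal by (simp_all add: monoidal_category_def)

lemmas ide_hom = category_ide[OF category_V]
  and comp_hom = category_comp[OF category_V]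
  and id_right = category_id_right[OF category_V]
  and id_left = category_id_left[OF category_V]
  and comp_assoc = category_assoc[OF category_V]
  and hom_obj = category_hom_obj[OF category_V]

lemma tensor_obj: "a \<in> Obj V \<Longrightarrow> b \<in> Obj V \<Longrightarrow> a \<otimes> b \<in> Obj V"
  by (rule functor_obj[OF functor_tensor]) simp

lemma tensor_hom: "f \<in> hom V a b \<Longrightarrow> g \<in> hom V a' b' \<Longrightarrow> f \<odot> g \<in> hom V (a \<otimes> a') (b \<otimes> b')"
  by (rule functor_hom[OF functor_tensor]) simp

lemma tensor_ide: "a \<in> Obj V \<Longrightarrow> b \<in> Obj V \<Longrightarrow> Ide V a \<odot> Ide V b = Ide V (a \<otimes> b)"
  using functor_ide[OF functor_tensor, of "(a, b)"] by simp

text \<open>Functoriality of \<open>Tensor V\<close> on the product category. Every splitting of a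
  tensor of arrows into steps that keep one slot fixed is an instance of it.\<close>

lemma interchange:
  assumes "f \<in> hom V a b" "f' \<in> hom V b c" "g \<in> hom V a' b'" "g' \<in> hom V b' c'"
  shows "(f' \<odot> g') \<cdot> (f \<odot> g) = (f' \<cdot> f) \<odot> (g' \<cdot> g)"
  using functor_comp[OF functor_tensor, of "(f, g)" "(a, a')" "(b, b')" "(f', g')" "(c, c')"] assms
  by (simp add: Comp_prod_cat[OF assms])

lemma Assoc_hom:
  "a \<in> Obj V \<Longrightarrow> b \<in> Obj V \<Longrightarrow> c \<in> Obj V \<Longrightarrow>
     Assoc V a b c \<in> hom V ((a \<otimes> b) \<otimes> c) (a \<otimes> (b \<otimes> c))"
  and Assoc_iso: "a \<in> Obj V \<Longrightarrow> b \<in> Obj V \<Longrightarrow> c \<in> Obj V \<Longrightarrow> is_iso V (Assoc V a b c)"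
  and LUnit_hom: "a \<in> Obj V \<Longrightarrow> LUnit V a \<in> hom V (\<one> \<otimes> a) a"
  and LUnit_iso: "a \<in> Obj V \<Longrightarrow> is_iso V (LUnit V a)"
  and RUnit_hom: "a \<in> Obj V \<Longrightarrow> RUnit V a \<in> hom V (a \<otimes> \<one>) a"
  and RUnit_iso: "a \<in> Obj V \<Longrightarrow> is_iso V (RUnit V a)"
  using monoidal by (simp_all add: monoidal_category_def)

lemma Assoc_natural:
  assumes "f \<in> hom V a a'" "g \<in> hom V b b'" "h \<in> hom V c c'"
  shows "Assoc V a' b' c' \<cdot> ((f \<odot> g) \<odot> h) = (f \<odot> (g \<odot> h)) \<cdot> Assoc V a b c"
proof -
  have "\<forall>f \<in> Arr V. \<forall>g \<in> Arr V. \<forall>h \<in> Arr V.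
      Assoc V (Cod V f) (Cod V g) (Cod V h) \<cdot> ((f \<odot> g) \<odot> h)
        = (f \<odot> (g \<odot> h)) \<cdot> Assoc V (Dom V f) (Dom V g) (Dom V h)"
    using monoidal by (simp add: monoidal_category_def)
  from this[rule_format, of f g h] show ?thesis
    using assms by (simp add: hom_def)
qed

lemma LUnit_natural: "f \<in> hom V a b \<Longrightarrow> LUnit V b \<cdot> (Ide V \<one> \<odot> f) = f \<cdot> LUnit V a"
  and RUnit_natural: "f \<in> hom V a b \<Longrightarrow> RUnit V b \<cdot> (f \<odot> Ide V \<one>) = f \<cdot> RUnit V a"
  using monoidal by (auto simp: monoidal_category_def hom_def)

lemma pentagon:
  "a \<in> Obj V \<Longrightarrow> b \<in> Obj V \<Longrightarrow> c \<in> Obj V \<Longrightarrow> d \<in> Obj V \<Longrightarrow>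
     Assoc V a b (c \<otimes> d) \<cdot> Assoc V (a \<otimes> b) c d
       = (Ide V a \<odot> Assoc V b c d) \<cdot> Assoc V a (b \<otimes> c) d \<cdot> (Assoc V a b c \<odot> Ide V d)"
  and triangle: "a \<in> Obj V \<Longrightarrow> b \<in> Obj V \<Longrightarrow>
     (Ide V a \<odot> LUnit V b) \<cdot> Assoc V a \<one> b = RUnit V a \<odot> Ide V b"
  using monoidal by (simp_all add: monoidal_category_def)

end


section \<open>The Grothendieck construction is a category\<close>

lemma groth_simps [simp]:
  "Obj (groth V) = groth_obj V"
  "Arr (groth V) = groth_arr V"
  "X \<in> groth_obj V \<Longrightarrow> Ide (groth V) X = groth_id V X"
  "Unit (groth V) = diag_unit V"
  "Assoc (groth V) = groth_assoc V"
  "LUnit (groth V) = groth_lunit V"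
  "RUnit (groth V) = groth_runit V"
  "X \<in> groth_obj V \<Longrightarrow> Y \<in> groth_obj V \<Longrightarrow> X \<otimes>\<^bsub>groth V\<^esub> Y = diag_tensor V X Y"
  "s \<in> groth_arr V \<Longrightarrow> t \<in> groth_arr V \<Longrightarrow> s \<odot>\<^bsub>groth V\<^esub> t = garr_tensor V s t"
  by (simp_all add: groth_def)

lemma groth_obj_iff [simp]: "(I, F) \<in> groth_obj V \<longleftrightarrow> small_category I \<and> is_functor I V F"
  by (simp add: groth_obj_def)

lemma hom_groth_iff: "t \<in> hom (groth V) X Y \<longleftrightarrow> t \<in> groth_arr V \<and> gdom t = X \<and> gcod t = Y"
  by (auto simp: hom_def groth_def)

text \<open>Composition in \<open>groth V\<close> is guarded by a composability test; for typed
  arrows the guard is met and the bare formula remains.\<close>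

lemma Comp_groth:
  "s \<in> hom (groth V) X Y \<Longrightarrow> t \<in> hom (groth V) Y Z \<Longrightarrow> t \<cdot>\<^bsub>groth V\<^esub> s = groth_comp V t s"
  by (auto simp: hom_groth_iff) (simp add: groth_def)

text \<open>Naturality is stated with \<open>G\<close> applied to the reindexed arrow rather than
  with \<open>comp_functor\<close>, so the extensional guard of the composite functor is discharged
  once, here.\<close>

lemma groth_homI:
  assumes "gdom t = (I, F)" "gcod t = (J, G)"
    and "(I, F) \<in> groth_obj V" "(J, G) \<in> groth_obj V"
    and I: "category I" and H: "is_functor I J (gfun t)"
    and "gtrans t \<in> extensional (Obj I)"
    and "\<And>i. i \<in> Obj I \<Longrightarrow> gtrans t i \<in> hom V (fobj F i) (fobj G (fobj (gfun t) i))"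
    and nat: "\<And>f i j. f \<in> hom I i j \<Longrightarrow>
      gtrans t j \<cdot>\<^bsub>V\<^esub> farr F f = farr G (farr (gfun t) f) \<cdot>\<^bsub>V\<^esub> gtrans t i"
  shows "t \<in> hom (groth V) (I, F) (J, G)"
  using assms nat[OF Arr_hom]
  by (simp add: hom_groth_iff groth_arr_def is_nat_trans_def)

lemma groth_homD:
  assumes "t \<in> hom (groth V) (I, F) (J, G)"
  shows "gdom t = (I, F)" "gcod t = (J, G)"
    and "small_category I" "small_category J" "is_functor I V F" "is_functor J V G"
    and "is_functor I J (gfun t)"
    and "gtrans t \<in> extensional (Obj I)"
    and "\<And>i. i \<in> Obj I \<Longrightarrow> gtrans t i \<in> hom V (fobj F i) (fobj G (fobj (gfun t) i))"
    and "\<And>f i j. f \<in> hom I i j \<Longrightarrow>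
      gtrans t j \<cdot>\<^bsub>V\<^esub> farr F f = farr G (farr (gfun t) f) \<cdot>\<^bsub>V\<^esub> gtrans t i"
proof -
  have "is_nat_trans I V F (comp_functor I G (gfun t)) (gtrans t)"
    using assms by (auto simp: hom_groth_iff groth_arr_def)
  then show "gtrans t j \<cdot>\<^bsub>V\<^esub> farr F f = farr G (farr (gfun t) f) \<cdot>\<^bsub>V\<^esub> gtrans t i"
    if "f \<in> hom I i j" for f i j
    using hom_Arr[OF that] hom_Dom[OF that] hom_Cod[OF that] by (auto simp: is_nat_trans_def)
qed (use assms in \<open>auto simp: hom_groth_iff groth_arr_def is_nat_trans_def\<close>)

text \<open>The source and target are given by the typing and the remaining fields are extensional.
  This reduces every diagram in \<open>groth V\<close> to equations at single objects and arrows of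
  the index category.\<close>

lemma groth_arr_eqI:
  assumes s: "s \<in> hom (groth V) (I, F) Y" and t: "t \<in> hom (groth V) (I, F) Y"
    and eq: "\<And>i. i \<in> Obj I \<Longrightarrow> fobj (gfun s) i = fobj (gfun t) i"
      "\<And>f. f \<in> Arr I \<Longrightarrow> farr (gfun s) f = farr (gfun t) f"
      "\<And>i. i \<in> Obj I \<Longrightarrow> gtrans s i = gtrans t i"
  shows "s = t"
proof -
  obtain J G where Y: "Y = (J, G)"
    by (cases Y)
  note s' = groth_homD[OF s[unfolded Y]] and t' = groth_homD[OF t[unfolded Y]]
  show ?thesis
  proof (rule garr.equality)
    show "gfun s = gfun t"
      using s'(7) t'(7) eq(1,2) by (rule func_eqI)
    show "gtrans s = gtrans t"
      using s'(8) t'(8) eq(3) by (rule extensionalityI)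
  qed (simp_all add: s' t')
qed

lemma groth_comp_apply:
  assumes s: "s \<in> hom (groth V) (I, F) Y" and t: "t \<in> hom (groth V) Y Z"
  shows "i \<in> Obj I \<Longrightarrow> fobj (gfun (t \<cdot>\<^bsub>groth V\<^esub> s)) i = fobj (gfun t) (fobj (gfun s) i)"
    and "f \<in> Arr I \<Longrightarrow> farr (gfun (t \<cdot>\<^bsub>groth V\<^esub> s)) f = farr (gfun t) (farr (gfun s) f)"
    and "i \<in> Obj I \<Longrightarrow>
      gtrans (t \<cdot>\<^bsub>groth V\<^esub> s) i = gtrans t (fobj (gfun s) i) \<cdot>\<^bsub>V\<^esub> gtrans s i"
  unfolding Comp_groth[OF s t] using s by (simp_all add: groth_comp_def hom_groth_iff)

lemma groth_id_apply [simp]: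
  "gdom (groth_id V X) = X" "gcod (groth_id V X) = X"
  "i \<in> Obj (fst X) \<Longrightarrow> fobj (gfun (groth_id V X)) i = i"
  "f \<in> Arr (fst X) \<Longrightarrow> farr (gfun (groth_id V X)) f = f"
  "i \<in> Obj (fst X) \<Longrightarrow> gtrans (groth_id V X) i = Ide V (fobj (snd X) i)"
  by (cases X; simp add: groth_id_def)+

context monoidal_cat
begin

lemma groth_id_hom:
  assumes "X \<in> groth_obj V"
  shows "groth_id V X \<in> hom (groth V) X X"
proof -
  obtain I F where X: "X = (I, F)"
    by (cases X)
  have I: "category I" and F: "is_functor I V F"
    using assms small_category_category by (auto simp: X)
  show ?thesis
    unfolding X
  proof (rule groth_homI)
    show "is_functor I I (gfun (groth_id V (I, F)))"
      by (simp add: groth_id_def is_functor_id[OF I])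
    show "gtrans (groth_id V (I, F)) \<in> extensional (Obj I)"
      by (simp add: groth_id_def)
  next
    fix f i j assume f: "f \<in> hom I i j"
    show "gtrans (groth_id V (I, F)) j \<cdot> farr F f
        = farr F (farr (gfun (groth_id V (I, F))) f) \<cdot> gtrans (groth_id V (I, F)) i"
      using category_hom_obj[OF I f] hom_Arr[OF f] functor_hom[OF F f] by (simp add: id_left id_right)
  qed (use assms I in \<open>simp_all add: X ide_hom functor_obj[OF F]\<close>)
qed

text \<open>The two naturality squares are pasted, that of \<open>t\<close> being taken at the image
  of \<open>f\<close> under the functor of \<open>s\<close>.\<close>

lemma groth_comp_hom:
  assumes s: "s \<in> hom (groth V) X Y" and t: "t \<in> hom (groth V) Y Z"
  shows "t \<cdot>\<^bsub>groth V\<^esub> s \<in> hom (groth V) X Z"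
proof -
  obtain I F J G L M where XYZ: "X = (I, F)" "Y = (J, G)" "Z = (L, M)"
    by (cases X, cases Y, cases Z)
  note s' = s[unfolded XYZ] and t' = t[unfolded XYZ]
  note S = groth_homD[OF s'] and T = groth_homD[OF t']
  have I: "category I"
    using S(3) by (rule small_category_category)
  note A = groth_comp_apply[OF s' t']
  show ?thesis
    unfolding XYZ
  proof (rule groth_homI)
    show "is_functor I L (gfun (t \<cdot>\<^bsub>groth V\<^esub> s))"
      using is_functor_comp[OF I S(7) T(7)] S(1) by (simp add: Comp_groth[OF s t] groth_comp_def)
    show "gtrans (t \<cdot>\<^bsub>groth V\<^esub> s) \<in> extensional (Obj I)"
      using S(1) by (simp add: Comp_groth[OF s t] groth_comp_def)
    show "gtrans (t \<cdot>\<^bsub>groth V\<^esub> s) i \<in> hom V (fobj F i) (fobj M (fobj (gfun (t \<cdot>\<^bsub>groth V\<^esub> s)) i))"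
      if "i \<in> Obj I" for i
      using comp_hom[OF S(9) T(9)[OF functor_obj[OF S(7)]]] that by (simp add: A)
  next
    fix f i j assume f: "f \<in> hom I i j"
    note ij = category_hom_obj[OF I f]
    let ?Hi = "fobj (gfun s) i" and ?Hj = "fobj (gfun s) j" and ?Hf = "farr (gfun s) f"
    have Hf: "?Hf \<in> hom J ?Hi ?Hj"
      by (rule functor_hom[OF S(7) f])
    note h = functor_hom[OF S(5) f] S(9)[OF ij(1)] S(9)[OF ij(2)] functor_hom[OF S(6) Hf]
      T(9)[OF functor_obj[OF S(7) ij(1)]] T(9)[OF functor_obj[OF S(7) ij(2)]]
      functor_hom[OF T(6) functor_hom[OF T(7) Hf]]
    have "(gtrans t ?Hj \<cdot> gtrans s j) \<cdot> farr F f = gtrans t ?Hj \<cdot> (farr G ?Hf \<cdot> gtrans s i)"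
      using S(10)[OF f] by (simp add: comp_assoc[OF h(1) h(3) h(6)])
    also have "\<dots> = (farr M (farr (gfun t) ?Hf) \<cdot> gtrans t ?Hi) \<cdot> gtrans s i"
      by (simp add: comp_assoc[OF h(2) h(4) h(6), symmetric] T(10)[OF Hf])
    also have "\<dots> = farr M (farr (gfun t) ?Hf) \<cdot> (gtrans t ?Hi \<cdot> gtrans s i)"
      by (rule comp_assoc[OF h(2) h(5) h(7)])
    finally show "gtrans (t \<cdot>\<^bsub>groth V\<^esub> s) j \<cdot> farr F f
        = farr M (farr (gfun (t \<cdot>\<^bsub>groth V\<^esub> s)) f) \<cdot> gtrans (t \<cdot>\<^bsub>groth V\<^esub> s) i"
      using ij hom_Arr[OF f] by (simp add: A)
  qed (use S T I in \<open>simp_all add: Comp_groth[OF s t] groth_comp_def\<close>)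
qed

text \<open>On functor parts the laws hold by evaluation; on transformation parts they are the
  identity and associativity laws of \<open>V\<close>, taken at objects reindexed along the
  functors.\<close>

lemma category_groth:
  "category (groth V :: (('u::infinite, 'o, 'm) diagram, ('u, 'o, 'm) garr) moncat)"
proof (rule categoryI)
  show "Dom (groth V) f \<in> Obj (groth V) \<and> Cod (groth V) f \<in> Obj (groth V)"
    if "f \<in> Arr (groth V)" for f :: "('u, 'o, 'm) garr"
    using that by (auto simp: groth_def groth_arr_def)
next
  fix f g :: "('u, 'o, 'm) garr"
  show "\<not> composable (groth V) g f \<Longrightarrow> g \<cdot>\<^bsub>groth V\<^esub> f = undefined"
    by (auto simp: composable_def groth_def)
next
  fix f g h :: "('u, 'o, 'm) garr" and X Y Z W :: "('u, 'o, 'm) diagram"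
  assume f: "f \<in> hom (groth V) X Y"
  obtain I F J G where XY: "X = (I, F)" "Y = (J, G)"
    by (cases X, cases Y)
  note f' = f[unfolded XY(1)] and D = groth_homD[OF f[unfolded XY]]
  have X: "X \<in> groth_obj V" and Y: "Y \<in> groth_obj V"
    using D by (simp_all add: XY)
  have iX: "groth_id V X \<in> hom (groth V) (I, F) X" and iY: "groth_id V Y \<in> hom (groth V) Y Y"
    using groth_id_hom[OF X] groth_id_hom[OF Y] by (simp_all add: XY)
  have "f \<cdot>\<^bsub>groth V\<^esub> groth_id V X = f"
    using groth_comp_hom[OF iX f] f'
  proof (rule groth_arr_eqI)
    fix i assume "i \<in> Obj I"
    then show "fobj (gfun (f \<cdot>\<^bsub>groth V\<^esub> groth_id V X)) i = fobj (gfun f) i"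
      "gtrans (f \<cdot>\<^bsub>groth V\<^esub> groth_id V X) i = gtrans f i"
      using id_right[OF D(9)] by (simp_all add: groth_comp_apply[OF iX f], simp_all add: XY)
  qed (simp add: groth_comp_apply[OF iX f], simp add: XY)
  moreover have "groth_id V Y \<cdot>\<^bsub>groth V\<^esub> f = f"
    using groth_comp_hom[OF f' iY] f'
  proof (rule groth_arr_eqI)
    fix i assume "i \<in> Obj I"
    then show "fobj (gfun (groth_id V Y \<cdot>\<^bsub>groth V\<^esub> f)) i = fobj (gfun f) i"
      "gtrans (groth_id V Y \<cdot>\<^bsub>groth V\<^esub> f) i = gtrans f i"
      using id_left[OF D(9)] functor_obj[OF D(7)] by (simp_all add: groth_comp_apply[OF f' iY], simp_all add: XY)
  qed (simp add: groth_comp_apply[OF f' iY], simp add: XY functor_Arr[OF D(7)])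
  ultimately show "f \<cdot>\<^bsub>groth V\<^esub> Ide (groth V) X = f \<and> Ide (groth V) Y \<cdot>\<^bsub>groth V\<^esub> f = f"
    using X Y by simp
  assume g: "g \<in> hom (groth V) Y Z"
  then show "g \<cdot>\<^bsub>groth V\<^esub> f \<in> hom (groth V) X Z"
    by (rule groth_comp_hom[OF f])
  assume h: "h \<in> hom (groth V) Z W"
  obtain L M where Z: "Z = (L, M)"
    by (cases Z)
  obtain P N where W: "W = (P, N)"
    by (cases W)
  note DG = groth_homD[OF g[unfolded XY Z]] and DH = groth_homD[OF h[unfolded Z W]]
  note g' = g[unfolded XY(2)] and gf = groth_comp_hom[OF f' g]
  note A = groth_comp_apply[OF f' g] groth_comp_apply[OF gf h] groth_comp_apply[OF g' h]
    groth_comp_apply[OF f' groth_comp_hom[OF g h]]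
  show "(h \<cdot>\<^bsub>groth V\<^esub> g) \<cdot>\<^bsub>groth V\<^esub> f = h \<cdot>\<^bsub>groth V\<^esub> (g \<cdot>\<^bsub>groth V\<^esub> f)"
    using groth_comp_hom[OF f' groth_comp_hom[OF g h]] groth_comp_hom[OF gf h]
  proof (rule groth_arr_eqI)
    fix i assume i: "i \<in> Obj I"
    note Hi = functor_obj[OF D(7) i]
    show "fobj (gfun ((h \<cdot>\<^bsub>groth V\<^esub> g) \<cdot>\<^bsub>groth V\<^esub> f)) i
        = fobj (gfun (h \<cdot>\<^bsub>groth V\<^esub> (g \<cdot>\<^bsub>groth V\<^esub> f))) i"
      using i Hi by (simp add: A)
    show "gtrans ((h \<cdot>\<^bsub>groth V\<^esub> g) \<cdot>\<^bsub>groth V\<^esub> f) i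
        = gtrans (h \<cdot>\<^bsub>groth V\<^esub> (g \<cdot>\<^bsub>groth V\<^esub> f)) i"
      using i Hi comp_assoc[OF D(9)[OF i] DG(9)[OF Hi] DH(9)[OF functor_obj[OF DG(7) Hi]]]
      by (simp add: A)
  qed (simp add: A functor_Arr[OF D(7)])
qed (simp_all add: groth_id_hom, auto simp: groth_def)

text \<open>The inverse consists of the inverse functor \<open>H'\<close> and, at \<open>j\<close>,
  the inverse of the component of \<open>t\<close> at \<open>H' j\<close>. The associator and
  unitors of diagrams all have this shape.\<close>

lemma groth_isoI:
  assumes t: "t \<in> hom (groth V) (I, F) (J, G)"
    and obj: "bij_betw (fobj (gfun t)) (Obj I) (Obj J)"
    and arr: "bij_betw (farr (gfun t)) (Arr I) (Arr J)"
    and iso: "\<And>i. i \<in> Obj I \<Longrightarrow> is_iso V (gtrans t i)"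
  shows "is_iso (groth V) t"
proof -
  note D = groth_homD[OF t]
  have I: "category I" and J: "category J"
    using D(3,4) by (simp_all add: small_category_category)
  let ?H = "gfun t" and ?\<tau> = "gtrans t"
  obtain H' where H': "is_functor J I H'"
    and o1: "\<And>i. i \<in> Obj I \<Longrightarrow> fobj H' (fobj ?H i) = i" and o2: "\<And>j. j \<in> Obj J \<Longrightarrow> fobj ?H (fobj H' j) = j"
    and a1: "\<And>f. f \<in> Arr I \<Longrightarrow> farr H' (farr ?H f) = f" and a2: "\<And>g. g \<in> Arr J \<Longrightarrow> farr ?H (farr H' g) = g"
    using functor_inverse[OF I D(7) obj arr] by metis
  have "\<exists>g. g \<in> hom V (fobj G (fobj ?H i)) (fobj F i) \<and> g \<cdot> ?\<tau> i = Ide V (fobj F i)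
      \<and> ?\<tau> i \<cdot> g = Ide V (fobj G (fobj ?H i))" if "i \<in> Obj I" for i
    using is_isoE[OF iso D(9), OF that that] by metis
  \<comment> \<open>The pointwise inverses are chosen all at once; their naturality is not part of
    the choice and is derived afterwards.\<close>
  then obtain \<sigma> where \<sigma>: "\<And>i. i \<in> Obj I \<Longrightarrow> \<sigma> i \<in> hom V (fobj G (fobj ?H i)) (fobj F i)"
    and \<sigma>1: "\<And>i. i \<in> Obj I \<Longrightarrow> \<sigma> i \<cdot> ?\<tau> i = Ide V (fobj F i)"
    and \<sigma>2: "\<And>i. i \<in> Obj I \<Longrightarrow> ?\<tau> i \<cdot> \<sigma> i = Ide V (fobj G (fobj ?H i))"
    by metis
  define s where "s = \<lparr>gdom = (J, G), gcod = (I, F), gfun = H', gtrans = (\<lambda>j \<in> Obj J. \<sigma> (fobj H' j))\<rparr>"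
  have s: "s \<in> hom (groth V) (J, G) (I, F)"
  proof (rule groth_homI)
    show "gtrans s j \<in> hom V (fobj G j) (fobj F (fobj (gfun s) j))" if "j \<in> Obj J" for j
      using \<sigma>[OF functor_obj[OF H' that]] that by (simp add: s_def o2)
  next
    fix f j k assume f: "f \<in> hom J j k"
    note jk = category_hom_obj[OF J f]
    note jk' = functor_obj[OF H' jk(1)] functor_obj[OF H' jk(2)]
    let ?j = "fobj H' j" and ?k = "fobj H' k" and ?f = "farr H' f"
    note f' = functor_hom[OF H' f]
    have nat: "?\<tau> ?k \<cdot> farr F ?f = farr G f \<cdot> ?\<tau> ?j"
      using D(10)[OF f'] a2[OF hom_Arr[OF f]] by simp
    have h: "\<sigma> ?k \<in> hom V (fobj G k) (fobj F ?k)" "\<sigma> ?j \<in> hom V (fobj G j) (fobj F ?j)"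
      "?\<tau> ?j \<in> hom V (fobj F ?j) (fobj G j)" "?\<tau> ?k \<in> hom V (fobj F ?k) (fobj G k)"
      using \<sigma>[OF jk'(1)] \<sigma>[OF jk'(2)] D(9)[OF jk'(1)] D(9)[OF jk'(2)] jk by (simp_all add: o2)
    note Ff = functor_hom[OF D(5) f'] and Gf = functor_hom[OF D(6) f]
    \<comment> \<open>Naturality of the inverses: insert
      \<open>?\<tau> ?j \<cdot> \<sigma> ?j\<close> on the right, move \<open>farr G f\<close>
      across by naturality of \<open>?\<tau>\<close>, and cancel
      \<open>\<sigma> ?k \<cdot> ?\<tau> ?k\<close>.\<close>
    have "\<sigma> ?k \<cdot> farr G f = \<sigma> ?k \<cdot> (farr G f \<cdot> (?\<tau> ?j \<cdot> \<sigma> ?j))"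
      using \<sigma>2[OF jk'(1)] id_right[OF Gf] jk by (simp add: o2)
    also have "\<dots> = \<sigma> ?k \<cdot> (?\<tau> ?k \<cdot> farr F ?f) \<cdot> \<sigma> ?j"
      by (simp add: nat comp_assoc[OF h(2) h(3) Gf])
    also have "\<dots> = (\<sigma> ?k \<cdot> ?\<tau> ?k) \<cdot> farr F ?f \<cdot> \<sigma> ?j"
      using comp_assoc[OF comp_hom[OF h(2) Ff] h(4) h(1)] comp_assoc[OF h(2) Ff h(4)] by simp
    also have "\<dots> = farr F ?f \<cdot> \<sigma> ?j"
      using \<sigma>1[OF jk'(2)] id_left[OF comp_hom[OF h(2) Ff]] by simp
    finally show "gtrans s k \<cdot> farr G f = farr F (farr (gfun s) f) \<cdot> gtrans s j"
      using jk by (simp add: s_def)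
  qed (use D J H' in \<open>simp_all add: s_def\<close>)
  note A = groth_comp_apply[OF s t] groth_comp_apply[OF t s]
  have X: "(I, F) \<in> groth_obj V" and Y: "(J, G) \<in> groth_obj V"
    using D by simp_all
  show ?thesis
  proof (rule is_isoI[OF t s])
    have "s \<cdot>\<^bsub>groth V\<^esub> t = groth_id V (I, F)"
      using groth_comp_hom[OF t s] groth_id_hom[OF X]
      by (rule groth_arr_eqI) (simp_all add: A, simp_all add: s_def o1 a1 functor_obj[OF D(7)] \<sigma>1)
    then show "s \<cdot>\<^bsub>groth V\<^esub> t = Ide (groth V) (I, F)"
      using X by simp
    have "t \<cdot>\<^bsub>groth V\<^esub> s = groth_id V (J, G)"
      using groth_comp_hom[OF s t] groth_id_hom[OF Y]
      by (rule groth_arr_eqI)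
        (simp_all add: A, simp_all add: s_def o2 a2 \<sigma>2[OF functor_obj[OF H']])
    then show "t \<cdot>\<^bsub>groth V\<^esub> s = Ide (groth V) (J, G)"
      using Y by simp
  qed
qed

end

section \<open>The monoidal structure of the Grothendieck construction\<close>

text \<open>Names the functor part of \<open>diag_tensor\<close>, so that simplification turns a
  tensor of explicit pairs into an explicit pair and evaluates its functor only at points of the
  product.\<close>

definition box_functor ::
  "('o, 'm, 'z) moncat_scheme \<Rightarrow> ('u::infinite, 'u) cat \<Rightarrow> ('u, 'u) cat
    \<Rightarrow> ('u, 'u, 'o, 'm) func \<Rightarrow> ('u, 'u, 'o, 'm) func \<Rightarrow> ('u, 'u, 'o, 'm) func" where
  "box_functor V I J F G = snd (diag_tensor V (I, F) (J, G))"

lemma box_functor_simps [simp]: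
  "ufst a \<in> Obj I \<Longrightarrow> usnd a \<in> Obj J \<Longrightarrow>
     fobj (box_functor V I J F G) a = fobj F (ufst a) \<otimes>\<^bsub>V\<^esub> fobj G (usnd a)"
  "ufst f \<in> Arr I \<Longrightarrow> usnd f \<in> Arr J \<Longrightarrow>
     farr (box_functor V I J F G) f = farr F (ufst f) \<odot>\<^bsub>V\<^esub> farr G (usnd f)"
  by (simp_all add: box_functor_def diag_tensor_def)

lemma diag_tensor_eq [simp]: "diag_tensor V (I, F) (J, G) = (uprod I J, box_functor V I J F G)"
  by (simp add: box_functor_def diag_tensor_def)

definition unit_functor ::
  "('o, 'm, 'z) moncat_scheme \<Rightarrow> ('u, 'u, 'o, 'm) func" where
  "unit_functor V = snd (diag_unit V)"

lemma unit_functor_simps [simp]: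
  "fobj (unit_functor V) ustar = \<one>\<^bsub>V\<^esub>" "farr (unit_functor V) ustar = Ide V \<one>\<^bsub>V\<^esub>"
  by (simp_all add: unit_functor_def diag_unit_def)

lemma diag_unit_eq: "diag_unit V = (uterm, unit_functor V)"
  by (simp add: unit_functor_def diag_unit_def)

lemma garr_tensor_simps [simp]:
  "gdom (garr_tensor V s t) = diag_tensor V (gdom s) (gdom t)"
  "gcod (garr_tensor V s t) = diag_tensor V (gcod s) (gcod t)"
  "gfun (garr_tensor V s t) = uprod_functor (fst (gdom s)) (fst (gdom t)) (gfun s) (gfun t)"
  "ufst a \<in> Obj (fst (gdom s)) \<Longrightarrow> usnd a \<in> Obj (fst (gdom t)) \<Longrightarrow>
    gtrans (garr_tensor V s t) a = gtrans s (ufst a) \<odot>\<^bsub>V\<^esub> gtrans t (usnd a)"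
  "gtrans (garr_tensor V s t) \<in> extensional (Obj (uprod (fst (gdom s)) (fst (gdom t))))"
  by (simp_all add: garr_tensor_def Let_def)

lemma groth_assoc_simps [simp]:
  "gdom (groth_assoc V X Y Z) = diag_tensor V (diag_tensor V X Y) Z"
  "gcod (groth_assoc V X Y Z) = diag_tensor V X (diag_tensor V Y Z)"
  "gfun (groth_assoc V X Y Z) = uassoc (fst X) (fst Y) (fst Z)"
  "ufst (ufst a) \<in> Obj (fst X) \<Longrightarrow> usnd (ufst a) \<in> Obj (fst Y) \<Longrightarrow> usnd a \<in> Obj (fst Z) \<Longrightarrow>
    gtrans (groth_assoc V X Y Z) a
      = Assoc V (fobj (snd X) (ufst (ufst a))) (fobj (snd Y) (usnd (ufst a))) (fobj (snd Z) (usnd a))"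
  "gtrans (groth_assoc V X Y Z) \<in> extensional (Obj (uprod (uprod (fst X) (fst Y)) (fst Z)))"
  by (cases X; cases Y; cases Z; simp add: groth_assoc_def)+

lemma groth_unit_simps [simp]:
  "gdom (groth_lunit V X) = diag_tensor V (diag_unit V) X"
  "gcod (groth_lunit V X) = X"
  "gfun (groth_lunit V X) = ulunit (fst X)"
  "ufst a = ustar \<Longrightarrow> usnd a \<in> Obj (fst X) \<Longrightarrow>
    gtrans (groth_lunit V X) a = LUnit V (fobj (snd X) (usnd a))"
  "gtrans (groth_lunit V X) \<in> extensional (Obj (uprod uterm (fst X)))"
  "gdom (groth_runit V X) = diag_tensor V X (diag_unit V)"
  "gcod (groth_runit V X) = X"
  "gfun (groth_runit V X) = urunit (fst X)"
  "usnd a = ustar \<Longrightarrow> ufst a \<in> Obj (fst X) \<Longrightarrow>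
    gtrans (groth_runit V X) a = RUnit V (fobj (snd X) (ufst a))"
  "gtrans (groth_runit V X) \<in> extensional (Obj (uprod (fst X) uterm))"
  by (cases X; simp add: groth_lunit_def groth_runit_def)+

section \<open>Rebracketing and unit projections of index categories\<close>

lemma uassoc_bij:
  "bij_betw (fobj (uassoc I J K)) (Obj (uprod (uprod I J) K)) (Obj (uprod I (uprod J K)))"
  "bij_betw (farr (uassoc I J K)) (Arr (uprod (uprod I J) K)) (Arr (uprod I (uprod J K)))"
  by (rule bij_betw_byWitness[where f' = "\<lambda>x. upair (upair (ufst x, ufst (usnd x)), usnd (usnd x))"];
      auto)+

text \<open>Pairing with \<open>ustar\<close> inverts the projection, since the discarded coordinate
  can only be \<open>ustar\<close>.\<close>

lemma ulunit_bij:
  "bij_betw (fobj (ulunit I)) (Obj (uprod uterm I)) (Obj I)"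
  "bij_betw (farr (ulunit I)) (Arr (uprod uterm I)) (Arr I)"
  by (rule bij_betw_byWitness[where f' = "\<lambda>x. upair (ustar, x)"]; auto simp: upair_collapse)+

lemma urunit_bij:
  "bij_betw (fobj (urunit I)) (Obj (uprod I uterm)) (Obj I)"
  "bij_betw (farr (urunit I)) (Arr (uprod I uterm)) (Arr I)"
  by (rule bij_betw_byWitness[where f' = "\<lambda>x. upair (x, ustar)"]; auto simp: upair_collapse)+

lemma is_functor_uassoc:
  assumes I: "category I" and J: "category J" and K: "category K"
  shows "is_functor (uprod (uprod I J) K) (uprod I (uprod J K)) (uassoc I J K)"
proof (rule is_functorI)
  fix f a b assume f: "f \<in> hom (uprod (uprod I J) K) a b"
  show "farr (uassoc I J K) f
      \<in> hom (uprod I (uprod J K)) (fobj (uassoc I J K) a) (fobj (uassoc I J K) b)"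
    using f category_hom_obj[OF category_uprod[OF category_uprod[OF I J] K] f] hom_Arr[OF f] by simp
  fix g c assume g: "g \<in> hom (uprod (uprod I J) K) b c"
  have f': "ufst (ufst f) \<in> hom I (ufst (ufst a)) (ufst (ufst b))"
      "usnd (ufst f) \<in> hom J (usnd (ufst a)) (usnd (ufst b))" "usnd f \<in> hom K (usnd a) (usnd b)"
      "ufst f \<in> hom (uprod I J) (ufst a) (ufst b)"
    and g': "ufst (ufst g) \<in> hom I (ufst (ufst b)) (ufst (ufst c))"
      "usnd (ufst g) \<in> hom J (usnd (ufst b)) (usnd (ufst c))" "usnd g \<in> hom K (usnd b) (usnd c)"
      "ufst g \<in> hom (uprod I J) (ufst b) (ufst c)"
    using f g by simp_all
  \<comment> \<open>The composite is evaluated down to its three coordinates in the left bracketing,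
    ready to be rebracketed.\<close>
  have gf: "g \<cdot>\<^bsub>uprod (uprod I J) K\<^esub> f = upair (upair (ufst (ufst g) \<cdot>\<^bsub>I\<^esub> ufst (ufst f),
      usnd (ufst g) \<cdot>\<^bsub>J\<^esub> usnd (ufst f)), usnd g \<cdot>\<^bsub>K\<^esub> usnd f)"
    using Comp_uprod[OF f'(4) g'(4) f'(3) g'(3)] Comp_uprod[OF f'(1) g'(1) f'(2) g'(2)] by simp
  \<comment> \<open>The last two coordinates are typed as arrows of \<open>uprod J K\<close>, which
    the outer product on the right-hand side needs before its composite can be evaluated.\<close>
  have h: "upair (usnd (ufst f), usnd f) \<in> hom (uprod J K) (upair (usnd (ufst a), usnd a))
        (upair (usnd (ufst b), usnd b))"
      "upair (usnd (ufst g), usnd g) \<in> hom (uprod J K) (upair (usnd (ufst b), usnd b))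
        (upair (usnd (ufst c), usnd c))"
    using f' g' by simp_all
  show "farr (uassoc I J K) (g \<cdot>\<^bsub>uprod (uprod I J) K\<^esub> f)
      = farr (uassoc I J K) g \<cdot>\<^bsub>uprod I (uprod J K)\<^esub> farr (uassoc I J K) f"
    using hom_Arr[OF category_comp[OF category_uprod[OF category_uprod[OF I J] K] f g]]
      hom_Arr[OF f] hom_Arr[OF g]
      Comp_uprod[of "upair (ufst (ufst f), upair (usnd (ufst f), usnd f))" I _ _
        "upair (ufst (ufst g), upair (usnd (ufst g), usnd g))" _ "uprod J K", simplified ufst_upair usnd_upair,
        OF f'(1) g'(1) h]
      Comp_uprod[of "upair (usnd (ufst f), usnd f)" J _ _ "upair (usnd (ufst g), usnd g)" _ K,
        simplified ufst_upair usnd_upair, OF f'(2) g'(2) f'(3) g'(3)]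
    by (simp add: gf)
qed (auto simp: uassoc_def hom_Arr[OF category_ide[OF I]] hom_Arr[OF category_ide[OF J]]
      hom_Arr[OF category_ide[OF K]])

lemma is_functor_ulunit:
  assumes I: "category I"
  shows "is_functor (uprod uterm I) I (ulunit I)"
proof (rule is_functorI)
  fix f a b assume f: "f \<in> hom (uprod uterm I) a b"
  then have f': "ufst f \<in> hom uterm ustar ustar" "usnd f \<in> hom I (usnd a) (usnd b)"
    by simp_all
  show "farr (ulunit I) f \<in> hom I (fobj (ulunit I) a) (fobj (ulunit I) b)"
    using f category_hom_obj[OF I f'(2)] hom_Arr[OF f'(2)] by simp
  fix g c assume g: "g \<in> hom (uprod uterm I) b c"
  then have g': "ufst g \<in> hom uterm ustar ustar" "usnd g \<in> hom I (usnd b) (usnd c)"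
    by simp_all
  show "farr (ulunit I) (g \<cdot>\<^bsub>uprod uterm I\<^esub> f) = farr (ulunit I) g \<cdot>\<^bsub>I\<^esub> farr (ulunit I) f"
    using f g hom_Arr[OF f'(2)] hom_Arr[OF g'(2)] hom_Arr[OF category_comp[OF I f'(2) g'(2)]]
    by (simp add: Comp_uprod[OF f'(1) g'(1) f'(2) g'(2)])
qed (auto simp: ulunit_def hom_Arr[OF category_ide[OF I]])

lemma is_functor_urunit:
  assumes I: "category I"
  shows "is_functor (uprod I uterm) I (urunit I)"
proof (rule is_functorI)
  fix f a b assume f: "f \<in> hom (uprod I uterm) a b"
  then have f': "usnd f \<in> hom uterm ustar ustar" "ufst f \<in> hom I (ufst a) (ufst b)"
    by simp_all
  show "farr (urunit I) f \<in> hom I (fobj (urunit I) a) (fobj (urunit I) b)"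
    using f category_hom_obj[OF I f'(2)] hom_Arr[OF f'(2)] by simp
  fix g c assume g: "g \<in> hom (uprod I uterm) b c"
  then have g': "usnd g \<in> hom uterm ustar ustar" "ufst g \<in> hom I (ufst b) (ufst c)"
    by simp_all
  show "farr (urunit I) (g \<cdot>\<^bsub>uprod I uterm\<^esub> f) = farr (urunit I) g \<cdot>\<^bsub>I\<^esub> farr (urunit I) f"
    using f g hom_Arr[OF f'(2)] hom_Arr[OF g'(2)] hom_Arr[OF category_comp[OF I f'(2) g'(2)]]
    by (simp add: Comp_uprod[OF f'(2) g'(2) f'(1) g'(1)])
qed (auto simp: urunit_def hom_Arr[OF category_ide[OF I]])

section \<open>The tensor of diagrams and its constraints as morphisms\<close>

context monoidal_cat
begin

text \<open>Preservation of composites is the interchange law at the images under \<open>F\<close>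
  and \<open>G\<close>, preservation of identities is \<open>tensor_ide\<close>.\<close>

lemma is_functor_box:
  assumes I: "category I" and J: "category J" and F: "is_functor I V F" and G: "is_functor J V G"
  shows "is_functor (uprod I J) V (box_functor V I J F G)"
proof (rule is_functorI)
  fix f a b assume f: "f \<in> hom (uprod I J) a b"
  then have f': "ufst f \<in> hom I (ufst a) (ufst b)" "usnd f \<in> hom J (usnd a) (usnd b)"
    by simp_all
  show "farr (box_functor V I J F G) f
      \<in> hom V (fobj (box_functor V I J F G) a) (fobj (box_functor V I J F G) b)"
    using category_hom_obj[OF I f'(1)] category_hom_obj[OF J f'(2)] hom_Arr[OF f'(1)] hom_Arr[OF f'(2)]
    by (simp add: tensor_hom functor_hom[OF F f'(1)] functor_hom[OF G f'(2)])
  fix g c assume g: "g \<in> hom (uprod I J) b c"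
  then have g': "ufst g \<in> hom I (ufst b) (ufst c)" "usnd g \<in> hom J (usnd b) (usnd c)"
    by simp_all
  show "farr (box_functor V I J F G) (g \<cdot>\<^bsub>uprod I J\<^esub> f)
      = farr (box_functor V I J F G) g \<cdot> farr (box_functor V I J F G) f"
    using hom_Arr[OF f'(1)] hom_Arr[OF f'(2)] hom_Arr[OF g'(1)] hom_Arr[OF g'(2)]
      hom_Arr[OF category_comp[OF I f'(1) g'(1)]] hom_Arr[OF category_comp[OF J f'(2) g'(2)]]
    by (simp add: Comp_uprod[OF f'(1) g'(1) f'(2) g'(2)] functor_comp[OF F f'(1) g'(1)]
        functor_comp[OF G f'(2) g'(2)] interchange[OF functor_hom[OF F f'(1)] functor_hom[OF F g'(1)]
          functor_hom[OF G f'(2)] functor_hom[OF G g'(2)]])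
next
  show "fobj (box_functor V I J F G) \<in> extensional (Obj (uprod I J))"
    "farr (box_functor V I J F G) \<in> extensional (Arr (uprod I J))"
    by (simp_all add: box_functor_def diag_tensor_def comp_functor_def)
qed (auto simp: tensor_obj functor_obj[OF F] functor_obj[OF G] functor_ide[OF F] functor_ide[OF G]
      hom_Arr[OF category_ide[OF I]] hom_Arr[OF category_ide[OF J]] tensor_ide)

text \<open>The smallness condition on the index category is where the cardinal arithmetic of pairs
  is used.\<close>

lemma diag_tensor_obj:
  assumes "X \<in> groth_obj V" "Y \<in> groth_obj V"
  shows "diag_tensor V X Y \<in> groth_obj V"
  using assms
  by (cases X; cases Y)
    (simp add: small_category_uprod is_functor_box small_category_category)

lemma diag_unit_obj: "(diag_unit V :: ('u::infinite, 'o, 'm) diagram) \<in> groth_obj V"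
proof -
  have "is_functor (uterm :: ('u, 'u) cat) V (unit_functor V)"
    using ide_hom[OF unit_obj] unit_obj id_left[OF ide_hom[OF unit_obj]]
    by (intro is_functorI) (auto simp: unit_functor_def diag_unit_def)
  then show ?thesis
    by (simp add: diag_unit_eq small_category_uterm)
qed

lemma garr_tensor_hom:
  assumes s: "s \<in> hom (groth V) X X'" and t: "t \<in> hom (groth V) Y Y'"
  shows "garr_tensor V s t \<in> hom (groth V) (diag_tensor V X Y) (diag_tensor V X' Y')"
proof -
  obtain I F J G where XY: "X = (I, F)" "Y = (J, G)"
    by (cases X, cases Y)
  obtain I' F' J' G' where XY': "X' = (I', F')" "Y' = (J', G')"
    by (cases X', cases Y')
  note S = groth_homD[OF s[unfolded XY XY']] and T = groth_homD[OF t[unfolded XY XY']]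
  have I: "category I" and J: "category J"
    using S(3) T(3) by (simp_all add: small_category_category)
  note IJ = category_uprod[OF I J]
  have XYo: "diag_tensor V X Y \<in> groth_obj V" "diag_tensor V X' Y' \<in> groth_obj V"
    using S T by (simp_all add: diag_tensor_obj XY XY' del: diag_tensor_eq)
  show ?thesis
    unfolding XY XY' diag_tensor_eq
  proof (rule groth_homI)
    show "is_functor (uprod I J) (uprod I' J') (gfun (garr_tensor V s t))"
      by (simp add: S(1) T(1) is_functor_uprod_functor[OF I J S(7) T(7)])
    show "gtrans (garr_tensor V s t) \<in> extensional (Obj (uprod I J))"
      using garr_tensor_simps(5)[of V s t] by (simp add: S(1) T(1))
    show "gtrans (garr_tensor V s t) a \<in> hom V (fobj (box_functor V I J F G) a)
        (fobj (box_functor V I' J' F' G') (fobj (gfun (garr_tensor V s t)) a))"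
      if "a \<in> Obj (uprod I J)" for a
      using that tensor_hom[OF S(9) T(9)]
      by (simp add: S(1) T(1) functor_obj[OF S(7)] functor_obj[OF T(7)])
  next
    fix f a b assume f: "f \<in> hom (uprod I J) a b"
    then have f': "ufst f \<in> hom I (ufst a) (ufst b)" "usnd f \<in> hom J (usnd a) (usnd b)"
      by simp_all
    note o1 = category_hom_obj[OF I f'(1)] and o2 = category_hom_obj[OF J f'(2)]
    note Hf = functor_hom[OF S(7) f'(1)] and Kf = functor_hom[OF T(7) f'(2)]
    \<comment> \<open>Interchange on each side turns the square into the tensor of the naturality
      squares of \<open>s\<close> and \<open>t\<close>.\<close>
    have "(gtrans s (ufst b) \<odot> gtrans t (usnd b)) \<cdot> (farr F (ufst f) \<odot> farr G (usnd f))
      = (farr F' (farr (gfun s) (ufst f)) \<odot> farr G' (farr (gfun t) (usnd f)))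
         \<cdot> (gtrans s (ufst a) \<odot> gtrans t (usnd a))"
      using interchange[OF functor_hom[OF S(5) f'(1)] S(9)[OF o1(2)]
          functor_hom[OF T(5) f'(2)] T(9)[OF o2(2)]]
        interchange[OF S(9)[OF o1(1)] functor_hom[OF S(6) Hf] T(9)[OF o2(1)] functor_hom[OF T(6) Kf]]
      by (simp add: S(10)[OF f'(1)] T(10)[OF f'(2)])
    then show "gtrans (garr_tensor V s t) b \<cdot> farr (box_functor V I J F G) f
        = farr (box_functor V I' J' F' G') (farr (gfun (garr_tensor V s t)) f)
            \<cdot> gtrans (garr_tensor V s t) a"
      using o1 o2 hom_Arr[OF f'(1)] hom_Arr[OF f'(2)] hom_Arr[OF Hf] hom_Arr[OF Kf]
      by (simp add: S(1) T(1))
  qed (use XYo IJ in \<open>simp_all add: S(1,2) T(1,2) XY XY'\<close>)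
qed

text \<open>An arrow of the triple product has three coordinates; the square to be checked is
  naturality of the associator of \<open>V\<close> at their images under \<open>F\<close>,
  \<open>G\<close> and \<open>H\<close>.\<close>

lemma groth_assoc_hom:
  assumes "X \<in> groth_obj V" "Y \<in> groth_obj V" "Z \<in> groth_obj V"
  shows "groth_assoc V X Y Z \<in> hom (groth V)
    (diag_tensor V (diag_tensor V X Y) Z) (diag_tensor V X (diag_tensor V Y Z))"
proof -
  obtain I F J G K H where XYZ: "X = (I, F)" "Y = (J, G)" "Z = (K, H)"
    by (cases X, cases Y, cases Z)
  have I: "category I" "is_functor I V F" and J: "category J" "is_functor J V G"
    and K: "category K" "is_functor K V H"
    using assms small_category_category by (auto simp: XYZ)
  let ?D = "diag_tensor V (diag_tensor V X Y) Z" and ?C = "diag_tensor V X (diag_tensor V Y Z)"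
  have o: "?D \<in> groth_obj V" "?C \<in> groth_obj V"
    using assms by (simp_all add: diag_tensor_obj)
  show ?thesis
    unfolding XYZ diag_tensor_eq
  proof (rule groth_homI)
    show "gtrans (groth_assoc V (I, F) (J, G) (K, H)) \<in> extensional (Obj (uprod (uprod I J) K))"
      using groth_assoc_simps(5)[of V "(I, F)" "(J, G)" "(K, H)"] by simp
  next
    fix f a b assume f: "f \<in> hom (uprod (uprod I J) K) a b"
    then have f': "ufst (ufst f) \<in> hom I (ufst (ufst a)) (ufst (ufst b))"
        "usnd (ufst f) \<in> hom J (usnd (ufst a)) (usnd (ufst b))" "usnd f \<in> hom K (usnd a) (usnd b)"
      by simp_all
    show "gtrans (groth_assoc V (I, F) (J, G) (K, H)) b
          \<cdot> farr (box_functor V (uprod I J) K (box_functor V I J F G) H) f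
        = farr (box_functor V I (uprod J K) F (box_functor V J K G H))
            (farr (gfun (groth_assoc V (I, F) (J, G) (K, H))) f)
          \<cdot> gtrans (groth_assoc V (I, F) (J, G) (K, H)) a"
      using category_hom_obj[OF I(1) f'(1)] category_hom_obj[OF J(1) f'(2)]
        category_hom_obj[OF K(1) f'(3)] hom_Arr[OF f'(1)] hom_Arr[OF f'(2)] hom_Arr[OF f'(3)]
        Assoc_natural[OF functor_hom[OF I(2) f'(1)] functor_hom[OF J(2) f'(2)]
          functor_hom[OF K(2) f'(3)]]
      by simp
  qed (use o in \<open>auto simp: XYZ is_functor_uassoc[OF I(1) J(1) K(1)] category_uprod[OF category_uprod]
        I(1) J(1) K(1) Assoc_hom functor_obj[OF I(2)] functor_obj[OF J(2)] functor_obj[OF K(2)]\<close>)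
qed

lemma groth_lunit_hom:
  assumes "X \<in> groth_obj V"
  shows "groth_lunit V X \<in> hom (groth V) (diag_tensor V (diag_unit V) X) X"
proof -
  obtain I F where X: "X = (I, F)"
    by (cases X)
  have I: "category I" and F: "is_functor I V F"
    using assms small_category_category by (auto simp: X)
  have o: "diag_tensor V (diag_unit V) X \<in> groth_obj V"
    using assms by (simp add: diag_tensor_obj diag_unit_obj)
  show ?thesis
    unfolding X diag_tensor_eq diag_unit_eq
  proof (rule groth_homI)
    show "gtrans (groth_lunit V (I, F)) \<in> extensional (Obj (uprod uterm I))"
      using groth_unit_simps(5)[of V "(I, F)"] by simp
  next
    fix f a b assume "f \<in> hom (uprod uterm I) a b"
    then have f: "ufst f = ustar" "ufst a = ustar" "ufst b = ustar" "usnd f \<in> hom I (usnd a) (usnd b)"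
      by simp_all
    show "gtrans (groth_lunit V (I, F)) b \<cdot> farr (box_functor V uterm I (unit_functor V) F) f
        = farr F (farr (gfun (groth_lunit V (I, F))) f) \<cdot> gtrans (groth_lunit V (I, F)) a"
      using f(1-3) category_hom_obj[OF I f(4)] hom_Arr[OF f(4)] LUnit_natural[OF functor_hom[OF F f(4)]]
      by simp
  qed (use o assms in \<open>auto simp: X diag_unit_eq
        is_functor_ulunit[OF I] category_uprod I
        small_category_category[OF small_category_uterm] LUnit_hom functor_obj[OF F]\<close>)
qed

lemma groth_runit_hom:
  assumes "X \<in> groth_obj V"
  shows "groth_runit V X \<in> hom (groth V) (diag_tensor V X (diag_unit V)) X"
proof -
  obtain I F where X: "X = (I, F)"
    by (cases X)
  have I: "category I" and F: "is_functor I V F"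
    using assms small_category_category by (auto simp: X)
  have o: "diag_tensor V X (diag_unit V) \<in> groth_obj V"
    using assms by (simp add: diag_tensor_obj diag_unit_obj)
  show ?thesis
    unfolding X diag_tensor_eq diag_unit_eq
  proof (rule groth_homI)
    show "gtrans (groth_runit V (I, F)) \<in> extensional (Obj (uprod I uterm))"
      using groth_unit_simps(10)[of V "(I, F)"] by simp
  next
    fix f a b assume "f \<in> hom (uprod I uterm) a b"
    then have f: "usnd f = ustar" "usnd a = ustar" "usnd b = ustar" "ufst f \<in> hom I (ufst a) (ufst b)"
      by simp_all
    show "gtrans (groth_runit V (I, F)) b \<cdot> farr (box_functor V I uterm F (unit_functor V)) f
        = farr F (farr (gfun (groth_runit V (I, F))) f) \<cdot> gtrans (groth_runit V (I, F)) a"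
      using f(1-3) category_hom_obj[OF I f(4)] hom_Arr[OF f(4)] RUnit_natural[OF functor_hom[OF F f(4)]]
      by simp
  qed (use o assms in \<open>auto simp: X diag_unit_eq
        is_functor_urunit[OF I] category_uprod I
        small_category_category[OF small_category_uterm] RUnit_hom functor_obj[OF F]\<close>)
qed

section \<open>Invertibility of the constraints\<close>

lemma groth_assoc_iso:
  assumes "X \<in> groth_obj V" "Y \<in> groth_obj V" "Z \<in> groth_obj V"
  shows "is_iso (groth V) (groth_assoc V X Y Z)"
proof -
  obtain I F J G K H where XYZ: "X = (I, F)" "Y = (J, G)" "Z = (K, H)"
    by (cases X, cases Y, cases Z)
  have F: "is_functor I V F" and G: "is_functor J V G" and H: "is_functor K V H"
    using assms by (auto simp: XYZ)
  show ?thesis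
    using uassoc_bij[of I J K]
    by (intro groth_isoI[OF groth_assoc_hom[OF assms, unfolded XYZ diag_tensor_eq], folded XYZ])
      (auto simp: XYZ Assoc_iso functor_obj[OF F] functor_obj[OF G] functor_obj[OF H])
qed

lemma groth_lunit_iso:
  assumes "X \<in> groth_obj V"
  shows "is_iso (groth V) (groth_lunit V X)"
proof -
  obtain I F where X: "X = (I, F)"
    by (cases X)
  have F: "is_functor I V F"
    using assms by (auto simp: X)
  show ?thesis
    using ulunit_bij[of I]
    by (intro groth_isoI[OF groth_lunit_hom[OF assms, unfolded X diag_unit_eq diag_tensor_eq], folded X])
      (auto simp: X LUnit_iso functor_obj[OF F])
qed

lemma groth_runit_iso:
  assumes "X \<in> groth_obj V"
  shows "is_iso (groth V) (groth_runit V X)"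
proof -
  obtain I F where X: "X = (I, F)"
    by (cases X)
  have F: "is_functor I V F"
    using assms by (auto simp: X)
  show ?thesis
    using urunit_bij[of I]
    by (intro groth_isoI[OF groth_runit_hom[OF assms, unfolded X diag_unit_eq diag_tensor_eq], folded X])
      (auto simp: X RUnit_iso functor_obj[OF F])
qed

section \<open>Functoriality of the tensor of diagrams\<close>

lemma groth_tensor_ide:
  assumes "X \<in> groth_obj V" "Y \<in> groth_obj V"
  shows "garr_tensor V (groth_id V X) (groth_id V Y) = groth_id V (diag_tensor V X Y)"
proof -
  obtain I F J G where XY: "X = (I, F)" "Y = (J, G)"
    by (cases X, cases Y)
  have F: "is_functor I V F" and G: "is_functor J V G"
    using assms by (auto simp: XY)
  show ?thesis
    using garr_tensor_hom[OF groth_id_hom[OF assms(1)] groth_id_hom[OF assms(2)]]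
      groth_id_hom[OF diag_tensor_obj[OF assms]]
    unfolding XY diag_tensor_eq
    by (rule groth_arr_eqI) (auto simp: tensor_ide functor_obj[OF F] functor_obj[OF G])
qed

text \<open>Functor parts agree because both sides act coordinatewise. At a point \<open>a\<close>
  the transformation parts are related by interchange in \<open>V\<close>, with the second factors
  evaluated at the reindexed coordinates.\<close>

lemma groth_interchange:
  assumes s: "s \<in> hom (groth V) X X'" and s': "s' \<in> hom (groth V) X' X''"
    and t: "t \<in> hom (groth V) Y Y'" and t': "t' \<in> hom (groth V) Y' Y''"
  shows "garr_tensor V (s' \<cdot>\<^bsub>groth V\<^esub> s) (t' \<cdot>\<^bsub>groth V\<^esub> t)
    = garr_tensor V s' t' \<cdot>\<^bsub>groth V\<^esub> garr_tensor V s t"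
proof -
  obtain I F J G where XY: "X = (I, F)" "Y = (J, G)"
    by (cases X, cases Y)
  obtain I' F' J' G' where XY': "X' = (I', F')" "Y' = (J', G')"
    by (cases X', cases Y')
  obtain I'' F'' J'' G'' where XY'': "X'' = (I'', F'')" "Y'' = (J'', G'')"
    by (cases X'', cases Y'')
  note S = groth_homD[OF s[unfolded XY XY']] and T = groth_homD[OF t[unfolded XY XY']]
    and S' = groth_homD[OF s'[unfolded XY' XY'']] and T' = groth_homD[OF t'[unfolded XY' XY'']]
  note ss = groth_comp_hom[OF s s'] and tt = groth_comp_hom[OF t t']
  note D = groth_homD[OF ss[unfolded XY XY'']] groth_homD[OF tt[unfolded XY XY'']]
  note st = garr_tensor_hom[OF s t] and st' = garr_tensor_hom[OF s' t']
  note A = groth_comp_apply[OF s[unfolded XY] s'] groth_comp_apply[OF t[unfolded XY] t']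
    groth_comp_apply[OF st[unfolded XY diag_tensor_eq] st']
  show ?thesis
    using garr_tensor_hom[OF ss tt] groth_comp_hom[OF st st']
    unfolding XY diag_tensor_eq
  proof (rule groth_arr_eqI)
    fix a assume "a \<in> Obj (uprod I J)"
    then have a: "ufst a \<in> Obj I" "usnd a \<in> Obj J"
      by simp_all
    show "fobj (gfun (garr_tensor V (s' \<cdot>\<^bsub>groth V\<^esub> s) (t' \<cdot>\<^bsub>groth V\<^esub> t))) a
        = fobj (gfun (garr_tensor V s' t' \<cdot>\<^bsub>groth V\<^esub> garr_tensor V s t)) a"
      using a functor_obj[OF S(7) a(1)] functor_obj[OF T(7) a(2)]
      by (simp add: A, simp add: D S T S' T' A)
    show "gtrans (garr_tensor V (s' \<cdot>\<^bsub>groth V\<^esub> s) (t' \<cdot>\<^bsub>groth V\<^esub> t)) a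
        = gtrans (garr_tensor V s' t' \<cdot>\<^bsub>groth V\<^esub> garr_tensor V s t) a"
      using a functor_obj[OF S(7) a(1)] functor_obj[OF T(7) a(2)]
        interchange[OF S(9)[OF a(1)] S'(9)[OF functor_obj[OF S(7) a(1)]]
          T(9)[OF a(2)] T'(9)[OF functor_obj[OF T(7) a(2)]]]
      by (simp add: A, simp add: D(1,2,11,12) S(1,2) T(1,2) S'(1,2) T'(1,2) A)
  next
    fix f assume "f \<in> Arr (uprod I J)"
    then have f: "ufst f \<in> Arr I" "usnd f \<in> Arr J"
      by simp_all
    show "farr (gfun (garr_tensor V (s' \<cdot>\<^bsub>groth V\<^esub> s) (t' \<cdot>\<^bsub>groth V\<^esub> t))) f
        = farr (gfun (garr_tensor V s' t' \<cdot>\<^bsub>groth V\<^esub> garr_tensor V s t)) f"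
      using f functor_Arr[OF S(7) f(1)] functor_Arr[OF T(7) f(2)]
      by (simp add: A, simp add: D(1,2,11,12) S(1,2) T(1,2) S'(1,2) T'(1,2) A)
  qed
qed

section \<open>Naturality and coherence of the constraints\<close>

lemma groth_assoc_natural:
  assumes s: "s \<in> hom (groth V) X X'" and t: "t \<in> hom (groth V) Y Y'" and u: "u \<in> hom (groth V) Z Z'"
  shows "groth_assoc V X' Y' Z' \<cdot>\<^bsub>groth V\<^esub> garr_tensor V (garr_tensor V s t) u
    = garr_tensor V s (garr_tensor V t u) \<cdot>\<^bsub>groth V\<^esub> groth_assoc V X Y Z"
proof -
  obtain I F J G K H where XYZ: "X = (I, F)" "Y = (J, G)" "Z = (K, H)"
    by (cases X, cases Y, cases Z)
  obtain I' F' J' G' K' H' where XYZ': "X' = (I', F')" "Y' = (J', G')" "Z' = (K', H')"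
    by (cases X', cases Y', cases Z')
  note S = groth_homD[OF s[unfolded XYZ XYZ']] and T = groth_homD[OF t[unfolded XYZ XYZ']]
    and U = groth_homD[OF u[unfolded XYZ XYZ']]
  have o: "X \<in> groth_obj V" "Y \<in> groth_obj V" "Z \<in> groth_obj V"
    "X' \<in> groth_obj V" "Y' \<in> groth_obj V" "Z' \<in> groth_obj V"
    using S T U by (simp_all add: XYZ XYZ')
  note a = groth_assoc_hom[OF o(1-3)] and a' = groth_assoc_hom[OF o(4-6)]
  note st = garr_tensor_hom[OF s t] and tu = garr_tensor_hom[OF t u]
  note st_u = garr_tensor_hom[OF st u] and s_tu = garr_tensor_hom[OF s tu]
  note A = groth_comp_apply[OF st_u[unfolded XYZ diag_tensor_eq] a']
    groth_comp_apply[OF a[unfolded XYZ diag_tensor_eq] s_tu[unfolded XYZ diag_tensor_eq]]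
  show ?thesis
    using groth_comp_hom[OF st_u a'] groth_comp_hom[OF a s_tu]
    unfolding XYZ diag_tensor_eq
  proof (rule groth_arr_eqI)
    fix x assume "x \<in> Obj (uprod (uprod I J) K)"
    then have x: "ufst (ufst x) \<in> Obj I" "usnd (ufst x) \<in> Obj J" "usnd x \<in> Obj K"
      by simp_all
    note x' = functor_obj[OF S(7) x(1)] functor_obj[OF T(7) x(2)] functor_obj[OF U(7) x(3)]
    show "fobj (gfun (groth_assoc V X' Y' Z' \<cdot>\<^bsub>groth V\<^esub> garr_tensor V (garr_tensor V s t) u)) x
      = fobj (gfun (garr_tensor V s (garr_tensor V t u) \<cdot>\<^bsub>groth V\<^esub> groth_assoc V (I, F) (J, G) (K, H))) x"
      using x x' by (simp add: A, simp add: S(1,2) T(1,2) U(1,2) XYZ')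
    show "gtrans (groth_assoc V X' Y' Z' \<cdot>\<^bsub>groth V\<^esub> garr_tensor V (garr_tensor V s t) u) x
      = gtrans (garr_tensor V s (garr_tensor V t u) \<cdot>\<^bsub>groth V\<^esub> groth_assoc V (I, F) (J, G) (K, H)) x"
      using x x' Assoc_natural[OF S(9)[OF x(1)] T(9)[OF x(2)] U(9)[OF x(3)]]
      by (simp add: A, simp add: S(1,2) T(1,2) U(1,2) XYZ')
  next
    fix f assume "f \<in> Arr (uprod (uprod I J) K)"
    then have f: "ufst (ufst f) \<in> Arr I" "usnd (ufst f) \<in> Arr J" "usnd f \<in> Arr K"
      by simp_all
    note f' = functor_Arr[OF S(7) f(1)] functor_Arr[OF T(7) f(2)] functor_Arr[OF U(7) f(3)]
    show "farr (gfun (groth_assoc V X' Y' Z' \<cdot>\<^bsub>groth V\<^esub> garr_tensor V (garr_tensor V s t) u)) f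
      = farr (gfun (garr_tensor V s (garr_tensor V t u) \<cdot>\<^bsub>groth V\<^esub> groth_assoc V (I, F) (J, G) (K, H))) f"
      using f f' by (simp add: A, simp add: S(1,2) T(1,2) U(1,2) XYZ')
  qed
qed

lemma groth_lunit_natural:
  assumes s: "s \<in> hom (groth V) X X'"
  shows "groth_lunit V X' \<cdot>\<^bsub>groth V\<^esub> garr_tensor V (groth_id V (diag_unit V)) s
    = s \<cdot>\<^bsub>groth V\<^esub> groth_lunit V X"
proof -
  obtain I F I' F' where X: "X = (I, F)" "X' = (I', F')"
    by (cases X, cases X')
  note S = groth_homD[OF s[unfolded X]]
  have o: "X \<in> groth_obj V" "X' \<in> groth_obj V"
    using S by (simp_all add: X)
  note l = groth_lunit_hom[OF o(1)] and l' = groth_lunit_hom[OF o(2)]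
  note ist = garr_tensor_hom[OF groth_id_hom[OF diag_unit_obj] s]
  note A = groth_comp_apply[OF ist[unfolded X diag_unit_eq diag_tensor_eq, folded diag_unit_eq]
      l'[unfolded X diag_unit_eq diag_tensor_eq]]
    groth_comp_apply[OF l[unfolded X diag_unit_eq diag_tensor_eq] s[unfolded X]]
  show ?thesis
    using groth_comp_hom[OF ist l'] groth_comp_hom[OF l s]
    unfolding X diag_unit_eq diag_tensor_eq
  proof (rule groth_arr_eqI)
    fix x assume "x \<in> Obj (uprod uterm I)"
    then have x: "ufst x = ustar" "usnd x \<in> Obj I"
      by simp_all
    note x' = functor_obj[OF S(7) x(2)]
    show "fobj (gfun (groth_lunit V (I', F') \<cdot>\<^bsub>groth V\<^esub> garr_tensor V (groth_id V (uterm, unit_functor V)) s)) x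
      = fobj (gfun (s \<cdot>\<^bsub>groth V\<^esub> groth_lunit V (I, F))) x"
      using x x' by (simp add: A[unfolded diag_unit_eq], simp add: S(1,2))
    show "gtrans (groth_lunit V (I', F') \<cdot>\<^bsub>groth V\<^esub> garr_tensor V (groth_id V (uterm, unit_functor V)) s) x
      = gtrans (s \<cdot>\<^bsub>groth V\<^esub> groth_lunit V (I, F)) x"
      using x x' LUnit_natural[OF S(9)[OF x(2)]]
      by (simp add: A[unfolded diag_unit_eq], simp add: S(1,2))
  next
    fix f assume "f \<in> Arr (uprod uterm I)"
    then have f: "ufst f = ustar" "usnd f \<in> Arr I"
      by simp_all
    show "farr (gfun (groth_lunit V (I', F') \<cdot>\<^bsub>groth V\<^esub> garr_tensor V (groth_id V (uterm, unit_functor V)) s)) f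
      = farr (gfun (s \<cdot>\<^bsub>groth V\<^esub> groth_lunit V (I, F))) f"
      using f functor_Arr[OF S(7) f(2)] by (simp add: A[unfolded diag_unit_eq], simp add: S(1,2))
  qed
qed

lemma groth_runit_natural:
  assumes s: "s \<in> hom (groth V) X X'"
  shows "groth_runit V X' \<cdot>\<^bsub>groth V\<^esub> garr_tensor V s (groth_id V (diag_unit V))
    = s \<cdot>\<^bsub>groth V\<^esub> groth_runit V X"
proof -
  obtain I F I' F' where X: "X = (I, F)" "X' = (I', F')"
    by (cases X, cases X')
  note S = groth_homD[OF s[unfolded X]]
  have o: "X \<in> groth_obj V" "X' \<in> groth_obj V"
    using S by (simp_all add: X)
  note r = groth_runit_hom[OF o(1)] and r' = groth_runit_hom[OF o(2)]
  note si = garr_tensor_hom[OF s groth_id_hom[OF diag_unit_obj]]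
  note A = groth_comp_apply[OF si[unfolded X diag_unit_eq diag_tensor_eq, folded diag_unit_eq]
      r'[unfolded X diag_unit_eq diag_tensor_eq]]
    groth_comp_apply[OF r[unfolded X diag_unit_eq diag_tensor_eq] s[unfolded X]]
  show ?thesis
    using groth_comp_hom[OF si r'] groth_comp_hom[OF r s]
    unfolding X diag_unit_eq diag_tensor_eq
  proof (rule groth_arr_eqI)
    fix x assume "x \<in> Obj (uprod I uterm)"
    then have x: "usnd x = ustar" "ufst x \<in> Obj I"
      by simp_all
    note x' = functor_obj[OF S(7) x(2)]
    show "fobj (gfun (groth_runit V (I', F') \<cdot>\<^bsub>groth V\<^esub> garr_tensor V s (groth_id V (uterm, unit_functor V)))) x
      = fobj (gfun (s \<cdot>\<^bsub>groth V\<^esub> groth_runit V (I, F))) x"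
      using x x' by (simp add: A[unfolded diag_unit_eq], simp add: S(1,2))
    show "gtrans (groth_runit V (I', F') \<cdot>\<^bsub>groth V\<^esub> garr_tensor V s (groth_id V (uterm, unit_functor V))) x
      = gtrans (s \<cdot>\<^bsub>groth V\<^esub> groth_runit V (I, F)) x"
      using x x' RUnit_natural[OF S(9)[OF x(2)]]
      by (simp add: A[unfolded diag_unit_eq], simp add: S(1,2))
  next
    fix f assume "f \<in> Arr (uprod I uterm)"
    then have f: "usnd f = ustar" "ufst f \<in> Arr I"
      by simp_all
    show "farr (gfun (groth_runit V (I', F') \<cdot>\<^bsub>groth V\<^esub> garr_tensor V s (groth_id V (uterm, unit_functor V)))) f
      = farr (gfun (s \<cdot>\<^bsub>groth V\<^esub> groth_runit V (I, F))) f"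
      using f functor_Arr[OF S(7) f(2)] by (simp add: A[unfolded diag_unit_eq], simp add: S(1,2))
  qed
qed

text \<open>Both functor parts send a point with coordinates \<open>i\<close>, \<open>j\<close>,
  \<open>k\<close>, \<open>l\<close> to its fully right-bracketed form, and the transformation parts
  there are the two sides of the pentagon of \<open>V\<close> at the four values of the
  diagrams.\<close>

lemma groth_pentagon:
  assumes X: "X \<in> groth_obj V" and Y: "Y \<in> groth_obj V" and Z: "Z \<in> groth_obj V"
    and W: "W \<in> groth_obj V"
  shows "groth_assoc V X Y (diag_tensor V Z W) \<cdot>\<^bsub>groth V\<^esub> groth_assoc V (diag_tensor V X Y) Z W
    = garr_tensor V (groth_id V X) (groth_assoc V Y Z W)
      \<cdot>\<^bsub>groth V\<^esub> groth_assoc V X (diag_tensor V Y Z) W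
      \<cdot>\<^bsub>groth V\<^esub> garr_tensor V (groth_assoc V X Y Z) (groth_id V W)"
proof -
  obtain I F J G K H L M where eq: "X = (I, F)" "Y = (J, G)" "Z = (K, H)" "W = (L, M)"
    by (cases X, cases Y, cases Z, cases W)
  have F: "is_functor I V F" and G: "is_functor J V G" and H: "is_functor K V H" and M: "is_functor L V M"
    using assms by (auto simp: eq)
  note XY = diag_tensor_obj[OF X Y] and YZ = diag_tensor_obj[OF Y Z] and ZW = diag_tensor_obj[OF Z W]
  note l1 = groth_assoc_hom[OF XY Z W] and l2 = groth_assoc_hom[OF X Y ZW]
  note r1 = garr_tensor_hom[OF groth_assoc_hom[OF X Y Z] groth_id_hom[OF W]]
    and r2 = groth_assoc_hom[OF X YZ W]
    and r3 = garr_tensor_hom[OF groth_id_hom[OF X] groth_assoc_hom[OF Y Z W]]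
  note r21 = groth_comp_hom[OF r1 r2]
  note A = groth_comp_apply[OF l1[unfolded eq diag_tensor_eq] l2[unfolded eq diag_tensor_eq]]
    groth_comp_apply[OF r21[unfolded eq diag_tensor_eq] r3[unfolded eq diag_tensor_eq]]
    groth_comp_apply[OF r1[unfolded eq diag_tensor_eq] r2[unfolded eq diag_tensor_eq]]
  show ?thesis
    using groth_comp_hom[OF l1 l2] groth_comp_hom[OF r21 r3]
    unfolding eq diag_tensor_eq
    by (rule groth_arr_eqI)
      (auto simp: A pentagon functor_obj[OF F] functor_obj[OF G] functor_obj[OF H] functor_obj[OF M])
qed

text \<open>Both functor parts drop the middle coordinate \<open>ustar\<close>, at which the unit
  diagram takes the value \<open>\<one>\<close>; what remains is the triangle of
  \<open>V\<close>.\<close>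

lemma groth_triangle:
  assumes X: "X \<in> groth_obj V" and Y: "Y \<in> groth_obj V"
  shows "garr_tensor V (groth_id V X) (groth_lunit V Y) \<cdot>\<^bsub>groth V\<^esub> groth_assoc V X (diag_unit V) Y
    = garr_tensor V (groth_runit V X) (groth_id V Y)"
proof -
  obtain I F J G where eq: "X = (I, F)" "Y = (J, G)"
    by (cases X, cases Y)
  have F: "is_functor I V F" and G: "is_functor J V G"
    using assms by (auto simp: eq)
  note l1 = groth_assoc_hom[OF X diag_unit_obj Y]
    and l2 = garr_tensor_hom[OF groth_id_hom[OF X] groth_lunit_hom[OF Y]]
    and r = garr_tensor_hom[OF groth_runit_hom[OF X] groth_id_hom[OF Y]]
  note A = groth_comp_apply[OF l1[unfolded eq diag_unit_eq diag_tensor_eq]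
      l2[unfolded eq diag_unit_eq diag_tensor_eq]]
  show ?thesis
    using groth_comp_hom[OF l1 l2] r
    unfolding eq diag_unit_eq diag_tensor_eq
    by (rule groth_arr_eqI)
      (auto simp: A triangle diag_unit_eq functor_obj[OF F] functor_obj[OF G])
qed

text \<open>Part of what has to be shown, since \<open>lax_monoidal_functor\<close> demands a
  monoidal source. The typed facts are translated back into the form of the definition.\<close>

theorem monoidal_category_groth:
  "monoidal_category (groth V :: (('u::infinite, 'o, 'm) diagram, ('u, 'o, 'm) garr) moncat)"
proof -
  let ?G = "groth V :: (('u, 'o, 'm) diagram, ('u, 'o, 'm) garr) moncat"
  \<comment> \<open>The axioms range over untyped arrows; this gives each of them its hom-set, so
    that the typed naturality lemmas apply.\<close>
  have arr: "s \<in> hom ?G (Dom ?G s) (Cod ?G s)" "Dom ?G s \<in> groth_obj V" "Cod ?G s \<in> groth_obj V"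
    if "s \<in> groth_arr V" for s
    using Arr_hom[of s ?G] category_hom_obj[OF category_groth, of s] that by auto
  have "is_functor (prod_cat ?G ?G) ?G (Tensor ?G)"
  proof (rule is_functorI)
    show "fobj (Tensor ?G) \<in> extensional (Obj (prod_cat ?G ?G))"
      "farr (Tensor ?G) \<in> extensional (Arr (prod_cat ?G ?G))"
      by (simp_all add: groth_def prod_cat_def)
  next
    fix p assume "p \<in> Obj (prod_cat ?G ?G)"
    then obtain X Y where p: "p = (X, Y)" "X \<in> groth_obj V" "Y \<in> groth_obj V"
      by (cases p) auto
    show "fobj (Tensor ?G) p \<in> Obj ?G"
      using p by (simp add: diag_tensor_obj)
    show "farr (Tensor ?G) (Ide (prod_cat ?G ?G) p) = Ide ?G (fobj (Tensor ?G) p)"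
      using p groth_id_hom[OF p(2)] groth_id_hom[OF p(3)]
      by (simp add: diag_tensor_obj groth_tensor_ide hom_groth_iff)
  next
    fix q p p'
    assume q: "q \<in> hom (prod_cat ?G ?G) p p'"
    obtain s t X Y X' Y' where st: "q = (s, t)" "p = (X, Y)" "p' = (X', Y')"
      by (cases q, cases p, cases p')
    have s: "s \<in> hom ?G X X'" and t: "t \<in> hom ?G Y Y'"
      using q by (simp_all add: st)
    show "farr (Tensor ?G) q \<in> hom ?G (fobj (Tensor ?G) p) (fobj (Tensor ?G) p')"
      using s t category_hom_obj[OF category_groth s] category_hom_obj[OF category_groth t] hom_Arr[OF s] hom_Arr[OF t]
      by (simp add: st garr_tensor_hom)
    fix q' p''
    assume q': "q' \<in> hom (prod_cat ?G ?G) p' p''"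
    obtain s' t' X'' Y'' where st': "q' = (s', t')" "p'' = (X'', Y'')"
      by (cases q', cases p'')
    have s': "s' \<in> hom ?G X' X''" and t': "t' \<in> hom ?G Y' Y''"
      using q' by (simp_all add: st st')
    show "farr (Tensor ?G) (q' \<cdot>\<^bsub>prod_cat ?G ?G\<^esub> q) = farr (Tensor ?G) q' \<cdot>\<^bsub>?G\<^esub> farr (Tensor ?G) q"
      using hom_Arr[OF s] hom_Arr[OF t] hom_Arr[OF s'] hom_Arr[OF t']
        hom_Arr[OF groth_comp_hom[OF s s']] hom_Arr[OF groth_comp_hom[OF t t']]
        groth_interchange[OF s s' t t']
      by (simp add: st st' Comp_prod_cat[OF s s' t t'])
  qed
  moreover have "Assoc ?G (Cod ?G f) (Cod ?G g) (Cod ?G h) \<cdot>\<^bsub>?G\<^esub> ((f \<odot>\<^bsub>?G\<^esub> g) \<odot>\<^bsub>?G\<^esub> h)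
      = (f \<odot>\<^bsub>?G\<^esub> (g \<odot>\<^bsub>?G\<^esub> h)) \<cdot>\<^bsub>?G\<^esub> Assoc ?G (Dom ?G f) (Dom ?G g) (Dom ?G h)"
    if "f \<in> groth_arr V" "g \<in> groth_arr V" "h \<in> groth_arr V" for f g h
    using that groth_assoc_natural[OF arr(1) arr(1) arr(1), OF that]
      hom_Arr[OF garr_tensor_hom[OF arr(1) arr(1)], OF that(1,2)]
      hom_Arr[OF garr_tensor_hom[OF arr(1) arr(1)], OF that(2,3)]
    by simp
  moreover have "LUnit ?G (Cod ?G f) \<cdot>\<^bsub>?G\<^esub> (Ide ?G \<one>\<^bsub>?G\<^esub> \<odot>\<^bsub>?G\<^esub> f) = f \<cdot>\<^bsub>?G\<^esub> LUnit ?G (Dom ?G f)"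
    "RUnit ?G (Cod ?G f) \<cdot>\<^bsub>?G\<^esub> (f \<odot>\<^bsub>?G\<^esub> Ide ?G \<one>\<^bsub>?G\<^esub>) = f \<cdot>\<^bsub>?G\<^esub> RUnit ?G (Dom ?G f)"
    if "f \<in> groth_arr V" for f
    using that groth_lunit_natural[OF arr(1)[OF that]] groth_runit_natural[OF arr(1)[OF that]]
    by (simp_all add: diag_unit_obj hom_Arr[OF groth_id_hom[OF diag_unit_obj], simplified])
  moreover have "Assoc ?G a b (c \<otimes>\<^bsub>?G\<^esub> d) \<cdot>\<^bsub>?G\<^esub> Assoc ?G (a \<otimes>\<^bsub>?G\<^esub> b) c d
      = (Ide ?G a \<odot>\<^bsub>?G\<^esub> Assoc ?G b c d) \<cdot>\<^bsub>?G\<^esub> Assoc ?G a (b \<otimes>\<^bsub>?G\<^esub> c) d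
          \<cdot>\<^bsub>?G\<^esub> (Assoc ?G a b c \<odot>\<^bsub>?G\<^esub> Ide ?G d)"
    if "a \<in> groth_obj V" "b \<in> groth_obj V" "c \<in> groth_obj V" "d \<in> groth_obj V" for a b c d
    using that groth_pentagon[OF that] hom_Arr[OF groth_id_hom[OF that(1)]] hom_Arr[OF groth_id_hom[OF that(4)]]
      hom_Arr[OF groth_assoc_hom[OF that(1-3)]] hom_Arr[OF groth_assoc_hom[OF that(2-4)]]
    by simp
  moreover have "(Ide ?G a \<odot>\<^bsub>?G\<^esub> LUnit ?G b) \<cdot>\<^bsub>?G\<^esub> Assoc ?G a \<one>\<^bsub>?G\<^esub> b = RUnit ?G a \<odot>\<^bsub>?G\<^esub> Ide ?G b"
    if "a \<in> groth_obj V" "b \<in> groth_obj V" for a b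
    using that groth_triangle[OF that] hom_Arr[OF groth_id_hom[OF that(1)]] hom_Arr[OF groth_id_hom[OF that(2)]]
      hom_Arr[OF groth_lunit_hom[OF that(2)]] hom_Arr[OF groth_runit_hom[OF that(1)]]
    by simp
  ultimately show ?thesis
    unfolding monoidal_category_def
    by (simp add: category_groth diag_unit_obj diag_tensor_obj groth_assoc_hom groth_assoc_iso
        groth_lunit_hom groth_lunit_iso groth_runit_hom groth_runit_iso)
qed

end

section \<open>Colimits\<close>

lemma is_coconeI:
  assumes "category I" "c \<in> Obj V" "\<And>i. i \<in> Obj I \<Longrightarrow> \<iota> i \<in> hom V (fobj F i) c"
    and "\<And>f i j. f \<in> hom I i j \<Longrightarrow> \<iota> j \<cdot>\<^bsub>V\<^esub> farr F f = \<iota> i"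
  shows "is_cocone I V F c \<iota>"
  using assms(2-) Arr_hom by (fastforce simp: is_cocone_def)

lemma is_cocone_leg: "is_cocone I V F c \<iota> \<Longrightarrow> i \<in> Obj I \<Longrightarrow> \<iota> i \<in> hom V (fobj F i) c"
  and is_cocone_obj: "is_cocone I V F c \<iota> \<Longrightarrow> c \<in> Obj V"
  and is_cocone_comp: "is_cocone I V F c \<iota> \<Longrightarrow> f \<in> hom I i j \<Longrightarrow> \<iota> j \<cdot>\<^bsub>V\<^esub> farr F f = \<iota> i"
  by (auto simp: is_cocone_def hom_def)

lemma is_colimit_cocone: "is_colimit I V F c \<iota> \<Longrightarrow> is_cocone I V F c \<iota>"
  by (simp add: is_colimit_def)

lemmas is_colimit_leg = is_cocone_leg[OF is_colimit_cocone]
  and is_colimit_obj = is_cocone_obj[OF is_colimit_cocone]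
  and is_colimit_comp = is_cocone_comp[OF is_colimit_cocone]

lemma is_colimit_factor:
  assumes "is_colimit I V F c \<iota>" "is_cocone I V F d \<kappa>"
  obtains m where "m \<in> hom V c d" "\<And>i. i \<in> Obj I \<Longrightarrow> m \<cdot>\<^bsub>V\<^esub> \<iota> i = \<kappa> i"
  using assms unfolding is_colimit_def by blast

lemma is_cocone_postcomp:
  assumes V: "category V" and I: "category I" and F: "is_functor I V F"
    and c: "is_cocone I V F c \<iota>" and m: "m \<in> hom V c d"
  shows "is_cocone I V F d (\<lambda>i. m \<cdot>\<^bsub>V\<^esub> \<iota> i)"
proof (rule is_coconeI)
  show "(m \<cdot>\<^bsub>V\<^esub> \<iota> j) \<cdot>\<^bsub>V\<^esub> farr F f = m \<cdot>\<^bsub>V\<^esub> \<iota> i" if f: "f \<in> hom I i j" for f i j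
    using category_assoc[OF V functor_hom[OF F f] is_cocone_leg[OF c category_hom_obj(2)[OF I f]] m]
      is_cocone_comp[OF c f] by simp
qed (use I category_hom_obj[OF V m] category_comp[OF V is_cocone_leg[OF c] m] in auto)

text \<open>Both maps factor the cocone obtained by composing the legs with \<open>m\<close>, and
  such a factorization is unique.\<close>

lemma is_colimit_ext:
  assumes V: "category V" and I: "category I" and F: "is_functor I V F"
    and c: "is_colimit I V F c \<iota>" and m: "m \<in> hom V c d" and n: "n \<in> hom V c d"
    and eq: "\<And>i. i \<in> Obj I \<Longrightarrow> m \<cdot>\<^bsub>V\<^esub> \<iota> i = n \<cdot>\<^bsub>V\<^esub> \<iota> i"
  shows "m = n"
proof -
  have "\<exists>!p. p \<in> hom V c d \<and> (\<forall>i \<in> Obj I. p \<cdot>\<^bsub>V\<^esub> \<iota> i = m \<cdot>\<^bsub>V\<^esub> \<iota> i)"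
    using is_cocone_postcomp[OF V I F is_colimit_cocone[OF c] m] c unfolding is_colimit_def by blast
  moreover have "\<forall>i \<in> Obj I. n \<cdot>\<^bsub>V\<^esub> \<iota> i = m \<cdot>\<^bsub>V\<^esub> \<iota> i"
    by (metis eq)
  ultimately show ?thesis
    using m n by blast
qed

text \<open>The factorization \<open>n\<close> in the other direction is the inverse: both
  composites fix the legs, hence agree with identities. It is used for \<open>\<mu>\<close> and for
  \<open>\<eta>\<close>.\<close>

lemma is_colimit_comparison_iso:
  assumes V: "category V" and I: "category I" and F: "is_functor I V F"
    and c: "is_colimit I V F c \<iota>" and d: "is_colimit I V F d \<kappa>"
    and m: "m \<in> hom V c d" and eq: "\<And>i. i \<in> Obj I \<Longrightarrow> m \<cdot>\<^bsub>V\<^esub> \<iota> i = \<kappa> i"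
  shows "is_iso V m"
proof -
  obtain n where n: "n \<in> hom V d c" and eq': "\<And>i. i \<in> Obj I \<Longrightarrow> n \<cdot>\<^bsub>V\<^esub> \<kappa> i = \<iota> i"
    by (rule is_colimit_factor[OF d is_colimit_cocone[OF c]]) blast
  note ic = category_ide[OF V is_colimit_obj[OF c]] and id = category_ide[OF V is_colimit_obj[OF d]]
  have "n \<cdot>\<^bsub>V\<^esub> m = Ide V c"
    using category_assoc[OF V is_colimit_leg[OF c] m n] category_id_left[OF V is_colimit_leg[OF c]]
    by (intro is_colimit_ext[OF V I F c category_comp[OF V m n] ic]) (simp add: eq eq')
  moreover have "m \<cdot>\<^bsub>V\<^esub> n = Ide V d"
    using category_assoc[OF V is_colimit_leg[OF d] n m] category_id_left[OF V is_colimit_leg[OF d]]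
    by (intro is_colimit_ext[OF V I F d category_comp[OF V n m] id]) (simp add: eq eq')
  ultimately show ?thesis
    using is_isoI[OF m n] by blast
qed

section \<open>Tensor products of colimits\<close>

locale cocontinuous_monoidal_cat = monoidal_cat V
  for V :: "('o, 'm, 'z) moncat_scheme" (structure) +
  fixes universe :: "'u::infinite itself"
  assumes cocont_left: "A \<in> Obj V \<Longrightarrow> cocontinuous universe V V (tensor_left V A)"
    and cocont_right: "A \<in> Obj V \<Longrightarrow> cocontinuous universe V V (tensor_right V A)"
begin

text \<open>The legs stay in the form \<open>farr (tensor_left V A) (\<iota> i)\<close>: the
  extensional guard of \<open>tensor_left\<close> can be removed only where \<open>\<iota> i\<close>
  is known to be an arrow, that is for \<open>i\<close> in \<open>Obj I\<close>.\<close>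

lemma tensor_left_colimit:
  fixes I :: "('u, 'u) cat"
  assumes A: "A \<in> Obj V" and I: "small_category I" and F: "is_functor I V F"
    and c: "is_colimit I V F c \<iota>"
  shows "is_colimit I V (comp_functor I (tensor_left V A) F) (A \<otimes> c) (\<lambda>i. farr (tensor_left V A) (\<iota> i))"
proof -
  have "is_colimit I V (comp_functor I (tensor_left V A) F) (fobj (tensor_left V A) c)
      (\<lambda>i. farr (tensor_left V A) (\<iota> i))"
    using cocont_left[OF A] I F c unfolding cocontinuous_def by blast
  moreover have "fobj (tensor_left V A) c = A \<otimes> c"
    using is_colimit_obj[OF c] by (simp add: tensor_left_def)
  ultimately show ?thesis
    by (simp only:)
qed

lemma tensor_right_colimit:
  fixes I :: "('u, 'u) cat"
  assumes A: "A \<in> Obj V" and I: "small_category I" and F: "is_functor I V F"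
    and c: "is_colimit I V F c \<iota>"
  shows "is_colimit I V (comp_functor I (tensor_right V A) F) (c \<otimes> A) (\<lambda>i. farr (tensor_right V A) (\<iota> i))"
proof -
  have "is_colimit I V (comp_functor I (tensor_right V A) F) (fobj (tensor_right V A) c)
      (\<lambda>i. farr (tensor_right V A) (\<iota> i))"
    using cocont_right[OF A] I F c unfolding cocontinuous_def by blast
  moreover have "fobj (tensor_right V A) c = c \<otimes> A"
    using is_colimit_obj[OF c] by (simp add: tensor_right_def)
  ultimately show ?thesis
    by (simp only:)
qed

lemma tensor_left_simps [simp]:
  "x \<in> Obj V \<Longrightarrow> fobj (tensor_left V A) x = A \<otimes> x"
  "f \<in> hom V a b \<Longrightarrow> farr (tensor_left V A) f = Ide V A \<odot> f"
  "x \<in> Obj V \<Longrightarrow> fobj (tensor_right V A) x = x \<otimes> A"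
  "f \<in> hom V a b \<Longrightarrow> farr (tensor_right V A) f = f \<odot> Ide V A"
  by (auto simp: tensor_left_def tensor_right_def hom_Arr)

text \<open>Interchange with an identity in the fixed slot. Functoriality makes the composite
  diagrams of the Fubini argument functors, as \<open>is_colimit_ext\<close> requires.\<close>

lemma is_functor_tensor_left:
  assumes A: "A \<in> Obj V"
  shows "is_functor V V (tensor_left V A)"
proof (rule is_functorI)
  fix f g a b c assume f: "f \<in> hom V a b" and g: "g \<in> hom V b c"
  show "farr (tensor_left V A) (g \<cdot> f) = farr (tensor_left V A) g \<cdot> farr (tensor_left V A) f"
    using f g comp_hom[OF f g] interchange[OF ide_hom[OF A] ide_hom[OF A] f g] id_left[OF ide_hom[OF A]]
    by simp
next
  fix f a b assume f: "f \<in> hom V a b"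
  show "farr (tensor_left V A) f \<in> hom V (fobj (tensor_left V A) a) (fobj (tensor_left V A) b)"
    using f hom_obj[OF f] tensor_hom[OF ide_hom[OF A] f] by simp
next
  show "farr (tensor_left V A) (Ide V a) = Ide V (fobj (tensor_left V A) a)" if "a \<in> Obj V" for a
    using that tensor_ide[OF A that] ide_hom[OF that] by simp
qed (auto simp: tensor_obj A, auto simp: tensor_left_def)

lemma is_functor_tensor_right:
  assumes A: "A \<in> Obj V"
  shows "is_functor V V (tensor_right V A)"
proof (rule is_functorI)
  fix f g a b c assume f: "f \<in> hom V a b" and g: "g \<in> hom V b c"
  show "farr (tensor_right V A) (g \<cdot> f) = farr (tensor_right V A) g \<cdot> farr (tensor_right V A) f"
    using f g comp_hom[OF f g] interchange[OF f g ide_hom[OF A] ide_hom[OF A]] id_left[OF ide_hom[OF A]]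
    by simp
next
  fix f a b assume f: "f \<in> hom V a b"
  show "farr (tensor_right V A) f \<in> hom V (fobj (tensor_right V A) a) (fobj (tensor_right V A) b)"
    using f hom_obj[OF f] tensor_hom[OF f ide_hom[OF A]] by simp
next
  show "farr (tensor_right V A) (Ide V a) = Ide V (fobj (tensor_right V A) a)" if "a \<in> Obj V" for a
    using that tensor_ide[OF that A] ide_hom[OF that] by simp
qed (auto simp: tensor_obj A, auto simp: tensor_right_def)

text \<open>Two one-variable colimits are iterated: over \<open>J\<close> with
  \<open>fobj F i\<close> held fixed, then over \<open>I\<close> with the vertex \<open>d\<close>
  held fixed. Existence and uniqueness of the final map both descend through these two
  stages.\<close>

lemma tensor_colimit:
  fixes I J :: "('u, 'u) cat"
  assumes I: "small_category I" and J: "small_category J"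
    and F: "is_functor I V F" and G: "is_functor J V G"
    and c: "is_colimit I V F c \<iota>" and d: "is_colimit J V G d \<kappa>"
  shows "is_colimit (uprod I J) V (box_functor V I J F G) (c \<otimes> d) (\<lambda>a. \<iota> (ufst a) \<odot> \<kappa> (usnd a))"
proof -
  note I' = small_category_category[OF I] and J' = small_category_category[OF J]
  note c_obj = is_colimit_obj[OF c] and d_obj = is_colimit_obj[OF d]
  note leg = is_colimit_leg[OF c] is_colimit_leg[OF d]
  have cocone: "is_cocone (uprod I J) V (box_functor V I J F G) (c \<otimes> d) (\<lambda>a. \<iota> (ufst a) \<odot> \<kappa> (usnd a))"
  proof (rule is_coconeI)
    fix f a b assume "f \<in> hom (uprod I J) a b"
    then have f: "ufst f \<in> hom I (ufst a) (ufst b)" "usnd f \<in> hom J (usnd a) (usnd b)"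
      by simp_all
    note o = category_hom_obj[OF I' f(1)] category_hom_obj[OF J' f(2)]
    show "(\<iota> (ufst b) \<odot> \<kappa> (usnd b)) \<cdot> farr (box_functor V I J F G) f = \<iota> (ufst a) \<odot> \<kappa> (usnd a)"
      using interchange[OF functor_hom[OF F f(1)] leg(1)[OF o(2)] functor_hom[OF G f(2)] leg(2)[OF o(4)]]
        is_colimit_comp[OF c f(1)] is_colimit_comp[OF d f(2)] hom_Arr[OF f(1)] hom_Arr[OF f(2)] by simp
  qed (use tensor_hom[OF leg] in \<open>auto simp: category_uprod I' J' tensor_obj c_obj d_obj\<close>)
  have "\<exists>!m. m \<in> hom V (c \<otimes> d) e \<and> (\<forall>a \<in> Obj (uprod I J). m \<cdot> (\<iota> (ufst a) \<odot> \<kappa> (usnd a)) = \<xi> a)"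
    if e: "is_cocone (uprod I J) V (box_functor V I J F G) e \<xi>" for e \<xi>
  proof -
    have e_leg: "\<xi> (upair (i, j)) \<in> hom V (fobj F i \<otimes> fobj G j) e" if "i \<in> Obj I" "j \<in> Obj J" for i j
      using is_cocone_leg[OF e, of "upair (i, j)"] that by simp
    have lc: "is_colimit J V (comp_functor J (tensor_left V (fobj F i)) G) (fobj F i \<otimes> d)
        (\<lambda>j. farr (tensor_left V (fobj F i)) (\<kappa> j))" if "i \<in> Obj I" for i
      by (rule tensor_left_colimit[OF functor_obj[OF F that] J G d])
    have lF: "is_functor J V (comp_functor J (tensor_left V (fobj F i)) G)" if "i \<in> Obj I" for i
      by (rule is_functor_comp[OF J' G is_functor_tensor_left[OF functor_obj[OF F that]]])
    have rc: "is_colimit I V (comp_functor I (tensor_right V d) F) (c \<otimes> d)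
        (\<lambda>i. farr (tensor_right V d) (\<iota> i))"
      by (rule tensor_right_colimit[OF d_obj I F c])
    have rF: "is_functor I V (comp_functor I (tensor_right V d) F)"
      by (rule is_functor_comp[OF I' F is_functor_tensor_right[OF d_obj]])
    have ll: "farr (tensor_left V (fobj F i)) (\<kappa> j) = Ide V (fobj F i) \<odot> \<kappa> j"
      if "j \<in> Obj J" for i j
      using leg(2)[OF that] by simp
    have rl: "farr (tensor_right V d) (\<iota> i) = \<iota> i \<odot> Ide V d" if "i \<in> Obj I" for i
      using leg(1)[OF that] by simp
    \<comment> \<open>The link between the stages: each leg of the double colimit is a first-stage
      leg followed by a second-stage leg.\<close>
    have leg_split: "\<iota> i \<odot> \<kappa> j = (\<iota> i \<odot> Ide V d) \<cdot> (Ide V (fobj F i) \<odot> \<kappa> j)"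
      if i: "i \<in> Obj I" and j: "j \<in> Obj J" for i j
      using interchange[OF ide_hom[OF functor_obj[OF F i]] leg(1)[OF i] leg(2)[OF j] ide_hom[OF d_obj]]
        id_right[OF leg(1)[OF i]] id_left[OF leg(2)[OF j]] by simp
    have lleg: "Ide V (fobj F i) \<odot> \<kappa> j \<in> hom V (fobj F i \<otimes> fobj G j) (fobj F i \<otimes> d)"
      if "i \<in> Obj I" "j \<in> Obj J" for i j
      by (rule tensor_hom[OF ide_hom[OF functor_obj[OF F that(1)]] leg(2)[OF that(2)]])
    have rleg: "\<iota> i \<odot> Ide V d \<in> hom V (fobj F i \<otimes> d) (c \<otimes> d)" if "i \<in> Obj I" for i
      by (rule tensor_hom[OF leg(1)[OF that] ide_hom[OF d_obj]])
    have "\<exists>m. m \<in> hom V (fobj F i \<otimes> d) e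
        \<and> (\<forall>j \<in> Obj J. m \<cdot> (Ide V (fobj F i) \<odot> \<kappa> j) = \<xi> (upair (i, j)))" if i: "i \<in> Obj I" for i
    proof -
      have "is_cocone J V (comp_functor J (tensor_left V (fobj F i)) G) e (\<lambda>j. \<xi> (upair (i, j)))"
      proof (rule is_coconeI)
        fix f j k assume f: "f \<in> hom J j k"
        \<comment> \<open>For fixed \<open>i\<close> the cocone \<open>\<xi>\<close> is restricted
          along the inclusion of \<open>J\<close> at \<open>i\<close>, which sends \<open>f\<close>
          to its pair with the identity of \<open>i\<close>.\<close>
        have "upair (Ide I i, f) \<in> hom (uprod I J) (upair (i, j)) (upair (i, k))"
          using f category_ide[OF I' i] by simp
        from is_cocone_comp[OF e this]
        show "\<xi> (upair (i, k)) \<cdot> farr (comp_functor J (tensor_left V (fobj F i)) G) f = \<xi> (upair (i, j))"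
          using hom_Arr[OF f] hom_Arr[OF category_ide[OF I' i]] functor_ide[OF F i]
            functor_hom[OF G f] by simp
      qed (use J' is_cocone_obj[OF e] e_leg[OF i] functor_obj[OF G] in auto)
      from is_colimit_factor[OF lc[OF i] this] show ?thesis
        by (metis ll)
    qed
    then obtain p where p: "\<And>i. i \<in> Obj I \<Longrightarrow> p i \<in> hom V (fobj F i \<otimes> d) e"
      and p_leg: "\<And>i j. i \<in> Obj I \<Longrightarrow> j \<in> Obj J \<Longrightarrow>
        p i \<cdot> (Ide V (fobj F i) \<odot> \<kappa> j) = \<xi> (upair (i, j))"
      by metis
    have "is_cocone I V (comp_functor I (tensor_right V d) F) e p"
    proof (rule is_coconeI)
      fix f i k assume f: "f \<in> hom I i k"
      note i = category_hom_obj(1)[OF I' f] and k = category_hom_obj(2)[OF I' f]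
      note Ff = functor_hom[OF F f]
      have Ffd: "farr F f \<odot> Ide V d \<in> hom V (fobj F i \<otimes> d) (fobj F k \<otimes> d)"
        by (rule tensor_hom[OF Ff ide_hom[OF d_obj]])
      \<comment> \<open>Compatibility of the first-stage maps in \<open>i\<close>, tested on the
        legs of \<open>fobj F i \<otimes> d\<close>.\<close>
      have "p k \<cdot> (farr F f \<odot> Ide V d) = p i"
      proof (rule is_colimit_ext[OF category_V J' lF[OF i] lc[OF i] comp_hom[OF Ffd p[OF k]] p[OF i]])
        fix j assume j: "j \<in> Obj J"
        note Gj = ide_hom[OF functor_obj[OF G j]]
        have fj: "upair (f, Ide J j) \<in> hom (uprod I J) (upair (i, j)) (upair (k, j))"
          using f category_ide[OF J' j] by simp
        have "(p k \<cdot> (farr F f \<odot> Ide V d)) \<cdot> (Ide V (fobj F i) \<odot> \<kappa> j)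
            = p k \<cdot> (farr F f \<odot> \<kappa> j)"
          using comp_assoc[OF lleg[OF i j] Ffd p[OF k]]
            interchange[OF ide_hom[OF functor_obj[OF F i]] Ff leg(2)[OF j] ide_hom[OF d_obj]]
            id_right[OF Ff] id_left[OF leg(2)[OF j]] by simp
        \<comment> \<open>The tensor \<open>farr F f \<odot> \<kappa> j\<close> is split the other
          way round, so that \<open>p k\<close> meets a leg of its own source.\<close>
        also have "\<dots> = (p k \<cdot> (Ide V (fobj F k) \<odot> \<kappa> j)) \<cdot> (farr F f \<odot> Ide V (fobj G j))"
          using comp_assoc[OF tensor_hom[OF Ff Gj] lleg[OF k j] p[OF k]]
            interchange[OF Ff ide_hom[OF functor_obj[OF F k]] Gj leg(2)[OF j]]
            id_left[OF Ff] id_right[OF leg(2)[OF j]] by simp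
        \<comment> \<open>The cocone condition of \<open>\<xi>\<close> at the arrow
          \<open>fj\<close>, which moves only the first coordinate.\<close>
        also have "\<dots> = \<xi> (upair (i, j))"
          using is_cocone_comp[OF e fj] hom_Arr[OF f] hom_Arr[OF category_ide[OF J' j]]
          by (simp add: p_leg[OF k j] functor_ide[OF G j])
        finally show "(p k \<cdot> (farr F f \<odot> Ide V d)) \<cdot> farr (tensor_left V (fobj F i)) (\<kappa> j)
            = p i \<cdot> farr (tensor_left V (fobj F i)) (\<kappa> j)"
          by (simp only: ll[OF j] p_leg[OF i j])
      qed
      then show "p k \<cdot> farr (comp_functor I (tensor_right V d) F) f = p i"
        using hom_Arr[OF f] Ff by simp
    qed (use I' is_cocone_obj[OF e] p functor_obj[OF F] in auto)
    then obtain m where m: "m \<in> hom V (c \<otimes> d) e"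
      and m_leg: "\<And>i. i \<in> Obj I \<Longrightarrow> m \<cdot> farr (tensor_right V d) (\<iota> i) = p i"
      by (rule is_colimit_factor[OF rc]) blast
    show ?thesis
    proof (rule ex1I[of _ m], intro conjI ballI)
      fix a assume a: "a \<in> Obj (uprod I J)"
      then have ij: "ufst a \<in> Obj I" "usnd a \<in> Obj J"
        by simp_all
      show "m \<cdot> (\<iota> (ufst a) \<odot> \<kappa> (usnd a)) = \<xi> a"
        using comp_assoc[OF lleg[OF ij] rleg[OF ij(1)] m] m_leg[OF ij(1)] p_leg[OF ij]
        by (simp add: leg_split[OF ij] rl[OF ij(1)])
    next
      fix n assume n: "n \<in> hom V (c \<otimes> d) e
        \<and> (\<forall>a \<in> Obj (uprod I J). n \<cdot> (\<iota> (ufst a) \<odot> \<kappa> (usnd a)) = \<xi> a)"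
      then have n': "n \<in> hom V (c \<otimes> d) e"
        by blast
      show "n = m"
      proof (rule is_colimit_ext[OF category_V I' rF rc n' m])
        fix i assume i: "i \<in> Obj I"
        \<comment> \<open>A competing map \<open>n\<close> induces the same first-stage maps by
          uniqueness over \<open>J\<close>; uniqueness over \<open>I\<close> then identifies it with
          \<open>m\<close>.\<close>
        have "n \<cdot> (\<iota> i \<odot> Ide V d) = p i"
        proof (rule is_colimit_ext[OF category_V J' lF[OF i] lc[OF i] comp_hom[OF rleg[OF i] n'] p[OF i]])
          fix j assume j: "j \<in> Obj J"
          have "n \<cdot> (\<iota> i \<odot> \<kappa> j) = \<xi> (upair (i, j))"
            using n i j by (auto dest: bspec[where x = "upair (i, j)"])
          then show "(n \<cdot> (\<iota> i \<odot> Ide V d)) \<cdot> farr (tensor_left V (fobj F i)) (\<kappa> j)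
              = p i \<cdot> farr (tensor_left V (fobj F i)) (\<kappa> j)"
            using comp_assoc[OF lleg[OF i j] rleg[OF i] n']
            by (simp only: ll[OF j] p_leg[OF i j] leg_split[OF i j])
        qed
        then show "n \<cdot> farr (tensor_right V d) (\<iota> i) = m \<cdot> farr (tensor_right V d) (\<iota> i)"
          using m_leg[OF i] by (simp only: rl[OF i])
      qed
    qed (rule m)
  qed
  with cocone show ?thesis
    by (simp add: is_colimit_def)
qed

text \<open>The legs of a colimit are jointly epic. Both colimits are arbitrary, so a vertex such as
  \<open>K X \<otimes> K Y\<close> or \<open>\<one>\<close> may be inserted where no chosen colimit
  stands.\<close>

lemma tensor_colimit_ext:
  fixes I J :: "('u, 'u) cat"
  assumes I: "small_category I" and J: "small_category J"
    and F: "is_functor I V F" and G: "is_functor J V G"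
    and c: "is_colimit I V F c \<iota>" and d: "is_colimit J V G d \<kappa>"
    and m: "m \<in> hom V (c \<otimes> d) e" and n: "n \<in> hom V (c \<otimes> d) e"
    and eq: "\<And>i j. i \<in> Obj I \<Longrightarrow> j \<in> Obj J \<Longrightarrow> m \<cdot> (\<iota> i \<odot> \<kappa> j) = n \<cdot> (\<iota> i \<odot> \<kappa> j)"
  shows "m = n"
  using eq I J F G
  by (intro is_colimit_ext[OF category_V _ _ tensor_colimit[OF I J F G c d] m n])
    (simp_all add: category_uprod is_functor_box small_category_category)

text \<open>A cocone over the terminal category amounts to its one leg, so the identity leg is
  universal. This gives invertibility of \<open>\<eta>\<close> and lets \<open>\<one>\<close> enter
  the unit laws as a colimit.\<close>

lemma unit_colimit:
  "is_colimit (uterm :: ('u, 'u) cat) V (unit_functor V) \<one> (\<lambda>_. Ide V \<one>)"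
  unfolding is_colimit_def
proof (intro conjI allI impI)
  note u = ide_hom[OF unit_obj]
  show "is_cocone (uterm :: ('u, 'u) cat) V (unit_functor V) \<one> (\<lambda>_. Ide V \<one>)"
    using small_category_category[OF small_category_uterm] unit_obj u id_left[OF u]
    by (intro is_coconeI) auto
  fix d and \<kappa> :: "'u \<Rightarrow> 'm" assume d: "is_cocone uterm V (unit_functor V) d \<kappa>"
  have "\<kappa> ustar \<in> hom V \<one> d"
    using is_cocone_leg[OF d, of ustar] by simp
  then show "\<exists>!m. m \<in> hom V \<one> d \<and> (\<forall>i \<in> Obj uterm. m \<cdot> Ide V \<one> = \<kappa> i)"
    by (intro ex1I[of _ "\<kappa> ustar"]) (auto simp: id_right)
qed

end

section \<open>The colimit functor\<close>

locale chosen_colimits = cocontinuous_monoidal_cat V universe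
  for V :: "('o, 'm, 'z) moncat_scheme" (structure) and universe :: "'u::infinite itself" +
  fixes K :: "('u, 'o, 'm) diagram \<Rightarrow> 'o" and \<iota> :: "('u, 'o, 'm) diagram \<Rightarrow> 'u \<Rightarrow> 'm"
  assumes choice: "colimit_choice V K \<iota>"
begin

abbreviation colim :: "('u, 'o, 'm) garr \<Rightarrow> 'm" where
  "colim \<equiv> farr (colim_functor V K \<iota>)"

text \<open>The choice \<open>K\<close>, \<open>\<iota>\<close> is indexed by whole diagrams, so the
  facts from here on use \<open>fst\<close> and \<open>snd\<close> rather than splitting each
  diagram into a pair.\<close>

lemma diagramD:
  assumes "X \<in> groth_obj V"
  shows "small_category (fst X)" "category (fst X)" "is_functor (fst X) V (snd X)"
    and "is_colimit (fst X) V (snd X) (K X) (\<iota> X)"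
  using assms choice by (cases X; auto simp: colimit_choice_def small_category_category)+

lemma leg_hom: "X \<in> groth_obj V \<Longrightarrow> i \<in> Obj (fst X) \<Longrightarrow> \<iota> X i \<in> hom V (fobj (snd X) i) (K X)"
  by (rule is_colimit_leg[OF diagramD(4)])

lemma K_obj: "X \<in> groth_obj V \<Longrightarrow> K X \<in> Obj V"
  by (rule is_colimit_obj[OF diagramD(4)])

lemma garrD:
  fixes t :: "('u, 'o, 'm) garr"
  assumes "t \<in> hom (groth V) X Y"
  shows "gdom t = X" "gcod t = Y" "X \<in> groth_obj V" "Y \<in> groth_obj V"
    and "is_functor (fst X) (fst Y) (gfun t)"
    and "\<And>i. i \<in> Obj (fst X) \<Longrightarrow> gtrans t i \<in> hom V (fobj (snd X) i) (fobj (snd Y) (fobj (gfun t) i))"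
    and "\<And>f i j. f \<in> hom (fst X) i j \<Longrightarrow>
      gtrans t j \<cdot> farr (snd X) f = farr (snd Y) (farr (gfun t) f) \<cdot> gtrans t i"
proof -
  have t: "t \<in> hom (groth V) (fst X, snd X) (fst Y, snd Y)"
    using assms by simp
  note D = groth_homD[OF t]
  show "is_functor (fst X) (fst Y) (gfun t)"
    by (rule D(7))
  show "gtrans t i \<in> hom V (fobj (snd X) i) (fobj (snd Y) (fobj (gfun t) i))" if "i \<in> Obj (fst X)" for i
    using D(9) that by blast
  show "gtrans t j \<cdot> farr (snd X) f = farr (snd Y) (farr (gfun t) f) \<cdot> gtrans t i"
    if "f \<in> hom (fst X) i j" for f i j
    using D(10)[OF that] .
qed (use assms category_hom_obj[OF category_groth assms] in \<open>simp_all add: hom_groth_iff\<close>)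

lemma diagram_ext:
  assumes X: "X \<in> groth_obj V" and "m \<in> hom V (K X) d" "n \<in> hom V (K X) d"
    and "\<And>i. i \<in> Obj (fst X) \<Longrightarrow> m \<cdot> \<iota> X i = n \<cdot> \<iota> X i"
  shows "m = n"
  using is_colimit_ext[OF category_V diagramD(2)[OF X] diagramD(3)[OF X] diagramD(4)[OF X] assms(2,3)]
    assms(4) by blast

text \<open>The legs of \<open>Y\<close>, reindexed along the functor of \<open>t\<close> and
  precomposed with its transformation, form a cocone under \<open>X\<close>. Its unique
  factorization gives the definite description in \<open>colim_functor\<close> its meaning.\<close>

lemma colim_arr:
  assumes t: "t \<in> hom (groth V) X Y"
  shows "colim t \<in> hom V (K X) (K Y)"
    and "\<And>i. i \<in> Obj (fst X) \<Longrightarrow> colim t \<cdot> \<iota> X i = \<iota> Y (fobj (gfun t) i) \<cdot> gtrans t i"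
proof -
  note D = garrD[OF t] and X = diagramD[OF garrD(3)[OF t]] and Y = diagramD[OF garrD(4)[OF t]]
  let ?P = "\<lambda>m. m \<in> hom V (K X) (K Y) \<and>
    (\<forall>i \<in> Obj (fst X). m \<cdot> \<iota> X i = \<iota> Y (fobj (gfun t) i) \<cdot> gtrans t i)"
  have "is_cocone (fst X) V (snd X) (K Y) (\<lambda>i. \<iota> Y (fobj (gfun t) i) \<cdot> gtrans t i)"
  proof (rule is_coconeI)
    fix f i j assume f: "f \<in> hom (fst X) i j"
    note i = category_hom_obj(1)[OF X(2) f] and j = category_hom_obj(2)[OF X(2) f]
    note leg = leg_hom[OF D(4) functor_obj[OF D(5)]]
    note Hf = functor_hom[OF D(5) f]
    have "(\<iota> Y (fobj (gfun t) j) \<cdot> gtrans t j) \<cdot> farr (snd X) f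
        = \<iota> Y (fobj (gfun t) j) \<cdot> (farr (snd Y) (farr (gfun t) f) \<cdot> gtrans t i)"
      by (simp add: comp_assoc[OF functor_hom[OF X(3) f] D(6)[OF j] leg[OF j]] D(7)[OF f])
    \<comment> \<open>After naturality of \<open>t\<close>, the cocone condition of \<open>Y\<close>
      at the reindexed arrow removes the action of \<open>f\<close>.\<close>
    also have "\<dots> = \<iota> Y (fobj (gfun t) i) \<cdot> gtrans t i"
      by (simp add: comp_assoc[OF D(6)[OF i] functor_hom[OF Y(3) Hf] leg[OF j], symmetric]
          is_colimit_comp[OF Y(4) Hf])
    finally show "(\<iota> Y (fobj (gfun t) j) \<cdot> gtrans t j) \<cdot> farr (snd X) f
        = \<iota> Y (fobj (gfun t) i) \<cdot> gtrans t i" .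
  qed (use X(2) K_obj[OF D(4)] comp_hom[OF D(6) leg_hom[OF D(4) functor_obj[OF D(5)]]] in auto)
  then have "\<exists>!m. ?P m"
    using X(4) unfolding is_colimit_def by blast
  then have "?P (THE m. ?P m)"
    by (rule theI')
  moreover have "colim t = (THE m. ?P m)"
    using t D by (simp add: colim_functor_def hom_groth_iff)
  ultimately show "colim t \<in> hom V (K X) (K Y)"
    "\<And>i. i \<in> Obj (fst X) \<Longrightarrow> colim t \<cdot> \<iota> X i = \<iota> Y (fobj (gfun t) i) \<cdot> gtrans t i"
    by simp_all
qed

lemma fobj_colim [simp]: "X \<in> groth_obj V \<Longrightarrow> fobj (colim_functor V K \<iota>) X = K X"
  by (simp add: colim_functor_def)

text \<open>Identities and composites are compared on the legs of the source colimit, where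
  \<open>colim_arr\<close> reduces them to the formulas for \<open>groth_id\<close> and for
  composition in \<open>groth V\<close>.\<close>

lemma is_functor_colim: "is_functor (groth V) V (colim_functor V K \<iota>)"
proof (rule is_functorI)
  show "fobj (colim_functor V K \<iota>) \<in> extensional (Obj (groth V))"
    "farr (colim_functor V K \<iota>) \<in> extensional (Arr (groth V))"
    by (simp_all add: colim_functor_def)
  show "fobj (colim_functor V K \<iota>) X \<in> Obj V" if "X \<in> Obj (groth V)" for X
    using that by (simp add: K_obj)
next
  fix X :: "('u, 'o, 'm) diagram" assume "X \<in> Obj (groth V)"
  then have X: "X \<in> groth_obj V"
    by simp
  note c = colim_arr[OF groth_id_hom[OF X]]
  have "colim (groth_id V X) = Ide V (K X)"
  proof (rule diagram_ext[OF X c(1) ide_hom[OF K_obj[OF X]]])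
    fix i assume i: "i \<in> Obj (fst X)"
    show "colim (groth_id V X) \<cdot> \<iota> X i = Ide V (K X) \<cdot> \<iota> X i"
      using c(2)[OF i] id_left[OF leg_hom[OF X i]] id_right[OF leg_hom[OF X i]] i by simp
  qed
  then show "colim (Ide (groth V) X) = Ide V (fobj (colim_functor V K \<iota>) X)"
    using X by simp
next
  fix s t :: "('u, 'o, 'm) garr" and X Y Z :: "('u, 'o, 'm) diagram"
  assume s: "s \<in> hom (groth V) X Y"
  note S = garrD[OF s] and cs = colim_arr[OF s]
  show "colim s \<in> hom V (fobj (colim_functor V K \<iota>) X) (fobj (colim_functor V K \<iota>) Y)"
    using cs(1) S(3,4) by simp
  assume t: "t \<in> hom (groth V) Y Z"
  note T = garrD[OF t] and ct = colim_arr[OF t] and ts = groth_comp_hom[OF s t]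
  note A = groth_comp_apply[of s V "fst X" "snd X", unfolded prod.collapse, OF s t]
  show "colim (t \<cdot>\<^bsub>groth V\<^esub> s) = colim t \<cdot> colim s"
  proof (rule diagram_ext[OF S(3) colim_arr(1)[OF ts] comp_hom[OF cs(1) ct(1)]])
    fix i assume i: "i \<in> Obj (fst X)"
    note j = functor_obj[OF S(5) i]
    note leg = leg_hom[OF S(3) i] leg_hom[OF T(3) j] leg_hom[OF T(4) functor_obj[OF T(5) j]]
    have "(colim t \<cdot> colim s) \<cdot> \<iota> X i = colim t \<cdot> (\<iota> Y (fobj (gfun s) i) \<cdot> gtrans s i)"
      by (simp add: comp_assoc[OF leg(1) cs(1) ct(1)] cs(2)[OF i])
    also have "\<dots> = (\<iota> Z (fobj (gfun t) (fobj (gfun s) i)) \<cdot> gtrans t (fobj (gfun s) i)) \<cdot> gtrans s i"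
      by (simp add: comp_assoc[OF S(6)[OF i] leg(2) ct(1), symmetric] ct(2)[OF j])
    also have "\<dots> = colim (t \<cdot>\<^bsub>groth V\<^esub> s) \<cdot> \<iota> X i"
      using colim_arr(2)[OF ts i] comp_assoc[OF S(6)[OF i] T(6)[OF j] leg(3)] i by (simp add: A)
    finally show "colim (t \<cdot>\<^bsub>groth V\<^esub> s) \<cdot> \<iota> X i = (colim t \<cdot> colim s) \<cdot> \<iota> X i" ..
  qed
qed


section \<open>The coherence maps\<close>

lemma fst_diag_tensor [simp]: "fst (diag_tensor V X Y) = uprod (fst X) (fst Y)"
  by (cases X; cases Y) simp

lemma fobj_diag_tensor [simp]:
  "i \<in> Obj (fst X) \<Longrightarrow> j \<in> Obj (fst Y) \<Longrightarrow>
     fobj (snd (diag_tensor V X Y)) (upair (i, j)) = fobj (snd X) i \<otimes> fobj (snd Y) j"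
  by (cases X; cases Y) simp

text \<open>The description picks out a unique arrow because the tensored legs on the source are
  colimiting, by \<open>diag_tensor_colimit\<close> below.\<close>

definition \<mu> :: "('u, 'o, 'm) diagram \<Rightarrow> ('u, 'o, 'm) diagram \<Rightarrow> 'm" where
  "\<mu> X Y = (THE m. m \<in> hom V (K X \<otimes> K Y) (K (diag_tensor V X Y)) \<and>
     (\<forall>a \<in> Obj (fst (diag_tensor V X Y)).
        m \<cdot> (\<iota> X (ufst a) \<odot> \<iota> Y (usnd a)) = \<iota> (diag_tensor V X Y) a))"

text \<open>The comparison from the colimit \<open>\<one>\<close> of the unit diagram to the chosen
  one: as the leg of the former is an identity, the comparison is the leg of the latter
  itself.\<close>

definition \<eta> :: 'm where
  "\<eta> = \<iota> (diag_unit V) ustar"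

lemma diag_tensor_colimit:
  assumes X: "X \<in> groth_obj V" and Y: "Y \<in> groth_obj V"
  shows "is_colimit (fst (diag_tensor V X Y)) V (snd (diag_tensor V X Y)) (K X \<otimes> K Y)
    (\<lambda>a. \<iota> X (ufst a) \<odot> \<iota> Y (usnd a))"
proof -
  have "snd (diag_tensor V X Y) = box_functor V (fst X) (fst Y) (snd X) (snd Y)"
    by (cases X; cases Y) simp
  then show ?thesis
    using tensor_colimit[OF diagramD(1)[OF X] diagramD(1)[OF Y] diagramD(3)[OF X] diagramD(3)[OF Y]
        diagramD(4)[OF X] diagramD(4)[OF Y]] by simp
qed

lemma \<mu>:
  assumes X: "X \<in> groth_obj V" and Y: "Y \<in> groth_obj V"
  shows \<mu>_hom: "\<mu> X Y \<in> hom V (K X \<otimes> K Y) (K (diag_tensor V X Y))"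
    and \<mu>_leg: "\<And>i j. i \<in> Obj (fst X) \<Longrightarrow> j \<in> Obj (fst Y) \<Longrightarrow>
      \<mu> X Y \<cdot> (\<iota> X i \<odot> \<iota> Y j) = \<iota> (diag_tensor V X Y) (upair (i, j))"
    and \<mu>_iso: "is_iso V (\<mu> X Y)"
proof -
  note XY = diagramD[OF diag_tensor_obj[OF X Y]]
  let ?P = "\<lambda>m. m \<in> hom V (K X \<otimes> K Y) (K (diag_tensor V X Y)) \<and>
     (\<forall>a \<in> Obj (fst (diag_tensor V X Y)).
        m \<cdot> (\<iota> X (ufst a) \<odot> \<iota> Y (usnd a)) = \<iota> (diag_tensor V X Y) a)"
  have "\<exists>!m. ?P m"
    using diag_tensor_colimit[OF X Y] is_colimit_cocone[OF XY(4)] unfolding is_colimit_def by blast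
  then have P: "?P (\<mu> X Y)"
    unfolding \<mu>_def by (rule theI')
  then show "\<mu> X Y \<in> hom V (K X \<otimes> K Y) (K (diag_tensor V X Y))" ..
  then show "is_iso V (\<mu> X Y)"
    using P by (intro is_colimit_comparison_iso[OF category_V XY(2,3) diag_tensor_colimit[OF X Y] XY(4)]) auto
  show "\<mu> X Y \<cdot> (\<iota> X i \<odot> \<iota> Y j) = \<iota> (diag_tensor V X Y) (upair (i, j))"
    if "i \<in> Obj (fst X)" "j \<in> Obj (fst Y)" for i j
    using P that by (auto dest: bspec[where x = "upair (i, j)"])
qed

lemma \<eta>_hom: "\<eta> \<in> hom V \<one> (K (diag_unit V))"
  using leg_hom[OF diag_unit_obj, of ustar] by (simp add: \<eta>_def diag_unit_eq)

lemma \<eta>_iso: "is_iso V \<eta>"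
proof -
  have "is_colimit uterm V (unit_functor V) (K (diag_unit V)) (\<iota> (diag_unit V))"
    using diagramD(4)[OF diag_unit_obj] by (simp add: diag_unit_eq)
  moreover have "category (uterm :: ('u, 'u) cat)" "is_functor (uterm :: ('u, 'u) cat) V (unit_functor V)"
    using diagramD(2,3)[OF diag_unit_obj] by (simp_all add: diag_unit_eq)
  ultimately show ?thesis
    using unit_colimit \<eta>_hom id_right[OF \<eta>_hom]
    by (intro is_colimit_comparison_iso[OF category_V _ _ unit_colimit]) (auto simp: \<eta>_def)
qed

text \<open>On the legs at \<open>i\<close> and \<open>j\<close> both sides become the tensor of the
  two transformation components, followed by the leg of the target diagram at the pair of reindexed
  objects.\<close>

lemma \<mu>_natural:
  assumes s: "s \<in> hom (groth V) X X'" and t: "t \<in> hom (groth V) Y Y'"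
  shows "\<mu> X' Y' \<cdot> (colim s \<odot> colim t) = colim (garr_tensor V s t) \<cdot> \<mu> X Y"
proof -
  note S = garrD[OF s] and T = garrD[OF t] and cs = colim_arr[OF s] and ct = colim_arr[OF t]
  note st = colim_arr[OF garr_tensor_hom[OF s t]]
  note m = \<mu>_hom[OF S(3) T(3)] and m' = \<mu>_hom[OF S(4) T(4)]
  note X = diagramD[OF S(3)] and Y = diagramD[OF T(3)]
  note csct = tensor_hom[OF cs(1) ct(1)]
  show ?thesis
  proof (rule tensor_colimit_ext[OF X(1) Y(1) X(3) Y(3) X(4) Y(4) comp_hom[OF csct m'] comp_hom[OF m st(1)]])
    fix i j assume i: "i \<in> Obj (fst X)" and j: "j \<in> Obj (fst Y)"
    note i' = functor_obj[OF S(5) i] and j' = functor_obj[OF T(5) j]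
    note li = leg_hom[OF S(3) i] and lj = leg_hom[OF T(3) j]
    note li' = leg_hom[OF S(4) i'] and lj' = leg_hom[OF T(4) j']
    let ?i' = "fobj (gfun s) i" and ?j' = "fobj (gfun t) j"
    have ij: "upair (i, j) \<in> Obj (fst (diag_tensor V X Y))"
      using i j by simp
    have "(\<mu> X' Y' \<cdot> (colim s \<odot> colim t)) \<cdot> (\<iota> X i \<odot> \<iota> Y j)
        = \<mu> X' Y' \<cdot> ((\<iota> X' ?i' \<cdot> gtrans s i) \<odot> (\<iota> Y' ?j' \<cdot> gtrans t j))"
      by (simp add: comp_assoc[OF tensor_hom[OF li lj] csct m'] interchange[OF li cs(1) lj ct(1)]
          cs(2)[OF i] ct(2)[OF j])
    also have "\<dots> = \<mu> X' Y' \<cdot> (\<iota> X' ?i' \<odot> \<iota> Y' ?j') \<cdot> (gtrans s i \<odot> gtrans t j)"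
      by (simp add: interchange[OF S(6)[OF i] li' T(6)[OF j] lj'])
    also have "\<dots> = \<iota> (diag_tensor V X' Y') (upair (?i', ?j')) \<cdot> (gtrans s i \<odot> gtrans t j)"
      by (simp add: comp_assoc[OF tensor_hom[OF S(6)[OF i] T(6)[OF j]] tensor_hom[OF li' lj'] m', symmetric]
          \<mu>_leg[OF S(4) T(4) i' j'])
    also have "\<dots> = colim (garr_tensor V s t) \<cdot> \<iota> (diag_tensor V X Y) (upair (i, j))"
      using st(2)[OF ij] i j by (simp add: S(1) T(1))
    also have "\<dots> = (colim (garr_tensor V s t) \<cdot> \<mu> X Y) \<cdot> (\<iota> X i \<odot> \<iota> Y j)"
      by (simp add: comp_assoc[OF tensor_hom[OF li lj] m st(1)] \<mu>_leg[OF S(3) T(3) i j])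
    finally show "(\<mu> X' Y' \<cdot> (colim s \<odot> colim t)) \<cdot> (\<iota> X i \<odot> \<iota> Y j)
        = (colim (garr_tensor V s t) \<cdot> \<mu> X Y) \<cdot> (\<iota> X i \<odot> \<iota> Y j)" .
  qed
qed

text \<open>The source is treated as a tensor of two colimits, namely
  \<open>K X \<otimes> K Y\<close> over the product index category and \<open>K Z\<close>. On legs
  both sides give the associator at the three values, followed by the leg at the right-bracketed
  index.\<close>

lemma \<mu>_assoc:
  assumes X: "X \<in> groth_obj V" and Y: "Y \<in> groth_obj V" and Z: "Z \<in> groth_obj V"
  shows "colim (groth_assoc V X Y Z) \<cdot> \<mu> (diag_tensor V X Y) Z \<cdot> (\<mu> X Y \<odot> Ide V (K Z))
    = \<mu> X (diag_tensor V Y Z) \<cdot> (Ide V (K X) \<odot> \<mu> Y Z) \<cdot> Assoc V (K X) (K Y) (K Z)"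
proof -
  note XY = diag_tensor_obj[OF X Y] and YZ = diag_tensor_obj[OF Y Z]
  note a = colim_arr[OF groth_assoc_hom[OF X Y Z]]
  note kX = K_obj[OF X] and kY = K_obj[OF Y] and kZ = K_obj[OF Z]
  note mXY = \<mu>_hom[OF X Y] and mYZ = \<mu>_hom[OF Y Z] and mXY_Z = \<mu>_hom[OF XY Z] and mX_YZ = \<mu>_hom[OF X YZ]
  note m1 = tensor_hom[OF mXY ide_hom[OF kZ]] and m2 = tensor_hom[OF ide_hom[OF kX] mYZ]
  note A = Assoc_hom[OF kX kY kZ]
  note DXY = diagramD[OF XY] and DZ = diagramD[OF Z]
  show ?thesis
  \<comment> \<open>The first factor is the Fubini colimit of \<open>diag_tensor V X Y\<close>, not
    its chosen colimit, so its legs are already tensors of the legs of \<open>X\<close> and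
    \<open>Y\<close>.\<close>
  proof (rule tensor_colimit_ext[OF DXY(1) DZ(1) DXY(3) DZ(3) diag_tensor_colimit[OF X Y] DZ(4)
        comp_hom[OF comp_hom[OF m1 mXY_Z] a(1)] comp_hom[OF comp_hom[OF A m2] mX_YZ]])
    fix p k assume p: "p \<in> Obj (fst (diag_tensor V X Y))" and k: "k \<in> Obj (fst Z)"
    obtain i j where p_eq: "p = upair (i, j)"
      by (metis upair_ufst_usnd)
    have i: "i \<in> Obj (fst X)" and j: "j \<in> Obj (fst Y)"
      using p by (simp_all add: p_eq)
    have pk: "upair (p, k) \<in> Obj (fst (diag_tensor V (diag_tensor V X Y) Z))"
      and jk: "upair (j, k) \<in> Obj (fst (diag_tensor V Y Z))"
      using i j k p by simp_all
    note li = leg_hom[OF X i] and lj = leg_hom[OF Y j] and lk = leg_hom[OF Z k]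
    note lij = tensor_hom[OF li lj] and ljk = tensor_hom[OF lj lk]
    note l1 = tensor_hom[OF lij lk] and l2 = tensor_hom[OF li ljk]
    let ?l = "(\<iota> X i \<odot> \<iota> Y j) \<odot> \<iota> Z k"
    let ?A = "Assoc V (fobj (snd X) i) (fobj (snd Y) j) (fobj (snd Z) k)"
    have A': "?A \<in> hom V ((fobj (snd X) i \<otimes> fobj (snd Y) j) \<otimes> fobj (snd Z) k)
        (fobj (snd X) i \<otimes> (fobj (snd Y) j \<otimes> fobj (snd Z) k))"
      using hom_obj(1)[OF li] hom_obj(1)[OF lj] hom_obj(1)[OF lk] by (rule Assoc_hom)
    have "(colim (groth_assoc V X Y Z) \<cdot> \<mu> (diag_tensor V X Y) Z \<cdot> (\<mu> X Y \<odot> Ide V (K Z))) \<cdot> ?l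
        = colim (groth_assoc V X Y Z) \<cdot> \<mu> (diag_tensor V X Y) Z \<cdot> (\<mu> X Y \<odot> Ide V (K Z)) \<cdot> ?l"
      by (simp add: comp_assoc[OF l1 comp_hom[OF m1 mXY_Z] a(1)] comp_assoc[OF l1 m1 mXY_Z])
    also have "\<dots> = colim (groth_assoc V X Y Z) \<cdot> \<mu> (diag_tensor V X Y) Z \<cdot> (\<iota> (diag_tensor V X Y) p \<odot> \<iota> Z k)"
      by (simp add: interchange[OF lij mXY lk ide_hom[OF kZ]] \<mu>_leg[OF X Y i j] id_left[OF lk] p_eq)
    also have "\<dots> = colim (groth_assoc V X Y Z) \<cdot> \<iota> (diag_tensor V (diag_tensor V X Y) Z) (upair (p, k))"
      by (simp add: \<mu>_leg[OF XY Z p k])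
    \<comment> \<open>The turning point: the colimit of the associator rebrackets the index and
      emits the associator of \<open>V\<close>. From here the legs are expanded again through the
      other pair of comparison maps.\<close>
    also have "\<dots> = \<iota> (diag_tensor V X (diag_tensor V Y Z)) (upair (i, upair (j, k))) \<cdot> ?A"
      using a(2)[OF pk] i j k by (simp add: p_eq)
    also have "\<dots> = (\<mu> X (diag_tensor V Y Z) \<cdot> (\<iota> X i \<odot> \<iota> (diag_tensor V Y Z) (upair (j, k)))) \<cdot> ?A"
      by (simp add: \<mu>_leg[OF X YZ i jk])
    also have "\<dots> = (\<mu> X (diag_tensor V Y Z) \<cdot> (Ide V (K X) \<odot> \<mu> Y Z) \<cdot> (\<iota> X i \<odot> (\<iota> Y j \<odot> \<iota> Z k))) \<cdot> ?A"
      by (simp add: interchange[OF li ide_hom[OF kX] ljk mYZ] \<mu>_leg[OF Y Z j k] id_left[OF li])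
    also have "\<dots> = \<mu> X (diag_tensor V Y Z) \<cdot> (Ide V (K X) \<odot> \<mu> Y Z) \<cdot> (\<iota> X i \<odot> (\<iota> Y j \<odot> \<iota> Z k)) \<cdot> ?A"
      by (simp add: comp_assoc[OF A' comp_hom[OF l2 m2] mX_YZ] comp_assoc[OF A' l2 m2])
    \<comment> \<open>Naturality carries the associator from the values of the diagrams to their
      colimits.\<close>
    also have "\<dots> = \<mu> X (diag_tensor V Y Z) \<cdot> (Ide V (K X) \<odot> \<mu> Y Z) \<cdot> Assoc V (K X) (K Y) (K Z) \<cdot> ?l"
      by (simp add: Assoc_natural[OF li lj lk])
    also have "\<dots> = (\<mu> X (diag_tensor V Y Z) \<cdot> (Ide V (K X) \<odot> \<mu> Y Z) \<cdot> Assoc V (K X) (K Y) (K Z)) \<cdot> ?l"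
      by (simp add: comp_assoc[OF l1 comp_hom[OF A m2] mX_YZ] comp_assoc[OF l1 A m2])
    finally show "(colim (groth_assoc V X Y Z) \<cdot> \<mu> (diag_tensor V X Y) Z \<cdot> (\<mu> X Y \<odot> Ide V (K Z)))
          \<cdot> ((\<iota> X (ufst p) \<odot> \<iota> Y (usnd p)) \<odot> \<iota> Z k)
        = (\<mu> X (diag_tensor V Y Z) \<cdot> (Ide V (K X) \<odot> \<mu> Y Z) \<cdot> Assoc V (K X) (K Y) (K Z))
          \<cdot> ((\<iota> X (ufst p) \<odot> \<iota> Y (usnd p)) \<odot> \<iota> Z k)"
      by (simp add: p_eq)
  qed
qed

text \<open>With \<open>\<one>\<close> presented by \<open>unit_colimit\<close>, the legs to test
  are \<open>Ide V \<one> \<odot> \<iota> X i\<close>, and the claim becomes naturality of the left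
  unitor at \<open>\<iota> X i\<close>.\<close>

lemma \<mu>_left_unit:
  assumes X: "X \<in> groth_obj V"
  shows "colim (groth_lunit V X) \<cdot> \<mu> (diag_unit V) X \<cdot> (\<eta> \<odot> Ide V (K X)) = LUnit V (K X)"
proof -
  have U: "(diag_unit V :: ('u, 'o, 'm) diagram) \<in> groth_obj V"
    by (rule diag_unit_obj)
  have DU: "small_category (uterm :: ('u, 'u) cat)" "is_functor (uterm :: ('u, 'u) cat) V (unit_functor V)"
    using diagramD(1,3)[OF U] by (simp_all add: diag_unit_eq)
  have u: "ustar \<in> Obj (fst (diag_unit V :: ('u, 'o, 'm) diagram))"
    by (simp add: diag_unit_eq)
  note D = diagramD[OF X] and a = colim_arr[OF groth_lunit_hom[OF X]]
  note kX = ide_hom[OF K_obj[OF X]] and i1 = ide_hom[OF unit_obj] and m = \<mu>_hom[OF U X]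
  note \<eta>K = tensor_hom[OF \<eta>_hom kX]
  show ?thesis
  proof (rule tensor_colimit_ext[OF DU(1) D(1) DU(2) D(3) unit_colimit D(4)
        comp_hom[OF comp_hom[OF \<eta>K m] a(1)] LUnit_hom[OF K_obj[OF X]]])
    fix j i assume i: "i \<in> Obj (fst X)"
    note li = leg_hom[OF X i]
    note l = tensor_hom[OF i1 li]
    have ui: "upair (ustar, i) \<in> Obj (fst (diag_tensor V (diag_unit V) X))"
      using u i by simp
    have "(colim (groth_lunit V X) \<cdot> \<mu> (diag_unit V) X \<cdot> (\<eta> \<odot> Ide V (K X))) \<cdot> (Ide V \<one> \<odot> \<iota> X i)
        = colim (groth_lunit V X) \<cdot> \<mu> (diag_unit V) X \<cdot> (\<eta> \<odot> Ide V (K X)) \<cdot> (Ide V \<one> \<odot> \<iota> X i)"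
      by (simp add: comp_assoc[OF l comp_hom[OF \<eta>K m] a(1)] comp_assoc[OF l \<eta>K m])
    \<comment> \<open>Interchange absorbs the identity leg into \<open>\<eta>\<close>, which is by
      definition the chosen leg at \<open>ustar\<close>; now \<open>\<mu>_leg\<close>
      applies.\<close>
    also have "\<dots> = colim (groth_lunit V X) \<cdot> \<mu> (diag_unit V) X \<cdot> (\<iota> (diag_unit V) ustar \<odot> \<iota> X i)"
      by (simp add: interchange[OF i1 \<eta>_hom li kX] id_right[OF \<eta>_hom] id_left[OF li])
        (simp add: \<eta>_def)
    \<comment> \<open>The unit projection sends the index pair of \<open>ustar\<close> and
      \<open>i\<close> to \<open>i\<close>, so the leg of \<open>X\<close> reappears behind the
      unitor.\<close>
    also have "\<dots> = \<iota> X i \<cdot> LUnit V (fobj (snd X) i)"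
      using a(2)[OF ui] i by (simp add: \<mu>_leg[OF U X u i])
    also have "\<dots> = LUnit V (K X) \<cdot> (Ide V \<one> \<odot> \<iota> X i)"
      by (simp add: LUnit_natural[OF li])
    finally show "(colim (groth_lunit V X) \<cdot> \<mu> (diag_unit V) X \<cdot> (\<eta> \<odot> Ide V (K X))) \<cdot> (Ide V \<one> \<odot> \<iota> X i)
        = LUnit V (K X) \<cdot> (Ide V \<one> \<odot> \<iota> X i)" .
  qed
qed

text \<open>Mirror image of the left unit law, with \<open>unit_colimit\<close> in the second
  slot.\<close>

lemma \<mu>_right_unit:
  assumes X: "X \<in> groth_obj V"
  shows "colim (groth_runit V X) \<cdot> \<mu> X (diag_unit V) \<cdot> (Ide V (K X) \<odot> \<eta>) = RUnit V (K X)"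
proof -
  have U: "(diag_unit V :: ('u, 'o, 'm) diagram) \<in> groth_obj V"
    by (rule diag_unit_obj)
  have DU: "small_category (uterm :: ('u, 'u) cat)" "is_functor (uterm :: ('u, 'u) cat) V (unit_functor V)"
    using diagramD(1,3)[OF U] by (simp_all add: diag_unit_eq)
  have u: "ustar \<in> Obj (fst (diag_unit V :: ('u, 'o, 'm) diagram))"
    by (simp add: diag_unit_eq)
  note D = diagramD[OF X] and a = colim_arr[OF groth_runit_hom[OF X]]
  note kX = ide_hom[OF K_obj[OF X]] and i1 = ide_hom[OF unit_obj] and m = \<mu>_hom[OF X U]
  note K\<eta> = tensor_hom[OF kX \<eta>_hom]
  show ?thesis
  proof (rule tensor_colimit_ext[OF D(1) DU(1) D(3) DU(2) D(4) unit_colimit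
        comp_hom[OF comp_hom[OF K\<eta> m] a(1)] RUnit_hom[OF K_obj[OF X]]])
    fix i j assume i: "i \<in> Obj (fst X)"
    note li = leg_hom[OF X i]
    note l = tensor_hom[OF li i1]
    have iu: "upair (i, ustar) \<in> Obj (fst (diag_tensor V X (diag_unit V)))"
      using u i by simp
    have "(colim (groth_runit V X) \<cdot> \<mu> X (diag_unit V) \<cdot> (Ide V (K X) \<odot> \<eta>)) \<cdot> (\<iota> X i \<odot> Ide V \<one>)
        = colim (groth_runit V X) \<cdot> \<mu> X (diag_unit V) \<cdot> (Ide V (K X) \<odot> \<eta>) \<cdot> (\<iota> X i \<odot> Ide V \<one>)"
      by (simp add: comp_assoc[OF l comp_hom[OF K\<eta> m] a(1)] comp_assoc[OF l K\<eta> m])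
    also have "\<dots> = colim (groth_runit V X) \<cdot> \<mu> X (diag_unit V) \<cdot> (\<iota> X i \<odot> \<iota> (diag_unit V) ustar)"
      by (simp add: interchange[OF li kX i1 \<eta>_hom] id_right[OF \<eta>_hom] id_left[OF li])
        (simp add: \<eta>_def)
    also have "\<dots> = \<iota> X i \<cdot> RUnit V (fobj (snd X) i)"
      using a(2)[OF iu] i by (simp add: \<mu>_leg[OF X U i u])
    also have "\<dots> = RUnit V (K X) \<cdot> (\<iota> X i \<odot> Ide V \<one>)"
      by (simp add: RUnit_natural[OF li])
    finally show "(colim (groth_runit V X) \<cdot> \<mu> X (diag_unit V) \<cdot> (Ide V (K X) \<odot> \<eta>)) \<cdot> (\<iota> X i \<odot> Ide V \<one>)
        = RUnit V (K X) \<cdot> (\<iota> X i \<odot> Ide V \<one>)" .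
  qed
qed

theorem colim_strong_monoidal:
  "strong_monoidal_functor (groth V) V (colim_functor V K \<iota>) \<mu> \<eta>"
proof -
  let ?G = "groth V :: (('u, 'o, 'm) diagram, ('u, 'o, 'm) garr) moncat"
  \<comment> \<open>Naturality is restated for untyped arrows, as the definition of a lax monoidal
    functor asks for it.\<close>
  have "\<mu> (Cod ?G s) (Cod ?G t) \<cdot> (colim s \<odot> colim t) = colim (s \<odot>\<^bsub>?G\<^esub> t) \<cdot> \<mu> (Dom ?G s) (Dom ?G t)"
    if "s \<in> groth_arr V" "t \<in> groth_arr V" for s t
    using \<mu>_natural[of s "Dom ?G s" "Cod ?G s" t "Dom ?G t" "Cod ?G t"] that Arr_hom[of s ?G] Arr_hom[of t ?G]
    by simp
  then show ?thesis
    unfolding strong_monoidal_functor_def lax_monoidal_functor_def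
    by (simp add: monoidal_category_groth monoidal is_functor_colim \<mu>_hom \<eta>_hom \<mu>_assoc \<mu>_left_unit
        \<mu>_right_unit \<mu>_iso \<eta>_iso diag_unit_obj diag_tensor_obj)
qed

end

theorem proposition3p8:
  fixes V :: "('o, 'm) moncat"
    and K :: "('u::infinite, 'o, 'm) diagram \<Rightarrow> 'o"
    and \<iota> :: "('u, 'o, 'm) diagram \<Rightarrow> 'u \<Rightarrow> 'm"
  assumes "monoidal_category V"
    and "cocomplete TYPE('u) V"
    and "\<And>A. A \<in> Obj V \<Longrightarrow> cocontinuous TYPE('u) V V (tensor_left V A)"
    and "\<And>A. A \<in> Obj V \<Longrightarrow> cocontinuous TYPE('u) V V (tensor_right V A)"
    and "colimit_choice V K \<iota>"
  shows "\<exists>\<mu> \<eta>. strong_monoidal_functor (groth V) V (colim_functor V K \<iota>) \<mu> \<eta>"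
proof -
  \<comment> \<open>The witnesses are the maps \<open>\<mu>\<close> and \<open>\<eta>\<close> that
    this instance of the locale builds from the given choice of colimits.\<close>
  interpret chosen_colimits V "TYPE('u)" K \<iota>
    by unfold_locales (fact assms)+
  show ?thesis
    using colim_strong_monoidal by blast
qed

end
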